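(* Let $Y$ be a complex toric variety, with associated tropical space $Y^{\mathrm{trop}}$, and let $X$ be a closed algebraic subvariety of $Y$. Let $A_X\subset Y^{\mathrm{trop}}$ be the image of $X$ under the tropicalization map defined by the Archimedean absolute value on $\mathbf{C}$, and let $X^{\mathrm{trop}}\subset Y^{\mathrm{trop}}$ be the tropicalization of $X$ defined by the trivial norm on $\mathbf{C}$. Then $$\lim_{\rho\to0+}\rho\cdot A_X=X^{\mathrm{trop}},$$ where the limit is in the sense of Kuratowski convergence of subsets of $Y^{\mathrm{trop}}$.
   Context: Varieties are not assumed irreducible. Logarithms are natural and $-\log 0=+\infty$. Toric variety: let $N\simeq\mathbf{Z}^n$ be a lattice, $M=\mathrm{Hom}(N,\mathbf{Z})$, and $\Sigma$ a fan in $N$. For $\sigma\in\Sigma$ let $S_\sigma=\check\sigma\cap M$ (a finitely generated monoid) and $U_\sigma=\mathrm{Spec}\,\mathbf{C}[S_\sigma]$; for $m\in S_\sigma$ write $\chi^m\in\mathbf{C}[S_\sigma]$ for the corresponding character. $Y=Y_\Sigma$ is obtained by gluing the $U_\sigma$ in the usual way. Tropical space: let $\overline{\mathbf{R}}=\mathbf{R}\cup\{+\infty\}$ be the additive topological monoid with its natural topology. For $\sigma\in\Sigma$ let $U_\sigma^{\mathrm{trop}}=\mathrm{Hom}(S_\sigma,\overline{\mathbf{R}})$ be the set of monoid homomorphisms with the topology of pointwise convergence. $Y^{\mathrm{trop}}$ is obtained by gluing the $U^{\mathrm{trop}}_\sigma$, $\sigma\in\Sigma$, along the open embeddings $U_\tau^{\mathrm{trop}}\hookrightarrow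 U_\sigma^{\mathrm{trop}}$ (restriction along $S_\sigma\subset S_\tau$) for $\tau$ a face of $\sigma$. The group $\mathbf{R}_+^*$ of positive reals acts on $Y^{\mathrm{trop}}$ by $(\rho\cdot v)(m)=\rho\,v(m)$, and $\rho\cdot A:=\{\rho\cdot v\mid v\in A\}$. Amoeba: $A_X$ is the set of points of $Y^{\mathrm{trop}}$ given, for $\sigma\in\Sigma$ and a closed (complex) point $x\in X\cap U_\sigma$, by the homomorphism $S_\sigma\ni m\mapsto-\log|\chi^m(x)|_\infty\in\overline{\mathbf{R}}$, where $|\cdot|_\infty$ is the usual absolute value. Tropicalization: the trivial norm on $\mathbf{C}$ is $|0|_0=0$, $|a|_0=1$ for $a\neq0$. $X^{\mathrm{trop}}$ is the image in $Y^{\mathrm{trop}}$ of the Berkovich analytification of $X$ with respect to $|\cdot|_0$; concretely, it is the set of points of $Y^{\mathrm{trop}}$ given, for $\sigma\in\Sigma$, by homomorphisms $S_\sigma\ni m\mapsto-\log|\chi^m|\in\overline{\mathbf{R}}$, where $|\cdot|$ ranges over the multiplicative seminorms on $\mathbf{C}[S_\sigma]$ that restrict to $|\cdot|_0$ on $\mathbf{C}$ and vanish on the ideal of $X\cap U_\sigma$. Kuratowski convergence: for subsets $S_\rho$ ($\rho>0$) and $S$ of a topological space $T$, $\lim_{\rho\to0+}S_\rho=S$ means: (i) for every $v\in T\setminus S$ there are a neighborhood $U$ of $v$ and $\rho_0>0$ such that $S_\rho\cap U=\emptyset$ for $0<\rho<\rho_0$; and (ii) for every $v\in S$ and every neighborhood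 $U$ of $v$ there is $\rho_0>0$ such that $S_\rho\cap U\neq\emptyset$ for $0<\rho<\rho_0$. *)

theory Defs
  imports "HOL-Analysis.Analysis" "HOL-Library.Poly_Mapping" "HOL-Library.Function_Algebras"
begin

text \<open>
  The type \<open>'v\<close> plays the role of \<open>N \<otimes> \<real>\<close> and the lattice \<open>N \<simeq> \<int>\<^sup>n\<close> is the integer span of
  a basis; the rank \<open>n = 0\<close> is allowed. The dual lattice \<open>M = Hom(N, \<int>)\<close> is realised by the linear
  extensions of its elements to \<open>N \<otimes> \<real>\<close>, with pointwise addition.
\<close>

definition is_lattice :: "'v::real_vector set \<Rightarrow> bool" where
  "is_lattice N \<longleftrightarrow> (\<exists>B. finite B \<and> independent B \<and> span B = UNIV \<and>
     N = {\<Sum>b\<in>B. of_int (c b) *\<^sub>R b | c :: 'v \<Rightarrow> int. True})"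

definition dual_lattice :: "'v::real_vector set \<Rightarrow> ('v \<Rightarrow> real) set" where
  "dual_lattice N = {m. linear m \<and> (\<forall>v\<in>N. m v \<in> \<int>)}"

definition rational_polyhedral_cone :: "'v::real_vector set \<Rightarrow> 'v set \<Rightarrow> bool" where
  "rational_polyhedral_cone N \<sigma> \<longleftrightarrow> (\<exists>V. finite V \<and> V \<subseteq> N \<and> \<sigma> = convex_cone hull V)"

definition strongly_convex :: "'v::real_vector set \<Rightarrow> bool" where
  "strongly_convex \<sigma> \<longleftrightarrow> (\<forall>v\<in>\<sigma>. - v \<in> \<sigma> \<longrightarrow> v = 0)"

definition cone_face :: "'v::real_vector set \<Rightarrow> 'v set \<Rightarrow> bool" where
  "cone_face \<tau> \<sigma> \<longleftrightarrow>
     (\<exists>u. linear u \<and> (\<forall>v\<in>\<sigma>. u v \<ge> (0::real)) \<and> \<tau> = {v\<in>\<sigma>. u v = 0})"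

definition fan :: "'v::real_vector set \<Rightarrow> 'v set set \<Rightarrow> bool" where
  "fan N \<Sigma> \<longleftrightarrow> finite \<Sigma> \<and>
     (\<forall>\<sigma>\<in>\<Sigma>. rational_polyhedral_cone N \<sigma> \<and> strongly_convex \<sigma>) \<and>
     (\<forall>\<sigma>\<in>\<Sigma>. \<forall>\<tau>. cone_face \<tau> \<sigma> \<longrightarrow> \<tau> \<in> \<Sigma>) \<and>
     (\<forall>\<sigma>\<in>\<Sigma>. \<forall>\<sigma>'\<in>\<Sigma>. cone_face (\<sigma> \<inter> \<sigma>') \<sigma> \<and> cone_face (\<sigma> \<inter> \<sigma>') \<sigma>')"

definition cone_monoid :: "'v::real_vector set \<Rightarrow> 'v set \<Rightarrow> ('v \<Rightarrow> real) set" where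
  "cone_monoid N \<sigma> = {m \<in> dual_lattice N. \<forall>v\<in>\<sigma>. m v \<ge> 0}"

text \<open>
  Finitely supported functions on the group \<open>'v \<Rightarrow> real\<close>, with the convolution product of
  \<open>Poly_Mapping\<close>; \<open>\<complex>[S\<^sub>\<sigma>]\<close> consists of those supported on \<open>S\<^sub>\<sigma>\<close>.
\<close>

type_synonym 'v regular_fun = "('v \<Rightarrow> real) \<Rightarrow>\<^sub>0 complex"

definition monoid_algebra :: "'v::real_vector set \<Rightarrow> 'v set \<Rightarrow> 'v regular_fun set" where
  "monoid_algebra N \<sigma> = {f. Poly_Mapping.keys f \<subseteq> cone_monoid N \<sigma>}"

definition character :: "('v \<Rightarrow> real) \<Rightarrow> 'v regular_fun" where
  "character m = Poly_Mapping.single m 1"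

definition scalar :: "complex \<Rightarrow> 'v regular_fun" where
  "scalar a = Poly_Mapping.single 0 a"

text \<open>
  Points of a chart \<open>U \<sigma>\<close> are functions on a set \<open>D \<sigma>\<close>, and for a face \<open>\<tau>\<close> of \<open>\<sigma>\<close> the gluing map
  \<open>U \<tau> \<rightarrow> U \<sigma>\<close> is restriction from \<open>D \<tau>\<close> to \<open>D \<sigma> \<subseteq> D \<tau>\<close>. A point of the glued space is a class
  of pairs (cone, point of its chart) for the equivalence relation generated by these maps.
\<close>

type_synonym ('v, 'c, 'd) glued_point = "('v set \<times> ('c \<Rightarrow> 'd)) set"

definition glue_step :: "'v::real_vector set set \<Rightarrow> ('v set \<Rightarrow> 'c set) \<Rightarrow> ('v set \<Rightarrow> ('c \<Rightarrow> 'd) set)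
    \<Rightarrow> 'v set \<times> ('c \<Rightarrow> 'd) \<Rightarrow> 'v set \<times> ('c \<Rightarrow> 'd) \<Rightarrow> bool" where
  "glue_step \<Sigma> D U = (\<lambda>(\<tau>, y) (\<sigma>, x).
     \<tau> \<in> \<Sigma> \<and> \<sigma> \<in> \<Sigma> \<and> cone_face \<tau> \<sigma> \<and> y \<in> U \<tau> \<and> x = restrict y (D \<sigma>))"

definition glue_class :: "'v::real_vector set set \<Rightarrow> ('v set \<Rightarrow> 'c set) \<Rightarrow> ('v set \<Rightarrow> ('c \<Rightarrow> 'd) set)
    \<Rightarrow> 'v set \<Rightarrow> ('c \<Rightarrow> 'd) \<Rightarrow> ('v, 'c, 'd) glued_point" where
  "glue_class \<Sigma> D U \<sigma> x = {p. equivclp (glue_step \<Sigma> D U) (\<sigma>, x) p}"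

text \<open>The complex points of \<open>U\<^sub>\<sigma> = Spec \<complex>[S\<^sub>\<sigma>]\<close>, as \<open>\<complex>\<close>-algebra homomorphisms \<open>f \<mapsto> f(x)\<close>.\<close>

definition affine_points ::
    "'v::real_vector set \<Rightarrow> 'v set \<Rightarrow> ('v regular_fun \<Rightarrow> complex) set" where
  "affine_points N \<sigma> = {x \<in> extensional (monoid_algebra N \<sigma>).
     (\<forall>f\<in>monoid_algebra N \<sigma>. \<forall>g\<in>monoid_algebra N \<sigma>. x (f + g) = x f + x g \<and> x (f * g) = x f * x g) \<and>
     (\<forall>a. x (scalar a) = a)}"

type_synonym 'v toric_point = "('v, 'v regular_fun, complex) glued_point"

definition toric_class ::
    "'v::real_vector set \<Rightarrow> 'v set set \<Rightarrow> 'v set \<Rightarrow> ('v regular_fun \<Rightarrow> complex) \<Rightarrow> 'v toric_point" where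
  "toric_class N \<Sigma> = glue_class \<Sigma> (monoid_algebra N) (affine_points N)"

definition toric_variety :: "'v::real_vector set \<Rightarrow> 'v set set \<Rightarrow> 'v toric_point set" where
  "toric_variety N \<Sigma> = {toric_class N \<Sigma> \<sigma> x | \<sigma> x. \<sigma> \<in> \<Sigma> \<and> x \<in> affine_points N \<sigma>}"

definition chart_part :: "'v::real_vector set \<Rightarrow> 'v set set \<Rightarrow> 'v toric_point set \<Rightarrow> 'v set
    \<Rightarrow> ('v regular_fun \<Rightarrow> complex) set" where
  "chart_part N \<Sigma> X \<sigma> = {x \<in> affine_points N \<sigma>. toric_class N \<Sigma> \<sigma> x \<in> X}"

text \<open>
  A closed subvariety (reduced, possibly reducible) is given by its set of complex points, a
  Zariski closed set: in every chart it is the zero locus of a set of regular functions.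
\<close>

definition closed_subvariety ::
    "'v::real_vector set \<Rightarrow> 'v set set \<Rightarrow> 'v toric_point set \<Rightarrow> bool" where
  "closed_subvariety N \<Sigma> X \<longleftrightarrow> X \<subseteq> toric_variety N \<Sigma> \<and>
     (\<forall>\<sigma>\<in>\<Sigma>. \<exists>F \<subseteq> monoid_algebra N \<sigma>.
        chart_part N \<Sigma> X \<sigma> = {x \<in> affine_points N \<sigma>. \<forall>f\<in>F. x f = 0})"

definition chart_ideal ::
    "'v::real_vector set \<Rightarrow> 'v set set \<Rightarrow> 'v toric_point set \<Rightarrow> 'v set \<Rightarrow> 'v regular_fun set" where
  "chart_ideal N \<Sigma> X \<sigma> = {f \<in> monoid_algebra N \<sigma>. \<forall>x\<in>chart_part N \<Sigma> X \<sigma>. x f = 0}"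

text \<open>The monoid \<open>\<real> \<union> {+\<infinity>}\<close> is the subspace \<open>{-\<infinity><..}\<close> of \<open>ereal\<close>.\<close>

definition trop_chart :: "'v::real_vector set \<Rightarrow> 'v set \<Rightarrow> (('v \<Rightarrow> real) \<Rightarrow> ereal) set" where
  "trop_chart N \<sigma> = {v \<in> cone_monoid N \<sigma> \<rightarrow>\<^sub>E {-\<infinity><..}. v 0 = 0 \<and>
     (\<forall>m\<in>cone_monoid N \<sigma>. \<forall>m'\<in>cone_monoid N \<sigma>. v (m + m') = v m + v m')}"

definition trop_chart_topology ::
    "'v::real_vector set \<Rightarrow> 'v set \<Rightarrow> (('v \<Rightarrow> real) \<Rightarrow> ereal) topology" where
  "trop_chart_topology N \<sigma> = subtopology
     (product_topology (\<lambda>m. top_of_set {-\<infinity><..}) (cone_monoid N \<sigma>)) (trop_chart N \<sigma>)"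

type_synonym 'v trop_point = "('v, 'v \<Rightarrow> real, ereal) glued_point"

definition trop_class ::
    "'v::real_vector set \<Rightarrow> 'v set set \<Rightarrow> 'v set \<Rightarrow> (('v \<Rightarrow> real) \<Rightarrow> ereal) \<Rightarrow> 'v trop_point" where
  "trop_class N \<Sigma> = glue_class \<Sigma> (cone_monoid N) (trop_chart N)"

definition trop_space :: "'v::real_vector set \<Rightarrow> 'v set set \<Rightarrow> 'v trop_point set" where
  "trop_space N \<Sigma> = {trop_class N \<Sigma> \<sigma> v | \<sigma> v. \<sigma> \<in> \<Sigma> \<and> v \<in> trop_chart N \<sigma>}"

definition trop_open :: "'v::real_vector set \<Rightarrow> 'v set set \<Rightarrow> 'v trop_point set \<Rightarrow> bool" where
  "trop_open N \<Sigma> W \<longleftrightarrow> W \<subseteq> trop_space N \<Sigma> \<and>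
     (\<forall>\<sigma>\<in>\<Sigma>. openin (trop_chart_topology N \<sigma>) {v \<in> trop_chart N \<sigma>. trop_class N \<Sigma> \<sigma> v \<in> W})"

definition trop_topology :: "'v::real_vector set \<Rightarrow> 'v set set \<Rightarrow> 'v trop_point topology" where
  "trop_topology N \<Sigma> = topology (trop_open N \<Sigma>)"

lemma topspace_trop_chart_topology: "topspace (trop_chart_topology N \<sigma>) = trop_chart N \<sigma>"
  by (auto simp: trop_chart_topology_def trop_chart_def)

lemma istopology_trop_open: "istopology (trop_open N \<Sigma>)"
  unfolding istopology_def
proof (intro conjI allI impI)
  fix V W assume V: "trop_open N \<Sigma> V" and W: "trop_open N \<Sigma> W"
  have "{v \<in> trop_chart N \<sigma>. trop_class N \<Sigma> \<sigma> v \<in> V \<inter> W} =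
      {v \<in> trop_chart N \<sigma>. trop_class N \<Sigma> \<sigma> v \<in> V} \<inter> {v \<in> trop_chart N \<sigma>. trop_class N \<Sigma> \<sigma> v \<in> W}" for \<sigma>
    by blast
  with V W show "trop_open N \<Sigma> (V \<inter> W)"
    unfolding trop_open_def by auto
next
  fix \<W> assume *: "\<forall>W\<in>\<W>. trop_open N \<Sigma> W"
  have "{v \<in> trop_chart N \<sigma>. trop_class N \<Sigma> \<sigma> v \<in> \<Union>\<W>} =
      \<Union>((\<lambda>W. {v \<in> trop_chart N \<sigma>. trop_class N \<Sigma> \<sigma> v \<in> W}) ` \<W>)" for \<sigma>
    by blast
  with * show "trop_open N \<Sigma> (\<Union>\<W>)"
    unfolding trop_open_def by (auto intro!: openin_Union)
qed

lemma openin_trop_topology: "openin (trop_topology N \<Sigma>) = trop_open N \<Sigma>"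
  by (simp add: trop_topology_def istopology_trop_open)

lemma topspace_trop_topology: "topspace (trop_topology N \<Sigma>) = trop_space N \<Sigma>"
proof (rule antisym)
  show "topspace (trop_topology N \<Sigma>) \<subseteq> trop_space N \<Sigma>"
    using openin_topspace[of "trop_topology N \<Sigma>"]
    unfolding openin_trop_topology trop_open_def by blast
  have "{v \<in> trop_chart N \<sigma>. trop_class N \<Sigma> \<sigma> v \<in> trop_space N \<Sigma>} =
      topspace (trop_chart_topology N \<sigma>)" if "\<sigma> \<in> \<Sigma>" for \<sigma>
    using that by (auto simp: topspace_trop_chart_topology trop_space_def)
  then have "openin (trop_topology N \<Sigma>) (trop_space N \<Sigma>)"
    unfolding openin_trop_topology trop_open_def by simp
  then show "trop_space N \<Sigma> \<subseteq> topspace (trop_topology N \<Sigma>)"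
    by (rule openin_subset)
qed

text \<open>
  The action of \<open>\<rho> > 0\<close> on classes: since \<open>v \<mapsto> \<rho> \<cdot> v\<close> is a bijection of every chart commuting with
  the gluing maps, the image of a class is the class of the image of any representative.
\<close>

definition trop_scale :: "'v::real_vector set \<Rightarrow> real \<Rightarrow> 'v trop_point \<Rightarrow> 'v trop_point" where
  "trop_scale N \<rho> P = (\<lambda>(\<sigma>, v). (\<sigma>, \<lambda>m\<in>cone_monoid N \<sigma>. ereal \<rho> * v m)) ` P"

definition neg_log :: "real \<Rightarrow> ereal" where
  "neg_log t = (if t = 0 then \<infinity> else ereal (- ln t))"

definition amoeba ::
    "'v::real_vector set \<Rightarrow> 'v set set \<Rightarrow> 'v toric_point set \<Rightarrow> 'v trop_point set" where
  "amoeba N \<Sigma> X =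
     {trop_class N \<Sigma> \<sigma> (\<lambda>m\<in>cone_monoid N \<sigma>. neg_log (cmod (x (character m)))) | \<sigma> x.
        \<sigma> \<in> \<Sigma> \<and> x \<in> chart_part N \<Sigma> X \<sigma>}"

definition trivial_norm :: "complex \<Rightarrow> real" where
  "trivial_norm a = (if a = 0 then 0 else 1)"

text \<open>
  Multiplicative seminorms on \<open>\<complex>[S\<^sub>\<sigma>]\<close> extending the trivial norm; the values at \<open>0\<close> and \<open>1\<close>
  are prescribed by the last clause.
\<close>

definition mult_seminorm :: "'v::real_vector set \<Rightarrow> 'v set \<Rightarrow> ('v regular_fun \<Rightarrow> real) \<Rightarrow> bool" where
  "mult_seminorm N \<sigma> s \<longleftrightarrow>
     (\<forall>f\<in>monoid_algebra N \<sigma>. s f \<ge> 0) \<and>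
     (\<forall>f\<in>monoid_algebra N \<sigma>. \<forall>g\<in>monoid_algebra N \<sigma>. s (f + g) \<le> s f + s g \<and> s (f * g) = s f * s g) \<and>
     (\<forall>a. s (scalar a) = trivial_norm a)"

definition tropicalization ::
    "'v::real_vector set \<Rightarrow> 'v set set \<Rightarrow> 'v toric_point set \<Rightarrow> 'v trop_point set" where
  "tropicalization N \<Sigma> X =
     {trop_class N \<Sigma> \<sigma> (\<lambda>m\<in>cone_monoid N \<sigma>. neg_log (s (character m))) | \<sigma> s.
        \<sigma> \<in> \<Sigma> \<and> mult_seminorm N \<sigma> s \<and> (\<forall>f\<in>chart_ideal N \<Sigma> X \<sigma>. s f = 0)}"

text \<open>Convergence as \<open>\<rho> \<rightarrow> 0+\<close>; it suffices to consider open neighbourhoods.\<close>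

definition kuratowski_limit :: "'a topology \<Rightarrow> (real \<Rightarrow> 'a set) \<Rightarrow> 'a set \<Rightarrow> bool" where
  "kuratowski_limit T A L \<longleftrightarrow>
     (\<forall>v \<in> topspace T - L. \<exists>U. openin T U \<and> v \<in> U \<and>
        (\<exists>\<rho>0>0. \<forall>\<rho>. 0 < \<rho> \<and> \<rho> < \<rho>0 \<longrightarrow> A \<rho> \<inter> U = {})) \<and>
     (\<forall>v \<in> L. \<forall>U. openin T U \<and> v \<in> U \<longrightarrow>
        (\<exists>\<rho>0>0. \<forall>\<rho>. 0 < \<rho> \<and> \<rho> < \<rho>0 \<longrightarrow> A \<rho> \<inter> U \<noteq> {}))"

end

theory Submission
  imports Defs "HOL-Computational_Algebra.Primes"
begin

text \<open>
  \<^emph>\<open>Limit points of the rescaled amoebas lie in the tropicalization.\<close> If \<open>- \<rho> log \<bar>\<chi>\<^sup>m(x)\<bar>\<close> approaches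
  \<open>w\<close> as \<open>\<rho> \<rightarrow> 0\<close> with \<open>x\<close> in \<open>X\<close>, then by compactness of products the functions \<open>f \<mapsto> \<bar>f(x)\<bar>\<^sup>\<rho>\<close> have a
  cluster point, and it is a multiplicative seminorm, trivial on constants, vanishing on the ideal
  of \<open>X\<close> and inducing \<open>w\<close>.

  \<^emph>\<open>Conversely,\<close> let a seminorm \<open>s\<close> induce \<open>w\<close>. Adjoining inverses of the characters with finite
  \<open>w\<close>-value, it suffices to find zeros \<open>x\<close> of an ideal in a polynomial ring with
  \<open>\<bar>x\<^sub>j\<bar> \<le> C exp (a\<^sub>j / \<rho>)\<close> for integers \<open>a\<^sub>j\<close>. Because of \<open>s\<close> no element of the ideal has leading
  term \<open>1\<close> for the order given by the weight \<open>a\<close>, ties being broken by a positive form. By Dickson's lemma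
  finitely many elements of the ideal generate the leading terms, and in the weighted
  \<open>l\<^sup>1\<close>-norm of a polydisc of the above shape, \<open>C\<close> large and then \<open>\<rho>\<close> small, their leading terms
  dominate. Hence division by them does not increase norms, so that \<open>1\<close> has distance at least \<open>1\<close>
  from the ideal, and a Gelfand-Mazur argument yields a zero in the polydisc.

  The two parts are local on the charts; they are put together using that faces are cut out by
  integral functionals, so that the charts embed openly into the tropical space.
\<close>


text \<open>The polydisc gives only upper bounds for the coordinates of a zero, while approaching
  \<open>w\<close> needs two-sided ones. A character with finite \<open>w\<close>-value therefore
  enters together with its inverse, as two variables whose product is forced to be 1; a character
  with infinite value gets a strongly negative weight. The inverses need not be regular, so the
  ideal is localised at a character \<open>m0\<close> at which \<open>s\<close> does not vanish. The
  real numbers \<open>log s\<close> do not serve as weights themselves, because the termination of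
  the division relies on integrality. They are multiplied by a large \<open>q\<close> and rounded
  up, and the zero is taken at the parameter \<open>q * \<rho>\<close>; the rounding costs at most
  \<open>1 / q\<close>. A zero is required for every small \<open>\<rho>\<close> and not just along
  a sequence. This is why \<open>C\<close> and the bound on \<open>\<rho>\<close> are fixed before
  any zero is produced: they come from finitely many elements of the ideal.\<close>

section \<open>Seminorms on commutative complex algebras\<close>

text \<open>The algebra is a carrier set and not a type, because the algebras that occur consist of
  finitely supported functions with exponents in a given submonoid. The complex numbers are an
  instance too, used for evaluation at points.\<close>

locale complex_subalgebra =
  fixes sc :: "complex \<Rightarrow> 'a::comm_ring_1" and B :: "'a set"
  assumes sc_add: "sc (a + b) = sc a + sc b"
    and sc_mult: "sc (a * b) = sc a * sc b"
    and sc_1: "sc 1 = 1"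
    and sc_mem: "sc a \<in> B"
    and add_mem: "f \<in> B \<Longrightarrow> g \<in> B \<Longrightarrow> f + g \<in> B"
    and mult_mem: "f \<in> B \<Longrightarrow> g \<in> B \<Longrightarrow> f * g \<in> B"
begin

lemma sc_0: "sc 0 = 0"
  using sc_add[of 0 0] by simp

lemma sc_minus: "sc (- a) = - sc a"
  using sc_add[of a "- a"] by (simp add: sc_0 eq_neg_iff_add_eq_0 add.commute)

lemma sc_diff: "sc (a - b) = sc a - sc b"
  using sc_add[of a "- b"] by (simp add: sc_minus)

lemma sc_power: "sc (a ^ n) = sc a ^ n"
  by (induction n) (auto simp: sc_1 sc_mult)

lemma sc_of_nat: "sc (of_nat n) = of_nat n"
  by (induction n) (auto simp: sc_0 sc_1 sc_add)

lemma sc_sum: "sc (\<Sum>i\<in>I. h i) = (\<Sum>i\<in>I. sc (h i))"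
  by (induction I rule: infinite_finite_induct) (auto simp: sc_0 sc_add)

lemma one_mem: "1 \<in> B" and zero_mem: "0 \<in> B"
  using sc_mem[of 1] sc_mem[of 0] by (simp_all add: sc_0 sc_1)

lemma minus_mem: "f \<in> B \<Longrightarrow> - f \<in> B"
  using mult_mem[OF sc_mem[of "-1"], of f] by (simp add: sc_minus sc_1)

lemma diff_mem: "f \<in> B \<Longrightarrow> g \<in> B \<Longrightarrow> f - g \<in> B"
  using add_mem[OF _ minus_mem] by fastforce

lemma power_mem: "f \<in> B \<Longrightarrow> f ^ n \<in> B"
  by (induction n) (auto simp: one_mem mult_mem)

lemma sum_mem: "(\<And>i. i \<in> I \<Longrightarrow> h i \<in> B) \<Longrightarrow> sum h I \<in> B"
  by (induction I rule: infinite_finite_induct) (auto simp: zero_mem add_mem)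

lemmas mem_intros = sc_mem add_mem mult_mem one_mem zero_mem minus_mem diff_mem power_mem sum_mem

text \<open>Submultiplicative and Archimedean on scalars, in contrast to
  \<open>mult_seminorm\<close>. The bound on scalars is an equality by \<open>q 1 = 1\<close>, see
  \<open>q_sc\<close>.\<close>

definition seminorm :: "('a \<Rightarrow> real) \<Rightarrow> bool" where
  "seminorm q \<longleftrightarrow> (\<forall>f\<in>B. 0 \<le> q f) \<and> (\<forall>f\<in>B. \<forall>g\<in>B. q (f + g) \<le> q f + q g) \<and>
     (\<forall>f\<in>B. \<forall>g\<in>B. q (f * g) \<le> q f * q g) \<and> (\<forall>z. q (sc z) \<le> cmod z) \<and> q 1 = 1"

context
  fixes q assumes q: "seminorm q"
begin

lemma q_nonneg: "f \<in> B \<Longrightarrow> 0 \<le> q f"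
  and q_add: "f \<in> B \<Longrightarrow> g \<in> B \<Longrightarrow> q (f + g) \<le> q f + q g"
  and q_mult: "f \<in> B \<Longrightarrow> g \<in> B \<Longrightarrow> q (f * g) \<le> q f * q g"
  and q_sc_le: "q (sc z) \<le> cmod z"
  and q_one: "q 1 = 1"
  using q by (auto simp: seminorm_def)

lemma q_zero: "q 0 = 0"
  using q_sc_le[of 0] q_nonneg[OF zero_mem] by (simp add: sc_0)

lemma q_scale: "f \<in> B \<Longrightarrow> q (sc z * f) = cmod z * q f"
proof (cases "z = 0")
  case False
  assume f: "f \<in> B"
  have le: "q (sc w * g) \<le> cmod w * q g" if "g \<in> B" for w g
    using q_mult[OF sc_mem[of w] that] mult_right_mono[OF q_sc_le[of w] q_nonneg[OF that]] by linarith
  have "sc (1 / z) * (sc z * f) = f"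
    using False by (simp flip: mult.assoc sc_mult add: sc_1)
  then have "q f \<le> cmod (1 / z) * q (sc z * f)"
    using le[of "sc z * f" "1 / z"] f by (simp add: mem_intros)
  then have "cmod z * q f \<le> q (sc z * f)"
    using False by (simp add: norm_divide field_simps)
  with le[OF f] show ?thesis by (simp add: antisym)
qed (simp add: sc_0 q_zero)

lemma q_sc: "q (sc z) = cmod z"
  using q_scale[OF one_mem, of z] by (simp add: q_one)

lemma q_minus: "f \<in> B \<Longrightarrow> q (- f) = q f"
  using q_scale[of f "-1"] by (simp add: sc_minus sc_1)

lemma q_diff: "f \<in> B \<Longrightarrow> g \<in> B \<Longrightarrow> q (f - g) \<le> q f + q g"
  using q_add[of f "- g"] by (simp add: q_minus mem_intros)

lemma q_diff_ge: "f \<in> B \<Longrightarrow> g \<in> B \<Longrightarrow> q f - q g \<le> q (f - g)"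
  using q_add[of "f - g" g] by (simp add: mem_intros)

lemma q_power: "f \<in> B \<Longrightarrow> q (f ^ n) \<le> q f ^ n"
proof (induction n)
  case (Suc n)
  then show ?case
    using q_mult[of f "f ^ n"] mult_left_mono[OF Suc.IH q_nonneg[of f]] by (force simp: mem_intros)
qed (simp add: q_one)

lemma q_sum: "(\<And>i. i \<in> I \<Longrightarrow> h i \<in> B) \<Longrightarrow> q (sum h I) \<le> (\<Sum>i\<in>I. q (h i))"
proof (induction I rule: infinite_finite_induct)
  case (insert i I)
  then have "q (h i + sum h I) \<le> q (h i) + q (sum h I)"
    by (intro q_add sum_mem) auto
  with insert show ?case by force
qed (simp_all add: q_zero)

end

text \<open>The quotient seminorm is the distance to the ideal \<open>L\<close>. Hypothesis
  \<open>far\<close> is properness of \<open>L\<close> in quantitative form; it keeps the norm of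
  \<open>1\<close> equal to 1.\<close>

lemma quotient_seminorm:
  assumes q: "seminorm q" and L: "L \<subseteq> B" "L \<noteq> {}"
    and L_add: "\<And>f g. f \<in> L \<Longrightarrow> g \<in> L \<Longrightarrow> f + g \<in> L"
    and L_mult: "\<And>f g. f \<in> B \<Longrightarrow> g \<in> L \<Longrightarrow> f * g \<in> L"
    and far: "\<And>l. l \<in> L \<Longrightarrow> 1 \<le> q (1 - l)"
  obtains q' where "seminorm q'" "\<And>f. f \<in> B \<Longrightarrow> q' f \<le> q f" "\<And>f. f \<in> L \<Longrightarrow> q' f = 0"
proof
  define q' where "q' f = (INF l\<in>L. q (f - l))" for f
  have L0: "0 \<in> L" using L L_mult[OF zero_mem] by fastforce
  have LB: "l \<in> B" if "l \<in> L" for l using that L by blast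
  have bdd: "bdd_below ((\<lambda>l. q (f - l)) ` L)" if "f \<in> B" for f
    using that by (intro bdd_belowI2[where m = 0] q_nonneg[OF q] diff_mem[OF _ LB])
  have le: "q' f \<le> q (f - l)" if "f \<in> B" "l \<in> L" for f l
    unfolding q'_def using that by (intro cINF_lower bdd)
  have ge: "c \<le> q' f" if "\<And>l. l \<in> L \<Longrightarrow> c \<le> q (f - l)" for c f
    unfolding q'_def using L(2) that by (intro cINF_greatest) auto
  have approx: "\<exists>l\<in>L. q (f - l) < q' f + e" if "f \<in> B" "e > 0" for f e
  proof (rule ccontr)
    assume "\<not> (\<exists>l\<in>L. q (f - l) < q' f + e)"
    then have "q' f + e \<le> q' f" by (intro ge) auto
    with that show False by simp
  qed
  show le': "q' f \<le> q f" if "f \<in> B" for f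
    using le[OF that L0] by simp
  have nn: "0 \<le> q' f" if "f \<in> B" for f
    using that by (intro ge q_nonneg[OF q] diff_mem[OF _ LB])
  show "q' f = 0" if "f \<in> L" for f
    using le[OF LB[OF that] that] nn[OF LB[OF that]] by (simp add: q_zero[OF q])
  show "seminorm q'"
    unfolding seminorm_def
  proof (intro conjI ballI allI)
    fix f g assume f: "f \<in> B" and g: "g \<in> B"
    show "q' (f + g) \<le> q' f + q' g"
    proof (rule field_le_epsilon)
      fix e :: real assume e: "e > 0"
      obtain k l where k: "k \<in> L" "q (f - k) < q' f + e / 2" and l: "l \<in> L" "q (g - l) < q' g + e / 2"
        using approx[OF f, of "e/2"] approx[OF g, of "e/2"] e by auto
      have "q' (f + g) \<le> q ((f + g) - (k + l))"
        by (rule le) (auto intro!: add_mem f g L_add k l)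
      also have "\<dots> \<le> q (f - k) + q (g - l)"
        using q_add[OF q, of "f - k" "g - l"] by (simp add: f g k l LB mem_intros algebra_simps)
      finally show "q' (f + g) \<le> q' f + q' g + e" using k l by simp
    qed
    show "q' (f * g) \<le> q' f * q' g"
    proof (rule ccontr)
      assume "\<not> q' (f * g) \<le> q' f * q' g"
      then have "q' (f * g) > q' f * q' g" by simp
      moreover have "((\<lambda>e. (q' f + e) * (q' g + e)) \<longlongrightarrow> (q' f + 0) * (q' g + 0)) (at_right 0)"
        by (intro tendsto_intros)
      ultimately have "eventually (\<lambda>e. (q' f + e) * (q' g + e) < q' (f * g) \<and> e > 0) (at_right 0)"
        by (intro eventually_conj order_tendstoD(2)[where y = "(q' f + 0) * (q' g + 0)"] eventually_at_right_less) auto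
      then obtain e where e: "e > 0" "(q' f + e) * (q' g + e) < q' (f * g)"
        by (auto dest: eventually_happens)
      obtain k l where k: "k \<in> L" "q (f - k) < q' f + e" and l: "l \<in> L" "q (g - l) < q' g + e"
        using approx[OF f, of "e"] approx[OF g, of "e"] e by auto
      \<comment> \<open>The product of two nearly optimal representatives differs from
        \<open>f * g\<close> by an element of \<open>L\<close>, so it represents the class of the
        product.\<close>
      have "f * g - (f - k) * (g - l) = f * l + (g - l) * k" by (simp add: algebra_simps)
      also have "\<dots> \<in> L" by (intro L_add L_mult f g diff_mem k l LB)
      finally have "q' (f * g) \<le> q (f * g - (f * g - (f - k) * (g - l)))"
        by (intro le mem_intros f g)
      also have "\<dots> = q ((f - k) * (g - l))" by simp
      also have "\<dots> \<le> q (f - k) * q (g - l)"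
        by (intro q_mult[OF q] diff_mem f g k l LB)
      also have "\<dots> \<le> (q' f + e) * (q' g + e)"
        using k l e nn[OF f] nn[OF g] by (intro mult_mono q_nonneg[OF q] diff_mem[OF _ LB]) (auto simp: f g)
      finally show False using e by simp
    qed
  next
    show "q' (sc z) \<le> cmod z" for z
      using le'[OF sc_mem] q_sc[OF q] by metis
    show "q' 1 = 1"
      using le'[OF one_mem] ge[of 1 1] far q_one[OF q] by (auto intro: antisym)
  qed (use nn in auto)
qed


text \<open>
  No completion of the algebra is needed: if every \<open>T - \<zeta>\<close> were invertible up
  to a small error, then multiplication by \<open>T - \<zeta>\<close> would be bounded below uniformly on compact sets
  of \<open>\<zeta>\<close>, and comparing the averages of the resolvents over \<open>n\<close>-th roots of unity on two circles
  slightly outside and inside the spectral radius would show that the latter can be decreased.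
\<close>

lemma spectrum_nonempty:
  assumes q: "seminorm q" and T: "T \<in> B"
  shows "\<exists>\<zeta>. \<forall>h\<in>B. 1 \<le> q (1 - h * (T - sc \<zeta>))"
proof (rule ccontr)
  assume "\<not> ?thesis"
  then have inv: "\<exists>h\<in>B. q (1 - h * (T - sc \<zeta>)) < 1" for \<zeta>
    by (meson not_le)
  \<comment> \<open>Multiplication by \<open>T - sc \<zeta>\<close> is bounded below by
    \<open>1 / M\<close>; this stands in for an inverse of norm at most \<open>M\<close>.\<close>
  define bb where "bb M \<zeta> \<longleftrightarrow> M > 0 \<and> (\<forall>f\<in>B. q f \<le> M * q (f * (T - sc \<zeta>)))" for M \<zeta>
  note nn = q_nonneg[OF q]
  have bb_mono: "bb M' \<zeta>" if "bb M \<zeta>" "M \<le> M'" for M M' \<zeta>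
    unfolding bb_def
  proof (intro conjI ballI)
    show "0 < M'" using that by (auto simp: bb_def)
    fix f assume f: "f \<in> B"
    have "q f \<le> M * q (f * (T - sc \<zeta>))" using that f by (auto simp: bb_def)
    also have "\<dots> \<le> M' * q (f * (T - sc \<zeta>))"
      using that f T by (intro mult_right_mono nn mem_intros)
    finally show "q f \<le> M' * q (f * (T - sc \<zeta>))" .
  qed
  have ex_bb: "\<exists>M. bb M \<zeta>" for \<zeta>
  proof -
    obtain h where h: "h \<in> B" "q (1 - h * (T - sc \<zeta>)) < 1" using inv by blast
    define e where "e = q (1 - h * (T - sc \<zeta>))"
    have e: "e < 1" using h by (simp add: e_def)
    have "q f \<le> (q h / (1 - e) + 1) * q (f * (T - sc \<zeta>))" if f: "f \<in> B" for f
    proof -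
      have "f = h * (f * (T - sc \<zeta>)) + f * (1 - h * (T - sc \<zeta>))" by (simp add: algebra_simps)
      then have "q f = q (h * (f * (T - sc \<zeta>)) + f * (1 - h * (T - sc \<zeta>)))" by simp
      also have "\<dots> \<le> q (h * (f * (T - sc \<zeta>))) + q (f * (1 - h * (T - sc \<zeta>)))"
        by (intro q_add[OF q] mem_intros f h T)
      also have "\<dots> \<le> q h * q (f * (T - sc \<zeta>)) + q f * e"
        unfolding e_def by (intro add_mono q_mult[OF q] mem_intros f h T)
      finally have "(1 - e) * q f \<le> q h * q (f * (T - sc \<zeta>))" by (simp add: algebra_simps)
      then have "q f \<le> q h / (1 - e) * q (f * (T - sc \<zeta>))" using e by (simp add: field_simps)
      moreover have "0 \<le> q (f * (T - sc \<zeta>))" by (intro nn mem_intros f T)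
      ultimately show ?thesis by (simp add: distrib_right)
    qed
    moreover have "q h / (1 - e) + 1 > 0" using nn[OF h(1)] e by (smt (verit) divide_nonneg_pos)
    ultimately show ?thesis unfolding bb_def by blast
  qed
  \<comment> \<open>Moving \<open>\<zeta>\<close> by \<open>1 / (2 * M)\<close> costs at most half
    of the lower bound, so being bounded below is an open condition and compactness applies.\<close>
  have bb_near: "bb (2 * M) \<mu>" if M: "bb M \<zeta>" and d: "cmod (\<mu> - \<zeta>) \<le> 1 / (2 * M)" for M \<zeta> \<mu>
    unfolding bb_def
  proof (intro conjI ballI)
    have M0: "M > 0" using M by (simp add: bb_def)
    then show "0 < 2 * M" by simp
    fix f assume f: "f \<in> B"
    have "f * (T - sc \<zeta>) = f * (T - sc \<mu>) + sc (\<mu> - \<zeta>) * f" by (simp add: algebra_simps sc_diff)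
    then have "q (f * (T - sc \<zeta>)) \<le> q (f * (T - sc \<mu>)) + cmod (\<mu> - \<zeta>) * q f"
      using q_add[OF q, of "f * (T - sc \<mu>)" "sc (\<mu> - \<zeta>) * f"] by (simp add: f T mem_intros q_scale[OF q])
    also have "\<dots> \<le> q (f * (T - sc \<mu>)) + 1 / (2 * M) * q f"
      using d nn[OF f] by (intro add_left_mono mult_right_mono)
    finally have "M * q (f * (T - sc \<zeta>)) \<le> M * (q (f * (T - sc \<mu>)) + 1 / (2 * M) * q f)"
      using M0 by (intro mult_left_mono) auto
    moreover have "q f \<le> M * q (f * (T - sc \<zeta>))" using M f by (simp add: bb_def)
    ultimately show "q f \<le> 2 * M * q (f * (T - sc \<mu>))" using M0 by (simp add: algebra_simps)
  qed
  have unif: "\<exists>M. \<forall>\<zeta>\<in>cball 0 R. bb M \<zeta>" for R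
  proof -
    obtain Mf where Mf: "\<And>\<zeta>. bb (Mf \<zeta>) \<zeta>" using ex_bb by metis
    have Mf0: "Mf \<zeta> > 0" for \<zeta> using Mf[of \<zeta>] by (simp add: bb_def)
    obtain C where C: "C \<subseteq> cball 0 R" "finite C" "cball 0 R \<subseteq> (\<Union>c\<in>C. ball c (1 / (2 * Mf c)))"
      by (rule compactE_image[of "cball 0 R" "cball 0 R" "\<lambda>c. ball c (1 / (2 * Mf c))"])
        (use Mf0 in \<open>auto intro!: bexI\<close>)
    have "bb (Max (insert 1 ((\<lambda>c. 2 * Mf c) ` C))) \<zeta>" if z: "\<zeta> \<in> cball 0 R" for \<zeta>
    proof -
      obtain c where c: "c \<in> C" "\<zeta> \<in> ball c (1 / (2 * Mf c))" using z C by blast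
      have "bb (2 * Mf c) \<zeta>"
        by (rule bb_near[OF Mf]) (use c in \<open>auto simp: dist_norm norm_minus_commute\<close>)
      then show ?thesis by (rule bb_mono) (use c C in auto)
    qed
    then show ?thesis by blast
  qed
  \<comment> \<open>Exponential growth rates of the powers of \<open>T\<close>; their infimum
    \<open>r\<close> is the spectral radius.\<close>
  define G where "G = {R. R > 0 \<and> (\<exists>C. \<forall>n. q (T ^ n) \<le> C * R ^ n)}"
  have G1: "q T + 1 \<in> G"
  proof -
    have "q (T ^ n) \<le> 1 * (q T + 1) ^ n" for n
      using q_power[OF q T, of n] power_mono[of "q T" "q T + 1" n] nn[OF T] by simp
    then show ?thesis using nn[OF T] unfolding G_def by (auto intro!: exI[of _ 1])
  qed
  define r where "r = Inf G"
  have bddG: "bdd_below G" by (rule bdd_belowI[of _ 0]) (auto simp: G_def)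
  obtain M0 where M0: "bb M0 0" using ex_bb by blast
  have M0_pos: "M0 > 0" using M0 by (simp add: bb_def)
  \<comment> \<open>Iterating the lower bound at \<open>\<zeta> = 0\<close> gives
    \<open>q (T ^ n) \<ge> 1 / M0 ^ n\<close>. Hence \<open>r > 0\<close>, and there is room for a
    circle inside the one of radius \<open>r\<close>.\<close>
  have low: "1 / M0 \<le> R" if R: "R \<in> G" for R
  proof (rule ccontr)
    assume "\<not> 1 / M0 \<le> R"
    then have lt: "M0 * R < 1" using M0_pos by (simp add: field_simps)
    have R0: "R > 0" using R by (simp add: G_def)
    obtain C where C: "\<And>n. q (T ^ n) \<le> C * R ^ n" using R by (auto simp: G_def)
    have "1 \<le> M0 ^ n * q (T ^ n)" for n
    proof (induction n)
      case (Suc n)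
      have "q (T ^ n) \<le> M0 * q (T ^ n * (T - sc 0))"
        using M0 T by (auto simp: bb_def mem_intros)
      then have "M0 ^ n * q (T ^ n) \<le> M0 ^ n * (M0 * q (T ^ Suc n))"
        using M0_pos by (intro mult_left_mono) (auto simp: sc_0 mult.commute)
      with Suc show ?case by (simp add: mult_ac)
    qed (simp add: q_one[OF q])
    then have "1 \<le> C * (M0 * R) ^ n" for n
      using C[of n] mult_left_mono[OF C[of n], of "M0 ^ n"] M0_pos
      by (smt (verit) mult.assoc mult.commute power_mult_distrib zero_le_power)
    moreover have "(\<lambda>n. C * (M0 * R) ^ n) \<longlonglongrightarrow> C * 0"
      using lt M0_pos R0 by (intro tendsto_intros LIMSEQ_power_zero) (auto simp: abs_mult)
    ultimately have "1 \<le> C * 0" by (intro LIMSEQ_le_const) auto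
    then show False by simp
  qed
  have r_ge: "1 / M0 \<le> r" unfolding r_def using G1 low by (intro cInf_greatest) auto
  then have r0: "r > 0" using M0_pos by (smt (verit) divide_pos_pos)
  obtain M where M: "\<And>\<zeta>. cmod \<zeta> \<le> r + 1 \<Longrightarrow> bb M \<zeta>"
    using unif[of "r + 1"] by (metis mem_cball_0)
  have M_pos: "M > 0" using M[of 0] r0 by (simp add: bb_def)
  define K where "K = M * (r + 1)"
  have K0: "K \<ge> 0" using M_pos r0 by (simp add: K_def)
  \<comment> \<open>Up to the scalar \<open>- w / R\<close>, the element
    \<open>1 - sc (w / R) * T\<close> is \<open>T - sc \<zeta>\<close> with \<open>\<zeta>\<close>
    on the circle of radius \<open>R\<close>; so one constant serves both circles and all roots of
    unity.\<close>
  have bK: "q f \<le> K * q (f * (1 - sc (w / R) * T))"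
    if f: "f \<in> B" and R: "0 < R" "R \<le> r + 1" and w: "cmod w = 1" for f R w
  proof -
    have w0: "w \<noteq> 0" using w by auto
    define \<zeta> where "\<zeta> = R / w"
    have l: "cmod \<zeta> = R" using w R by (simp add: \<zeta>_def norm_divide)
    have e: "sc (- (w / R)) * (T - sc \<zeta>) = 1 - sc (w / R) * T"
      using R w0 by (simp add: \<zeta>_def algebra_simps sc_minus flip: sc_mult) (simp add: sc_1)
    have "q f \<le> M * q (f * (T - sc \<zeta>))" using M[of \<zeta>] l R f by (auto simp: bb_def)
    also have "q (f * (1 - sc (w / R) * T)) = q (sc (- (w / R)) * (f * (T - sc \<zeta>)))"
      unfolding e[symmetric] by (simp only: mult_ac)
    then have "q (f * (T - sc \<zeta>)) = R * q (f * (1 - sc (w / R) * T))"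
      using R w by (simp add: q_scale[OF q] mem_intros f T norm_divide)
    also have "M * (R * q (f * (1 - sc (w / R) * T))) \<le> M * ((r + 1) * q (f * (1 - sc (w / R) * T)))"
      using M_pos R by (intro mult_left_mono mult_right_mono nn mem_intros f T) auto
    finally show ?thesis by (simp add: K_def mult_ac)
  qed
  \<comment> \<open>The bound \<open>r / 2\<close> gives
    \<open>r\<^sup>2 - d\<^sup>2 \<ge> 3 * r\<^sup>2 / 4\<close>, hence
    \<open>1 / R' - 1 / R \<le> 8 * d / (3 * r\<^sup>2)\<close> for the radii \<open>r - d\<close>
    and \<open>r + d\<close>; the last entry then makes \<open>\<epsilon> \<le> 1 / 4\<close>. The
    first entry keeps \<open>R\<close> below \<open>r + 1\<close>.\<close>
  define d where "d = Min {1/2, r / 2, 1 / (4 * (8 / (3 * r\<^sup>2) * (q T * K\<^sup>2) + 1))}"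
  have c0: "0 \<le> 8 / (3 * r\<^sup>2) * (q T * K\<^sup>2)" using nn[OF T] r0 by simp
  have d: "0 < d" "d \<le> 1/2" "d \<le> r / 2" "d \<le> 1 / (4 * (8 / (3 * r\<^sup>2) * (q T * K\<^sup>2) + 1))"
    using c0 r0 unfolding d_def by (auto simp del: mult_pos_pos intro!: divide_pos_pos add_nonneg_pos)
  define R where "R = r + d"
  define R' where "R' = r - d"
  have RR: "0 < R" "0 < R'" "R' < R" "R \<le> r + 1" "R' \<le> r + 1" using d r0 by (auto simp: R_def R'_def)
  define \<epsilon> where "\<epsilon> = q T * K\<^sup>2 * (1 / R' - 1 / R)"
  have eps: "\<epsilon> \<le> 1 / 4"
  proof -
    have "1 / R' - 1 / R = 2 * d / (r\<^sup>2 - d\<^sup>2)"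
      using RR by (simp add: R_def R'_def field_simps power2_eq_square)
    also have "d\<^sup>2 \<le> (r / 2)\<^sup>2" using d by (intro power_mono) auto
    then have le: "3 * r\<^sup>2 / 4 \<le> r\<^sup>2 - d\<^sup>2" by (simp add: power_divide)
    have pos: "0 < 3 * r\<^sup>2 / 4" using r0 by simp
    with le have "2 * d / (r\<^sup>2 - d\<^sup>2) \<le> 2 * d / (3 * r\<^sup>2 / 4)"
      using d by (intro divide_left_mono mult_pos_pos) linarith+
    finally have "\<epsilon> \<le> q T * K\<^sup>2 * (2 * d / (3 * r\<^sup>2 / 4))"
      unfolding \<epsilon>_def using nn[OF T] by (intro mult_left_mono) auto
    also have "\<dots> = 8 / (3 * r\<^sup>2) * (q T * K\<^sup>2) * d" by simp
    also have "\<dots> \<le> 8 / (3 * r\<^sup>2) * (q T * K\<^sup>2) * (1 / (4 * (8 / (3 * r\<^sup>2) * (q T * K\<^sup>2) + 1)))"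
      using c0 d by (intro mult_left_mono) auto
    also have "\<dots> \<le> 1 / 4"
    proof -
      have "x * (1 / (4 * (x + 1))) \<le> 1 / 4" if "x \<ge> 0" for x :: real
        using that by (simp add: field_simps)
      from this[OF c0] show ?thesis .
    qed
    finally show ?thesis .
  qed
  have key: "q (T ^ n) / R' ^ n - q (T ^ n) / R ^ n \<le> \<epsilon> * ((1 + q (T ^ n) / R ^ n) * (1 + q (T ^ n) / R' ^ n))"
    if n: "n > 0" for n
  proof -
    define x where "x = sc (1 / R) * T"
    define y where "y = sc (1 / R') * T"
    define w where "w k = cis (2 * pi * real k / real n)" for k
    have w1: "cmod (w k) = 1" for k by (simp add: w_def)
    have wn: "w k ^ n = 1" for k
      using n by (simp add: w_def Complex.DeMoivre)
    have xB: "x \<in> B" "y \<in> B" by (auto simp: x_def y_def intro!: mem_intros T)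
    \<comment> \<open>This is \<open>1 - z ^ n\<close> times the resolvent at the point
      \<open>w k\<close>, written as a finite geometric sum so that nothing has to be
      inverted.\<close>
    define P where "P z k = (\<Sum>i<n. (sc (w k) * z) ^ i)" for z k
    have PB: "P z k \<in> B" if "z \<in> B" for z k unfolding P_def by (intro mem_intros that)
    have P1: "P z k * (1 - sc (w k) * z) = 1 - z ^ n" for z k
    proof -
      have "(1 - sc (w k) * z) * P z k = 1 - (sc (w k) * z) ^ n"
        unfolding P_def by (rule one_diff_power_eq[symmetric])
      also have "(sc (w k) * z) ^ n = z ^ n" by (simp add: power_mult_distrib wn sc_1 flip: sc_power)
      finally show ?thesis by (simp add: mult.commute)
    qed
    \<comment> \<open>Orthogonality of the characters of the group of \<open>n\<close>-th roots of
      unity: only the term \<open>i = 0\<close> survives.\<close>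
    have Psum: "(\<Sum>k<n. P z k) = of_nat n" for z
    proof -
      have s0: "(\<Sum>k<n. w k ^ i) = (if i = 0 then of_nat n else 0)" if "i < n" for i
      proof (cases "i = 0")
        case False
        define v where "v = cis (2 * pi * real i / real n)"
        have "w k ^ i = v ^ k" for k
          by (simp add: w_def v_def Complex.DeMoivre mult_ac)
        moreover have "v ^ n = 1" using n by (simp add: v_def Complex.DeMoivre)
        moreover have "v \<noteq> 1"
        proof
          assume "v = 1"
          then have "cos (2 * pi * real i / real n) = 1" by (simp add: v_def complex_eq_iff)
          then obtain m :: int where "2 * pi * real i / real n = of_int m * 2 * pi"
            by (auto simp: cos_one_2pi_int)
          then have "real i = real_of_int m * real n" using n by (simp add: field_simps)
          then have "int i = m * int n" by (metis of_int_eq_iff of_int_mult of_int_of_nat_eq)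
          moreover from this have "m > 0" using False n by (metis of_nat_0_less_iff zero_less_mult_pos2 bot_nat_0.not_eq_extremum)
          ultimately show False using that n
            by (smt (verit) mult_le_cancel_right1 of_nat_less_iff of_nat_0_less_iff)
        qed
        ultimately have "(\<Sum>k<n. w k ^ i) = 0" by (simp add: geometric_sum)
        with False show ?thesis by simp
      qed simp
      have "(\<Sum>k<n. P z k) = (\<Sum>i<n. sc (\<Sum>k<n. w k ^ i) * z ^ i)"
        unfolding P_def by (subst sum.swap) (simp add: power_mult_distrib sc_sum sum_distrib_right sc_power)
      also have "\<dots> = (\<Sum>i<n. if i = 0 then of_nat n else 0)"
        by (intro sum.cong) (auto simp: s0 sc_0 sc_of_nat)
      finally show ?thesis using n by simp
    qed
    define AB where "AB = (1 - x ^ n) * (1 - y ^ n)"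
    have ABB: "AB \<in> B" unfolding AB_def by (intro mem_intros xB)
    \<comment> \<open>The resolvent identity, multiplied by \<open>(1 - x ^ n) * (1 - y ^ n)\<close>
      and summed over the roots of unity. What it gains is the small factor
      \<open>x - y\<close>.\<close>
    have id: "of_nat n * (x ^ n - y ^ n) = (\<Sum>k<n. P x k * P y k * (sc (w k) * (x - y)))"
    proof -
      have "of_nat n * (x ^ n - y ^ n) = of_nat n * (1 - y ^ n) - of_nat n * (1 - x ^ n)"
        by (simp add: algebra_simps)
      also have "\<dots> = (\<Sum>k<n. P x k) * (1 - y ^ n) - (\<Sum>k<n. P y k) * (1 - x ^ n)"
        by (simp add: Psum)
      also have "\<dots> = (\<Sum>k<n. P x k * (1 - y ^ n) - P y k * (1 - x ^ n))"
        by (simp add: sum_distrib_right sum_subtractf)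
      also have "\<dots> = (\<Sum>k<n. P x k * P y k * (sc (w k) * (x - y)))"
      proof (intro sum.cong refl)
        fix k
        have "P x k * (1 - y ^ n) - P y k * (1 - x ^ n)
            = P x k * (P y k * (1 - sc (w k) * y)) - P y k * (P x k * (1 - sc (w k) * x))"
          by (simp only: P1)
        also have "\<dots> = P x k * P y k * (sc (w k) * (x - y))" by (simp add: algebra_simps)
        finally show "P x k * (1 - y ^ n) - P y k * (1 - x ^ n) = P x k * P y k * (sc (w k) * (x - y))" .
      qed
      finally show ?thesis .
    qed
    \<comment> \<open>Each application of \<open>bK\<close> cancels one resolvent. The result no
      longer depends on \<open>k\<close>, so that averaging loses nothing.\<close>
    have PP: "q (P x k * P y k) \<le> K\<^sup>2 * q AB" for k
    proof -
      have swx: "sc (w k) * x = sc (w k / R) * T" and swy: "sc (w k) * y = sc (w k / R') * T"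
        by (simp_all add: x_def y_def divide_inverse sc_mult mult_ac)
      have "q (P x k * P y k) \<le> K * q (P x k * P y k * (1 - sc (w k) * x))"
        unfolding swx by (intro bK mem_intros PB xB RR w1)
      also have "P x k * P y k * (1 - sc (w k) * x) = P y k * (1 - x ^ n)"
        unfolding P1[of x k, symmetric] by (simp add: mult_ac)
      also have "q (P y k * (1 - x ^ n)) \<le> K * q (P y k * (1 - x ^ n) * (1 - sc (w k) * y))"
        unfolding swy by (intro bK mem_intros PB xB RR w1)
      also have "P y k * (1 - x ^ n) * (1 - sc (w k) * y) = AB"
        unfolding AB_def P1[of y k, symmetric] by (simp add: mult_ac)
      finally show ?thesis using K0 by (simp add: power2_eq_square mult_left_mono mult.assoc)
    qed
    have xy: "q (sc (w k) * (x - y)) = (1 / R' - 1 / R) * q T" for k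
    proof -
      have "x - y = sc (complex_of_real (1 / R - 1 / R')) * T"
        by (simp add: x_def y_def algebra_simps sc_diff)
      then have "q (sc (w k) * (x - y)) = \<bar>1 / R - 1 / R'\<bar> * q T"
        using w1 by (simp add: q_scale[OF q] mem_intros T norm_of_real del: of_real_diff of_real_divide)
      also have "\<bar>1 / R - 1 / R'\<bar> = 1 / R' - 1 / R" using RR by (simp add: frac_le)
      finally show ?thesis .
    qed
    have nB: "q (of_nat n * f) = real n * q f" if "f \<in> B" for f
      using q_scale[OF q that, of "of_nat n"] by (simp add: sc_of_nat)
    have "real n * q (x ^ n - y ^ n) = q (\<Sum>k<n. P x k * P y k * (sc (w k) * (x - y)))"
      unfolding id[symmetric] by (rule nB[symmetric]) (intro mem_intros xB)
    also have "\<dots> \<le> (\<Sum>k<n. q (P x k * P y k * (sc (w k) * (x - y))))"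
      by (intro q_sum[OF q] mem_intros PB xB)
    also have "\<dots> \<le> (\<Sum>k<n. K\<^sup>2 * q AB * ((1 / R' - 1 / R) * q T))"
    proof (intro sum_mono)
      fix k
      have "q (P x k * P y k * (sc (w k) * (x - y))) \<le> q (P x k * P y k) * q (sc (w k) * (x - y))"
        by (intro q_mult[OF q] mem_intros PB xB)
      also have "\<dots> \<le> K\<^sup>2 * q AB * q (sc (w k) * (x - y))"
        by (intro mult_right_mono PP nn mem_intros xB)
      finally show "q (P x k * P y k * (sc (w k) * (x - y))) \<le> K\<^sup>2 * q AB * ((1 / R' - 1 / R) * q T)"
        by (simp add: xy)
    qed
    also have "\<dots> = real n * (\<epsilon> * q AB)" by (simp add: \<epsilon>_def algebra_simps)
    finally have *: "q (x ^ n - y ^ n) \<le> \<epsilon> * q AB" using n by simp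
    have qx: "q (x ^ n) = q (T ^ n) / R ^ n" and qy: "q (y ^ n) = q (T ^ n) / R' ^ n"
      using RR by (simp_all add: x_def y_def power_mult_distrib q_scale[OF q] T mem_intros norm_power norm_divide power_divide flip: sc_power)
    have "q (y ^ n) - q (x ^ n) \<le> q (x ^ n - y ^ n)"
      using q_diff_ge[OF q, of "y ^ n" "x ^ n"] q_minus[OF q, of "x ^ n - y ^ n"] by (simp add: mem_intros xB)
    also note *
    also have "\<epsilon> * q AB \<le> \<epsilon> * ((1 + q (x ^ n)) * (1 + q (y ^ n)))"
    proof (rule mult_left_mono)
      have "q AB \<le> q (1 - x ^ n) * q (1 - y ^ n)"
        unfolding AB_def by (intro q_mult[OF q] mem_intros xB)
      also have "\<dots> \<le> (1 + q (x ^ n)) * (1 + q (y ^ n))"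
        using q_diff[OF q, of 1 "x ^ n"] q_diff[OF q, of 1 "y ^ n"]
        by (intro mult_mono nn) (auto simp: q_one[OF q] xB mem_intros add_nonneg_nonneg nn)
      finally show "q AB \<le> (1 + q (x ^ n)) * (1 + q (y ^ n))" .
      show "0 \<le> \<epsilon>" using RR nn[OF T] by (simp add: \<epsilon>_def frac_le)
    qed
    finally show ?thesis by (simp add: qx qy)
  qed
  have eps0: "0 \<le> \<epsilon>" using RR nn[OF T] by (simp add: \<epsilon>_def frac_le)
  \<comment> \<open>A growth rate below \<open>R\<close> makes \<open>q (T ^ n) / R ^ n\<close> tend
    to 0, so that \<open>key\<close> becomes an estimate for the ratio with \<open>R'\<close>
    alone.\<close>
  obtain R1 where R1: "R1 \<in> G" "R1 < R"
    using cInf_lessD[of G R] G1 d by (auto simp: r_def R_def)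
  have R1_0: "R1 > 0" using R1 by (simp add: G_def)
  obtain C where C: "\<And>n. q (T ^ n) \<le> C * R1 ^ n" using R1 by (auto simp: G_def)
  have "(\<lambda>n. C * (R1 / R) ^ n) \<longlonglongrightarrow> C * 0"
    using R1 R1_0 RR by (intro tendsto_intros LIMSEQ_power_zero) auto
  then have "eventually (\<lambda>n. C * (R1 / R) ^ n < 1) sequentially" by (rule order_tendstoD) simp
  then obtain n0 where n0: "\<And>n. n \<ge> n0 \<Longrightarrow> C * (R1 / R) ^ n < 1" by (auto simp: eventually_sequentially)
  \<comment> \<open>With \<open>x < 1\<close> and \<open>\<epsilon> \<le> 1 / 4\<close>,
    \<open>key\<close> gives \<open>y - x \<le> (1 + y) / 2\<close>, that is
    \<open>y \<le> 1 + 2 * x < 3\<close>. So \<open>R'\<close> is a growth rate smaller than the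
    infimum \<open>r\<close>.\<close>
  have bound: "q (T ^ n) \<le> 3 * R' ^ n" if n: "n \<ge> n0" "n > 0" for n
  proof -
    define y where "y = q (T ^ n) / R' ^ n"
    define x where "x = q (T ^ n) / R ^ n"
    have "x \<le> C * R1 ^ n / R ^ n" unfolding x_def using C[of n] RR by (intro divide_right_mono) auto
    also have "\<dots> < 1" using n0[OF n(1)] by (simp add: power_divide)
    finally have x1: "x < 1" .
    have y0: "y \<ge> 0" unfolding y_def using RR by (intro divide_nonneg_pos nn mem_intros T) auto
    have x0: "x \<ge> 0" unfolding x_def using RR by (intro divide_nonneg_pos nn mem_intros T) auto
    have "y - x \<le> \<epsilon> * ((1 + x) * (1 + y))" using key[OF n(2)] by (simp add: x_def y_def)
    also have "\<dots> \<le> 1 / 4 * (2 * (1 + y))"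
      using eps eps0 x1 x0 y0 by (intro mult_mono) auto
    finally have "y \<le> 3" using x1 by simp
    then show ?thesis using RR by (simp add: y_def field_simps)
  qed
  have "\<exists>C. \<forall>n. q (T ^ n) \<le> C * R' ^ n"
  proof (intro exI allI)
    fix n
    define C' where "C' = Max (insert 3 ((\<lambda>n. q (T ^ n) / R' ^ n) ` {..n0}))"
    have "q (T ^ n) / R' ^ n \<le> C'"
    proof (cases "n \<le> n0")
      case True
      then show ?thesis unfolding C'_def by (intro Max_ge) auto
    next
      case False
      then have "q (T ^ n) / R' ^ n \<le> 3" using bound[of n] RR by (simp add: field_simps)
      also have "3 \<le> C'" unfolding C'_def by (intro Max_ge) auto
      finally show ?thesis .
    qed
    then show "q (T ^ n) \<le> C' * R' ^ n" using RR by (simp add: field_simps)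
  qed
  then have "R' \<in> G" using RR by (simp add: G_def)
  then have "r \<le> R'" unfolding r_def by (intro cInf_lower bddG)
  then show False using d by (simp add: R'_def)
qed

text \<open>One element at a time: take a spectral value \<open>z\<close> of \<open>T n\<close> for
  the current seminorm and divide by the ideal generated by \<open>T n - sc z\<close>. The
  conclusion of \<open>spectrum_nonempty\<close> is exactly the distance hypothesis of
  \<open>quotient_seminorm\<close>. The seminorms decrease, so zeros obtained earlier
  persist.\<close>

lemma common_character:
  fixes n :: nat
  assumes q: "seminorm q" and T: "\<And>j. j < n \<Longrightarrow> T j \<in> B"
  shows "\<exists>\<zeta> q'. seminorm q' \<and> (\<forall>f\<in>B. q' f \<le> q f) \<and> (\<forall>j<n. q' (T j - sc (\<zeta> j)) = 0)"
  using T
proof (induction n)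
  case 0
  then show ?case using q by auto
next
  case (Suc n)
  then obtain \<zeta> q1 where q1: "seminorm q1" "\<And>f. f \<in> B \<Longrightarrow> q1 f \<le> q f" "\<And>j. j < n \<Longrightarrow> q1 (T j - sc (\<zeta> j)) = 0"
    by (metis less_SucI)
  obtain z where z: "\<And>h. h \<in> B \<Longrightarrow> 1 \<le> q1 (1 - h * (T n - sc z))"
    using spectrum_nonempty[OF q1(1), of "T n"] Suc.prems by blast
  define L where "L = (\<lambda>h. h * (T n - sc z)) ` B"
  have Tn: "T n - sc z \<in> B" using Suc.prems by (auto intro!: mem_intros)
  obtain q2 where q2: "seminorm q2" "\<And>f. f \<in> B \<Longrightarrow> q2 f \<le> q1 f" "\<And>f. f \<in> L \<Longrightarrow> q2 f = 0"
  proof (rule quotient_seminorm[OF q1(1), of L])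
    show "L \<subseteq> B" "L \<noteq> {}" using Tn one_mem by (auto simp: L_def mem_intros)
    show "f + g \<in> L" if "f \<in> L" "g \<in> L" for f g
      using that by (auto simp: L_def simp flip: distrib_right intro!: imageI add_mem)
    show "f * g \<in> L" if "f \<in> B" "g \<in> L" for f g
      using that by (auto simp: L_def simp flip: mult.assoc intro!: imageI mult_mem)
    show "1 \<le> q1 (1 - l)" if "l \<in> L" for l using that z by (auto simp: L_def)
  qed auto
  have "T n - sc z \<in> L" unfolding L_def by (rule image_eqI[of _ _ 1]) (simp_all add: one_mem)
  then have "q2 (T j - sc ((\<zeta>(n := z)) j)) = 0" if "j < Suc n" for j
  proof (cases "j = n")
    case False
    then have j: "j < n" using that by simp
    have "T j - sc (\<zeta> j) \<in> B" using Suc.prems that by (auto intro!: mem_intros)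
    then show ?thesis using q2(2)[of "T j - sc (\<zeta> j)"] q1(3)[OF j] q_nonneg[OF q2(1), of "T j - sc (\<zeta> j)"] False by simp
  qed (use q2(3) in auto)
  then show ?case using q2(1,2) q1(2) by (meson order_trans)
qed

end

section \<open>Dickson's lemma\<close>

text \<open>Take a finite \<open>F\<close> that works for the coordinates in \<open>I\<close>, and
  let \<open>n\<close> bound its coordinate \<open>j\<close>. Elements with larger coordinate
  \<open>j\<close> are already dominated by \<open>F\<close>; the others lie in finitely many slices
  with constant coordinate \<open>j\<close>, to which the induction hypothesis applies
  again.\<close>

lemma dickson:
  fixes A :: "('i \<Rightarrow> nat) set"
  assumes "finite I"
  shows "\<exists>F\<subseteq>A. finite F \<and> (\<forall>a\<in>A. \<exists>b\<in>F. \<forall>i\<in>I. b i \<le> a i)"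
  using assms
proof (induction I arbitrary: A rule: finite_induct)
  case empty
  show ?case
  proof (cases "A = {}")
    case False
    then obtain a where "a \<in> A" by blast
    then show ?thesis by (intro exI[of _ "{a}"]) auto
  qed auto
next
  case (insert j I)
  obtain F where F: "F \<subseteq> A" "finite F" "\<And>a. a \<in> A \<Longrightarrow> \<exists>b\<in>F. \<forall>i\<in>I. b i \<le> a i"
    using insert.IH[of A] by meson
  define n where "n = Max (insert 0 ((\<lambda>b. b j) ` F))"
  have n: "b j \<le> n" if "b \<in> F" for b unfolding n_def using that F by (intro Max_ge) auto
  have "\<exists>G. G \<subseteq> {a \<in> A. a j = k} \<and> finite G \<and> (\<forall>a\<in>{a \<in> A. a j = k}. \<exists>b\<in>G. \<forall>i\<in>I. b i \<le> a i)" for k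
    using insert.IH[of "{a \<in> A. a j = k}"] by blast
  then have "\<forall>k. \<exists>G. G \<subseteq> {a \<in> A. a j = k} \<and> finite G \<and> (\<forall>a\<in>{a \<in> A. a j = k}. \<exists>b\<in>G. \<forall>i\<in>I. b i \<le> a i)"
    by blast
  from choice[OF this] obtain G where G0: "\<forall>k. G k \<subseteq> {a \<in> A. a j = k} \<and> finite (G k) \<and>
      (\<forall>a\<in>{a \<in> A. a j = k}. \<exists>b\<in>G k. \<forall>i\<in>I. b i \<le> a i)"
    by (elim exE)
  have G: "G k \<subseteq> {a \<in> A. a j = k}" "finite (G k)" "a \<in> A \<Longrightarrow> a j = k \<Longrightarrow> \<exists>b\<in>G k. \<forall>i\<in>I. b i \<le> a i" for k a
    using G0[rule_format, of k] by auto
  show ?case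
  proof (intro exI[of _ "F \<union> (\<Union>k\<le>n. G k)"] conjI ballI)
    show "F \<union> (\<Union>k\<le>n. G k) \<subseteq> A" using F G(1) by blast
    show "finite (F \<union> (\<Union>k\<le>n. G k))" using F G(2) by auto
    fix a assume a: "a \<in> A"
    show "\<exists>b\<in>F \<union> (\<Union>k\<le>n. G k). \<forall>i\<in>insert j I. b i \<le> a i"
    proof (cases "a j \<le> n")
      case True
      obtain b where "b \<in> G (a j)" "\<forall>i\<in>I. b i \<le> a i" using G(3)[OF a refl] by blast
      with True G(1)[of "a j"] show ?thesis by (intro bexI[of _ b]) auto
    next
      case False
      obtain b where b: "b \<in> F" "\<forall>i\<in>I. b i \<le> a i" using F(3)[OF a] by blast
      with n[OF b(1)] False show ?thesis by (intro bexI[of _ b]) auto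
    qed
  qed
qed

subsection \<open>Evaluation and weighted norms of finitely supported functions\<close>

abbreviation keys :: "('k \<Rightarrow>\<^sub>0 'b::zero) \<Rightarrow> 'k set" where "keys \<equiv> Poly_Mapping.keys"
abbreviation lookup :: "('k \<Rightarrow>\<^sub>0 'b::zero) \<Rightarrow> 'k \<Rightarrow> 'b" where "lookup \<equiv> Poly_Mapping.lookup"
abbreviation single :: "'k \<Rightarrow> 'b \<Rightarrow> ('k \<Rightarrow>\<^sub>0 'b::zero)" where "single \<equiv> Poly_Mapping.single"

lemma poly_mapping_eq_sum_single:
  "f = (\<Sum>k\<in>keys f. single k (lookup f k))"
proof (rule poly_mapping_eqI)
  fix k
  show "lookup f k =
      lookup (\<Sum>k\<in>keys f. single k (lookup f k)) k"
    by (cases "k \<in> keys f")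
      (auto simp: lookup_sum lookup_single when_def in_keys_iff sum.delta)
qed

lemma times_eq_sum_single:
  fixes f g :: "'k::comm_monoid_add \<Rightarrow>\<^sub>0 'b::comm_semiring_1"
  shows "f * g = (\<Sum>a\<in>keys f. \<Sum>b\<in>keys g.
    single (a + b) (lookup f a * lookup g b))"
proof -
  have "f * g = (\<Sum>a\<in>keys f. single a (lookup f a)) *
      (\<Sum>b\<in>keys g. single b (lookup g b))"
    by (simp flip: poly_mapping_eq_sum_single)
  then show ?thesis by (simp add: sum_product mult_single)
qed

lemma lookup_single_0_times:
  fixes f :: "'k::comm_monoid_add \<Rightarrow>\<^sub>0 'b::comm_semiring_1"
  shows "lookup (single 0 c * f) k = c * lookup f k"
  unfolding mult_map_scale_conv_mult[symmetric]
  by (simp add: Poly_Mapping.map.rep_eq when_def)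

lemma keys_times_subset:
  assumes "\<And>a b. a \<in> E \<Longrightarrow> b \<in> E \<Longrightarrow> a + b \<in> E"
    and "keys f \<subseteq> E" "keys g \<subseteq> E"
  shows "keys (f * g) \<subseteq> E"
  using keys_mult[of f g] assms by blast

lemma keys_plus_subset:
  "keys f \<subseteq> E \<Longrightarrow> keys g \<subseteq> E \<Longrightarrow> keys (f + g) \<subseteq> E"
  using keys_add[of f g] by blast

lemma complex_subalgebra_monoid_algebra:
  fixes E :: "'k::comm_monoid_add set"
  assumes "0 \<in> E" "\<And>a b. a \<in> E \<Longrightarrow> b \<in> E \<Longrightarrow> a + b \<in> E"
  shows "complex_subalgebra (single 0) {f :: 'k \<Rightarrow>\<^sub>0 complex. keys f \<subseteq> E}"
proof
  show "single 0 (a * b) = single 0 a * single (0::'k) b" for a b :: complex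
    by (simp add: mult_single)
  show "single 0 a \<in> {f :: 'k \<Rightarrow>\<^sub>0 complex. keys f \<subseteq> E}" for a
    using assms(1) by (auto split: if_splits)
  fix f g :: "'k \<Rightarrow>\<^sub>0 complex"
  assume "f \<in> {f. keys f \<subseteq> E}" "g \<in> {f. keys f \<subseteq> E}"
  then show "f + g \<in> {f. keys f \<subseteq> E}" "f * g \<in> {f. keys f \<subseteq> E}"
    using keys_plus_subset[of f E g] keys_times_subset[of E f g] assms(2) by auto
qed (simp_all add: single_add)

lemma complex_subalgebra_complex: "complex_subalgebra (\<lambda>z. z) UNIV"
  by standard auto

context complex_subalgebra
begin

text \<open>The linear extension of \<open>\<psi>\<close>. As values lie in any algebra, it yields
  evaluation at a point (\<open>cplx.eval\<close>) as well as substitution of characters for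
  variables (\<open>monoid_algebra.eval\<close>).\<close>

definition eval :: "('k \<Rightarrow> 'a) \<Rightarrow> ('k \<Rightarrow>\<^sub>0 complex) \<Rightarrow> 'a" where
  "eval \<psi> f = (\<Sum>k\<in>keys f. sc (lookup f k) * \<psi> k)"

lemma eval_superset:
  assumes "finite A" "keys f \<subseteq> A"
  shows "eval \<psi> f = (\<Sum>k\<in>A. sc (lookup f k) * \<psi> k)"
  unfolding eval_def using assms
  by (intro sum.mono_neutral_left) (auto simp: in_keys_iff sc_0)

lemma eval_add: "eval \<psi> (f + g) = eval \<psi> f + eval \<psi> g"
proof -
  let ?A = "keys f \<union> keys g"
  have "eval \<psi> (f + g) = (\<Sum>k\<in>?A. sc (lookup (f + g) k) * \<psi> k)"
    using keys_add[of f g] by (intro eval_superset) auto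
  also have "\<dots> = (\<Sum>k\<in>?A. sc (lookup f k) * \<psi> k) + (\<Sum>k\<in>?A. sc (lookup g k) * \<psi> k)"
    by (simp add: lookup_add sc_add distrib_right sum.distrib)
  also have "\<dots> = eval \<psi> f + eval \<psi> g" by (simp flip: eval_superset)
  finally show ?thesis .
qed

lemma eval_0: "eval \<psi> 0 = 0"
  by (simp add: eval_def)

lemma eval_sum: "eval \<psi> (\<Sum>i\<in>I. h i) = (\<Sum>i\<in>I. eval \<psi> (h i))"
  by (induction I rule: infinite_finite_induct) (auto simp: eval_0 eval_add)

lemma eval_single: "eval \<psi> (single k c) = sc c * \<psi> k"
  by (cases "c = 0") (auto simp: eval_def sc_0)

lemma eval_mult:
  fixes f g :: "'k::comm_monoid_add \<Rightarrow>\<^sub>0 complex"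
  assumes "\<And>a b. a \<in> E \<Longrightarrow> b \<in> E \<Longrightarrow> \<psi> (a + b) = \<psi> a * \<psi> b"
    and "keys f \<subseteq> E" "keys g \<subseteq> E"
  shows "eval \<psi> (f * g) = eval \<psi> f * eval \<psi> g"
proof -
  have "eval \<psi> (f * g) = (\<Sum>a\<in>keys f. \<Sum>b\<in>keys g.
      sc (lookup f a * lookup g b) * \<psi> (a + b))"
    by (subst times_eq_sum_single) (simp add: eval_sum eval_single)
  also have "\<dots> = (\<Sum>a\<in>keys f. \<Sum>b\<in>keys g.
      (sc (lookup f a) * \<psi> a) * (sc (lookup g b) * \<psi> b))"
    using assms by (intro sum.cong refl) (auto simp: sc_mult subset_iff mult_ac)
  also have "\<dots> = eval \<psi> f * eval \<psi> g"
    by (simp add: eval_def sum_product)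
  finally show ?thesis .
qed

end

interpretation cplx: complex_subalgebra "\<lambda>z. z" UNIV
  by (rule complex_subalgebra_complex)

definition weighted_norm :: "('k \<Rightarrow> real) \<Rightarrow> ('k \<Rightarrow>\<^sub>0 complex) \<Rightarrow> real" where
  "weighted_norm W f = (\<Sum>k\<in>keys f. cmod (lookup f k) * W k)"

lemma weighted_norm_superset:
  assumes "finite A" "keys f \<subseteq> A"
  shows "weighted_norm W f = (\<Sum>k\<in>A. cmod (lookup f k) * W k)"
  unfolding weighted_norm_def using assms
  by (intro sum.mono_neutral_left) (auto simp: in_keys_iff)

context
  fixes W :: "'k::comm_monoid_add \<Rightarrow> real"
  assumes W: "\<And>k. 0 < W k" "\<And>k l. W (k + l) = W k * W l"
begin

lemma weighted_norm_nonneg: "0 \<le> weighted_norm W f"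
  unfolding weighted_norm_def using W by (intro sum_nonneg mult_nonneg_nonneg) (auto simp: less_imp_le)

lemma weighted_norm_add: "weighted_norm W (f + g) \<le> weighted_norm W f + weighted_norm W g"
proof -
  let ?A = "keys f \<union> keys g"
  have "weighted_norm W (f + g) = (\<Sum>k\<in>?A. cmod (lookup (f + g) k) * W k)"
    using keys_add[of f g] by (intro weighted_norm_superset) auto
  also have "\<dots> \<le> (\<Sum>k\<in>?A. cmod (lookup f k) * W k + cmod (lookup g k) * W k)"
    using W by (intro sum_mono) (auto simp: lookup_add less_imp_le norm_triangle_ineq mult_right_mono simp flip: distrib_right)
  also have "\<dots> = weighted_norm W f + weighted_norm W g"
    by (simp add: sum.distrib flip: weighted_norm_superset)
  finally show ?thesis .
qed

lemma weighted_norm_0: "weighted_norm W 0 = 0"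
  by (simp add: weighted_norm_def)

lemma weighted_norm_sum: "weighted_norm W (\<Sum>i\<in>I. h i) \<le> (\<Sum>i\<in>I. weighted_norm W (h i))"
proof (induction I rule: infinite_finite_induct)
  case (insert i I)
  then show ?case using weighted_norm_add[of "h i" "sum h I"] by simp
qed (simp_all add: weighted_norm_0)

lemma weighted_norm_single: "weighted_norm W (single k c) = cmod c * W k"
  by (cases "c = 0") (auto simp: weighted_norm_def)

lemma weighted_norm_mult: "weighted_norm W (f * g) \<le> weighted_norm W f * weighted_norm W g"
proof -
  have "weighted_norm W (f * g) \<le> (\<Sum>a\<in>keys f. \<Sum>b\<in>keys g.
      cmod (lookup f a * lookup g b) * W (a + b))"
    by (subst times_eq_sum_single)
      (intro order_trans[OF weighted_norm_sum] sum_mono eq_refl weighted_norm_single)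
  also have "\<dots> = weighted_norm W f * weighted_norm W g"
    by (simp add: weighted_norm_def sum_product norm_mult W mult_ac)
  finally show ?thesis .
qed

lemma weighted_norm_uminus: "weighted_norm W (- f) = weighted_norm W f"
  by (simp add: weighted_norm_superset[of "keys f" "- f"] in_keys_iff subset_iff
      weighted_norm_superset[of "keys f" f])

lemma weighted_norm_diff: "weighted_norm W (f - g) \<le> weighted_norm W f + weighted_norm W g"
  using weighted_norm_add[of f "- g"] by (simp add: weighted_norm_uminus)

lemma weight_0: "W 0 = 1"
  using W(1)[of 0] W(2)[of 0 0] by simp

end

subsection \<open>Points of an ideal in a large polydisc\<close>

text \<open>Exponents of monomials in the variables \<open>0, ..., N - 1\<close>, so that polynomial
  rings in all numbers of variables share one type.\<close>

definition exponents :: "nat \<Rightarrow> (nat \<Rightarrow> nat) set" where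
  "exponents N = {\<mu>. \<forall>i\<ge>N. \<mu> i = 0}"

lemma zero_in_exponents [simp]: "0 \<in> exponents N"
  and plus_in_exponents [simp]: "\<mu> \<in> exponents N \<Longrightarrow> \<nu> \<in> exponents N \<Longrightarrow> \<mu> + \<nu> \<in> exponents N"
  by (auto simp: exponents_def)

definition nth_prime :: "nat \<Rightarrow> nat" where
  "nth_prime = enumerate {p. prime p}"

lemma prime_nth_prime: "prime (nth_prime i)"
  using enumerate_in_set[OF primes_infinite] by (auto simp: nth_prime_def)

lemma inj_nth_prime: "inj nth_prime"
  unfolding nth_prime_def using strict_mono_enumerate[OF primes_infinite] by (rule strict_mono_imp_inj_on)

text \<open>
  Exponents are compared by their integral weight and then by an integer encoding them injectively;
  the logarithm of the latter is a linear form, so that the order is induced by two linear weights.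
\<close>

definition prime_code :: "nat \<Rightarrow> (nat \<Rightarrow> nat) \<Rightarrow> nat" where
  "prime_code N \<mu> = (\<Prod>i<N. nth_prime i ^ \<mu> i)"

lemma prime_code_plus: "prime_code N (\<mu> + \<nu>) = prime_code N \<mu> * prime_code N \<nu>"
  by (simp add: prime_code_def power_add prod.distrib)

lemma prime_code_pos: "prime_code N \<mu> > 0"
  unfolding prime_code_def by (intro prod_pos) (auto simp: prime_nth_prime prime_gt_0_nat)

lemma prime_code_zero: "prime_code N 0 = 1"
  by (simp add: prime_code_def)

text \<open>Unique factorisation: exponents below \<open>N\<close> are recovered as multiplicities
  of primes, and the remaining ones vanish.\<close>

lemma prime_code_inj:
  assumes "\<mu> \<in> exponents N" "\<nu> \<in> exponents N" "prime_code N \<mu> = prime_code N \<nu>"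
  shows "\<mu> = \<nu>"
proof -
  have *: "multiplicity (nth_prime i) (prime_code N \<mu>) = (if i < N then \<mu> i else 0)" for \<mu> i
  proof -
    have "prime_code N \<mu> = (\<Prod>p\<in>nth_prime ` {..<N}. p ^ \<mu> (inv nth_prime p))"
      unfolding prime_code_def
      by (subst prod.reindex) (auto intro: inj_on_subset[OF inj_nth_prime] simp: inv_f_f[OF inj_nth_prime])
    also have "multiplicity (nth_prime i) \<dots> = (if nth_prime i \<in> nth_prime ` {..<N} then \<mu> (inv nth_prime (nth_prime i)) else 0)"
      by (rule multiplicity_prod_prime_powers) (auto simp: prime_nth_prime)
    also have "\<dots> = (if i < N then \<mu> i else 0)"
      using inj_nth_prime by (auto simp: inv_f_f inj_image_mem_iff)
    finally show ?thesis .
  qed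
  show ?thesis
  proof
    fix i
    show "\<mu> i = \<nu> i"
      using *[of i \<mu>] *[of i \<nu>] assms by (cases "i < N") (auto simp: exponents_def)
  qed
qed

section \<open>Leading exponents and division\<close>

text \<open>\<open>L_nonunit\<close> says that no element of the ideal has leading exponent 0. The
  tie-breaking form need not be mentioned in it, because the code of 0 is the smallest possible, so
  an exponent other than 0 lies below 0 only by having negative weight.\<close>

locale weighted_ideal =
  fixes N :: nat and a :: "nat \<Rightarrow> int" and L :: "((nat \<Rightarrow> nat) \<Rightarrow>\<^sub>0 complex) set"
  assumes L_keys: "f \<in> L \<Longrightarrow> keys f \<subseteq> exponents N"
    and L_zero: "0 \<in> L"
    and L_add: "f \<in> L \<Longrightarrow> g \<in> L \<Longrightarrow> f + g \<in> L"
    and L_mult: "keys f \<subseteq> exponents N \<Longrightarrow> g \<in> L \<Longrightarrow> f * g \<in> L"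
    and L_nonunit: "f \<in> L \<Longrightarrow> lookup f 0 \<noteq> 0 \<Longrightarrow>
      \<exists>\<mu>\<in>keys f. \<mu> \<noteq> 0 \<and> 0 \<le> (\<Sum>i<N. a i * int (\<mu> i))"
begin

definition wt :: "(nat \<Rightarrow> nat) \<Rightarrow> int" where
  "wt \<mu> = (\<Sum>i<N. a i * int (\<mu> i))"

abbreviation code :: "(nat \<Rightarrow> nat) \<Rightarrow> nat" where
  "code \<equiv> prime_code N"

text \<open>An additive total order on exponents, but in general no well-order: weights may be
  negative and 0 need not be the least element.\<close>

definition less :: "(nat \<Rightarrow> nat) \<Rightarrow> (nat \<Rightarrow> nat) \<Rightarrow> bool"  (infix "\<sqsubset>" 50) where
  "\<mu> \<sqsubset> \<nu> \<longleftrightarrow> wt \<mu> < wt \<nu> \<or> wt \<mu> = wt \<nu> \<and> code \<mu> < code \<nu>"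

lemma wt_plus: "wt (\<mu> + \<nu>) = wt \<mu> + wt \<nu>"
  by (simp add: wt_def algebra_simps sum.distrib)

lemma wt_zero: "wt 0 = 0"
  by (simp add: wt_def)

lemma less_trans: "\<mu> \<sqsubset> \<nu> \<Longrightarrow> \<nu> \<sqsubset> \<xi> \<Longrightarrow> \<mu> \<sqsubset> \<xi>"
  by (auto simp: less_def)

lemma less_total: "\<mu> \<in> exponents N \<Longrightarrow> \<nu> \<in> exponents N \<Longrightarrow> \<mu> \<sqsubset> \<nu> \<or> \<mu> = \<nu> \<or> \<nu> \<sqsubset> \<mu>"
  using prime_code_inj[of \<mu> N \<nu>] by (auto simp: less_def)

lemma less_plus: "\<mu> \<sqsubset> \<nu> \<Longrightarrow> \<xi> + \<mu> \<sqsubset> \<xi> + \<nu>"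
  by (auto simp: less_def wt_plus prime_code_plus prime_code_pos)

lemma ex_top:
  assumes "finite A" "A \<noteq> {}" "A \<subseteq> exponents N"
  shows "\<exists>\<mu>\<in>A. \<forall>\<nu>\<in>A. \<nu> = \<mu> \<or> \<nu> \<sqsubset> \<mu>"
  using assms
proof (induction A rule: finite_ne_induct)
  case (insert x A)
  then obtain \<mu> where \<mu>: "\<mu> \<in> A" "\<forall>\<nu>\<in>A. \<nu> = \<mu> \<or> \<nu> \<sqsubset> \<mu>" by auto
  have "\<mu> \<sqsubset> x \<or> \<mu> = x \<or> x \<sqsubset> \<mu>" using less_total \<mu> insert.prems by blast
  then show ?case using \<mu> less_trans by (metis insert_iff)
qed auto

definition leading :: "(nat \<Rightarrow> nat) set" where
  "leading = {\<alpha>. \<exists>f\<in>L. lookup f \<alpha> = 1 \<and> (\<forall>\<mu>\<in>keys f. \<mu> \<noteq> \<alpha> \<longrightarrow> \<mu> \<sqsubset> \<alpha>)}"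

lemma L_uminus: "f \<in> L \<Longrightarrow> - f \<in> L"
  using L_mult[of "- 1" f] by (simp add: in_keys_iff subset_iff lookup_one when_def split: if_splits)

lemma L_diff: "f \<in> L \<Longrightarrow> g \<in> L \<Longrightarrow> f - g \<in> L"
  using L_add[OF _ L_uminus] by fastforce

lemma leadingI:
  assumes "f \<in> L" "\<alpha> \<in> keys f" "\<forall>\<mu>\<in>keys f. \<mu> \<noteq> \<alpha> \<longrightarrow> \<mu> \<sqsubset> \<alpha>"
  shows "\<alpha> \<in> leading"
proof -
  define c where "c = lookup f \<alpha>"
  have c: "c \<noteq> 0" using assms by (simp add: c_def in_keys_iff)
  define g where "g = single 0 (1 / c) * f"
  have "g \<in> L" unfolding g_def using assms by (intro L_mult) auto
  moreover have lk: "lookup g k = lookup f k / c" for k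
    by (simp add: g_def lookup_single_0_times)
  ultimately show ?thesis unfolding leading_def using assms(3) c
    by (auto simp: in_keys_iff c_def intro!: bexI[of _ g])
qed

text \<open>The monomial with exponent \<open>\<mu>\<close> at the polyradius
  \<open>nth_prime j ^ c * exp (a j / \<rho>)\<close>. Small \<open>\<rho>\<close> separates
  different integral weights, large \<open>c\<close> separates exponents of equal weight.\<close>

definition weight :: "nat \<Rightarrow> real \<Rightarrow> (nat \<Rightarrow> nat) \<Rightarrow> real" where
  "weight c \<rho> \<mu> = exp (wt \<mu> / \<rho>) * real (code \<mu>) ^ c"

abbreviation wnorm :: "nat \<Rightarrow> real \<Rightarrow> ((nat \<Rightarrow> nat) \<Rightarrow>\<^sub>0 complex) \<Rightarrow> real" where
  "wnorm c \<rho> \<equiv> weighted_norm (weight c \<rho>)"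

lemma weight_pos: "0 < weight c \<rho> \<mu>"
  by (simp add: weight_def prime_code_pos)

lemma weight_plus: "weight c \<rho> (\<mu> + \<nu>) = weight c \<rho> \<mu> * weight c \<rho> \<nu>"
  by (simp add: weight_def wt_plus prime_code_plus add_divide_distrib exp_add power_mult_distrib mult_ac)

lemma weight_ratio:
  "weight c \<rho> \<mu> = weight c \<rho> \<beta> * (exp ((wt \<mu> - wt \<beta>) / \<rho>) * (real (code \<mu>) / real (code \<beta>)) ^ c)"
  by (simp add: weight_def prime_code_pos diff_divide_distrib exp_diff power_divide less_imp_neq[THEN not_sym])

text \<open>Between exponents of equal weight the ratio does not depend on \<open>\<rho>\<close> and
  is a power with exponent \<open>c\<close> of a number below 1, so \<open>c\<close> is chosen
  first. Once \<open>c\<close> is fixed, the terms of smaller weight carry a factor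
  \<open>exp (- k / \<rho>)\<close> with \<open>k > 0\<close> and are handled by
  \<open>\<rho>0\<close>. Each group may use one half.\<close>

lemma leading_terms_dominate:
  assumes "finite F" and f: "\<And>\<beta> \<mu>. \<beta> \<in> F \<Longrightarrow> \<mu> \<in> keys (f \<beta>) \<Longrightarrow> \<mu> \<noteq> \<beta> \<Longrightarrow> \<mu> \<sqsubset> \<beta>"
  shows "\<exists>c. \<exists>\<rho>0>0. \<forall>\<rho>. 0 < \<rho> \<and> \<rho> < \<rho>0 \<longrightarrow> (\<forall>\<beta>\<in>F.
    (\<Sum>\<mu>\<in>keys (f \<beta>) - {\<beta>}. cmod (lookup (f \<beta>) \<mu>) * weight c \<rho> \<mu>) \<le> weight c \<rho> \<beta>)"
proof -
  define Eq where "Eq \<beta> = {\<mu> \<in> keys (f \<beta>) - {\<beta>}. wt \<mu> = wt \<beta>}" for \<beta>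
  define Lt where "Lt \<beta> = {\<mu> \<in> keys (f \<beta>) - {\<beta>}. wt \<mu> < wt \<beta>}" for \<beta>
  have split: "keys (f \<beta>) - {\<beta>} = Eq \<beta> \<union> Lt \<beta>" "Eq \<beta> \<inter> Lt \<beta> = {}" if "\<beta> \<in> F" for \<beta>
    using f[OF that] by (auto simp: Eq_def Lt_def less_def)
  have fin: "finite (Eq \<beta>)" "finite (Lt \<beta>)" for \<beta> by (auto simp: Eq_def Lt_def)
  have "eventually (\<lambda>c. \<forall>\<beta>\<in>F. (\<Sum>\<mu>\<in>Eq \<beta>. cmod (lookup (f \<beta>) \<mu>) * (real (code \<mu>) / real (code \<beta>)) ^ c) < 1/2) sequentially"
    using \<open>finite F\<close>
  proof (rule eventually_ball_finite, intro ballI)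
    fix \<beta> assume \<beta>: "\<beta> \<in> F"
    have "(\<lambda>c. \<Sum>\<mu>\<in>Eq \<beta>. cmod (lookup (f \<beta>) \<mu>) * (real (code \<mu>) / real (code \<beta>)) ^ c)
        \<longlonglongrightarrow> (\<Sum>\<mu>\<in>Eq \<beta>. cmod (lookup (f \<beta>) \<mu>) * 0)"
    proof (intro tendsto_intros LIMSEQ_power_zero)
      fix \<mu> assume "\<mu> \<in> Eq \<beta>"
      then have "code \<mu> < code \<beta>" using f[OF \<beta>, of \<mu>] by (auto simp: Eq_def less_def)
      then show "norm (real (code \<mu>) / real (code \<beta>)) < 1" by simp
    qed
    then show "\<forall>\<^sub>F c in sequentially. (\<Sum>\<mu>\<in>Eq \<beta>. cmod (lookup (f \<beta>) \<mu>) * (real (code \<mu>) / real (code \<beta>)) ^ c) < 1/2"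
      by (rule order_tendstoD) simp
  qed
  then obtain c where c: "\<And>\<beta>. \<beta> \<in> F \<Longrightarrow>
      (\<Sum>\<mu>\<in>Eq \<beta>. cmod (lookup (f \<beta>) \<mu>) * (real (code \<mu>) / real (code \<beta>)) ^ c) < 1/2"
    by (auto simp: eventually_sequentially)
  have "eventually (\<lambda>\<rho>. \<forall>\<beta>\<in>F. (\<Sum>\<mu>\<in>Lt \<beta>. cmod (lookup (f \<beta>) \<mu>) *
      (exp ((wt \<mu> - wt \<beta>) / \<rho>) * (real (code \<mu>) / real (code \<beta>)) ^ c)) < 1/2) (at_right 0)"
    using \<open>finite F\<close>
  proof (rule eventually_ball_finite, intro ballI)
    fix \<beta> assume \<beta>: "\<beta> \<in> F"
    have "((\<lambda>\<rho>. \<Sum>\<mu>\<in>Lt \<beta>. cmod (lookup (f \<beta>) \<mu>) *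
      (exp ((wt \<mu> - wt \<beta>) / \<rho>) * (real (code \<mu>) / real (code \<beta>)) ^ c))
      \<longlongrightarrow> (\<Sum>\<mu>\<in>Lt \<beta>. cmod (lookup (f \<beta>) \<mu>) * (0 * (real (code \<mu>) / real (code \<beta>)) ^ c))) (at_right 0)"
    proof (intro tendsto_sum tendsto_mult tendsto_const)
      fix \<mu> assume "\<mu> \<in> Lt \<beta>"
      then have neg: "real_of_int (wt \<mu> - wt \<beta>) < 0" by (simp add: Lt_def)
      have "filterlim (\<lambda>\<rho>. real_of_int (wt \<mu> - wt \<beta>) * inverse \<rho>) at_bot (at_right 0)"
        by (rule filterlim_tendsto_neg_mult_at_bot[OF tendsto_const neg filterlim_inverse_at_top_right])
      from filterlim_compose[OF exp_at_bot this]
      show "((\<lambda>\<rho>. exp ((wt \<mu> - wt \<beta>) / \<rho>)) \<longlongrightarrow> 0) (at_right 0)" by (simp add: divide_inverse)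
    qed
    then show "\<forall>\<^sub>F \<rho> in at_right 0. (\<Sum>\<mu>\<in>Lt \<beta>. cmod (lookup (f \<beta>) \<mu>) *
      (exp ((wt \<mu> - wt \<beta>) / \<rho>) * (real (code \<mu>) / real (code \<beta>)) ^ c)) < 1/2"
      by (rule order_tendstoD) simp
  qed
  then obtain \<rho>0 where \<rho>0: "\<rho>0 > 0" "\<And>\<rho> \<beta>. 0 < \<rho> \<Longrightarrow> \<rho> < \<rho>0 \<Longrightarrow> \<beta> \<in> F \<Longrightarrow> (\<Sum>\<mu>\<in>Lt \<beta>. cmod (lookup (f \<beta>) \<mu>) *
      (exp ((wt \<mu> - wt \<beta>) / \<rho>) * (real (code \<mu>) / real (code \<beta>)) ^ c)) < 1/2"
    by (auto simp: eventually_at_right_field)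
  show ?thesis
  proof (intro exI[of _ c] exI[of _ \<rho>0] conjI allI impI ballI \<rho>0(1))
    fix \<rho> \<beta> assume \<rho>: "0 < \<rho> \<and> \<rho> < \<rho>0" and \<beta>: "\<beta> \<in> F"
    let ?r = "\<lambda>\<mu>. exp ((wt \<mu> - wt \<beta>) / \<rho>) * (real (code \<mu>) / real (code \<beta>)) ^ c"
    have "(\<Sum>\<mu>\<in>keys (f \<beta>) - {\<beta>}. cmod (lookup (f \<beta>) \<mu>) * weight c \<rho> \<mu>)
        = weight c \<rho> \<beta> * (\<Sum>\<mu>\<in>Eq \<beta> \<union> Lt \<beta>. cmod (lookup (f \<beta>) \<mu>) * ?r \<mu>)"
      unfolding split(1)[OF \<beta>] sum_distrib_left
      by (intro sum.cong refl) (subst weight_ratio[of _ _ _ \<beta>], simp add: mult_ac)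
    also have "(\<Sum>\<mu>\<in>Eq \<beta> \<union> Lt \<beta>. cmod (lookup (f \<beta>) \<mu>) * ?r \<mu>)
        = (\<Sum>\<mu>\<in>Eq \<beta>. cmod (lookup (f \<beta>) \<mu>) * ?r \<mu>) + (\<Sum>\<mu>\<in>Lt \<beta>. cmod (lookup (f \<beta>) \<mu>) * ?r \<mu>)"
      using fin split(2)[OF \<beta>] by (rule sum.union_disjoint)
    also have "(\<Sum>\<mu>\<in>Eq \<beta>. cmod (lookup (f \<beta>) \<mu>) * ?r \<mu>)
        = (\<Sum>\<mu>\<in>Eq \<beta>. cmod (lookup (f \<beta>) \<mu>) * (real (code \<mu>) / real (code \<beta>)) ^ c)"
      by (intro sum.cong) (auto simp: Eq_def)
    finally show "(\<Sum>\<mu>\<in>keys (f \<beta>) - {\<beta>}. cmod (lookup (f \<beta>) \<mu>) * weight c \<rho> \<mu>) \<le> weight c \<rho> \<beta>"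
      using c[OF \<beta>] \<rho>0(2)[OF _ _ \<beta>, of \<rho>] \<rho> weight_pos[of c \<rho> \<beta>]
      by (simp add: mult_le_cancel_left2)
  qed
qed

text \<open>
  Reduction by the basis does not increase the norm; it is stopped once all exponents are below
  \<open>0\<close>, which happens after finitely many steps because the weight is integral.
\<close>

lemma constant_residue_le_norm:
  assumes F: "\<And>\<alpha>. \<alpha> \<in> leading \<Longrightarrow> \<exists>\<beta>\<in>F. \<forall>i<N. \<beta> i \<le> \<alpha> i"
    and fL: "\<And>\<beta>. \<beta> \<in> F \<Longrightarrow> f \<beta> \<in> L"
    and f1: "\<And>\<beta>. \<beta> \<in> F \<Longrightarrow> lookup (f \<beta>) \<beta> = 1"
    and f_less: "\<And>\<beta> \<mu>. \<beta> \<in> F \<Longrightarrow> \<mu> \<in> keys (f \<beta>) \<Longrightarrow> \<mu> \<noteq> \<beta> \<Longrightarrow> \<mu> \<sqsubset> \<beta>"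
    and dom: "\<And>\<beta>. \<beta> \<in> F \<Longrightarrow> (\<Sum>\<mu>\<in>keys (f \<beta>) - {\<beta>}.
        cmod (lookup (f \<beta>) \<mu>) * weight c \<rho> \<mu>) \<le> weight c \<rho> \<beta>"
    and g: "keys g \<subseteq> exponents N" "g - single 0 z \<in> L"
  shows "cmod z \<le> wnorm c \<rho> g"
proof -
  note W = weight_pos[of c \<rho>] weight_plus[of c \<rho>]
  have main: "cmod z \<le> wnorm c \<rho> g"
    if "\<alpha> \<in> exponents N" "\<alpha> = 0 \<or> 0 \<sqsubset> \<alpha>" "\<And>\<mu>. \<mu> \<in> keys g \<Longrightarrow> \<mu> = \<alpha> \<or> \<mu> \<sqsubset> \<alpha>"
      "keys g \<subseteq> exponents N" "g - single 0 z \<in> L" for \<alpha> g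
    using that
  \<comment> \<open>For \<open>\<alpha> = 0\<close> or \<open>0 \<sqsubset> \<alpha>\<close> the
    weight is non-negative, so \<open>nat\<close> loses nothing and descent in
    \<open>\<sqsubset>\<close> becomes descent in a well-founded lexicographic order.\<close>
  proof (induction "(nat (wt \<alpha>), code \<alpha>)" arbitrary: \<alpha> g rule: wf_induct_rule[OF wf_lex_prod[OF wf_less_than wf_less_than]])
    case (1 \<alpha> g)
    have step: ?case if g': "\<And>\<mu>. \<mu> \<in> keys g' \<Longrightarrow> \<mu> \<sqsubset> \<alpha>" and pos: "0 \<sqsubset> \<alpha>"
      and gE: "keys g' \<subseteq> exponents N" and gL: "g' - single 0 z \<in> L"
      and le: "wnorm c \<rho> g' \<le> wnorm c \<rho> g" for g'
    proof -
      \<comment> \<open>Inserting 0 keeps the new bound from falling below 0, where the induction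
        hypothesis would not apply.\<close>
      obtain \<alpha>' where \<alpha>': "\<alpha>' \<in> insert 0 (keys g')"
          "\<And>\<mu>. \<mu> \<in> insert 0 (keys g') \<Longrightarrow> \<mu> = \<alpha>' \<or> \<mu> \<sqsubset> \<alpha>'"
        using ex_top[of "insert 0 (keys g')"] gE by auto
      have "\<alpha>' \<sqsubset> \<alpha>" using \<alpha>'(1) g' pos by auto
      moreover have "\<alpha>' = 0 \<or> 0 \<sqsubset> \<alpha>'" using \<alpha>'(2)[of 0] by auto
      ultimately have "((nat (wt \<alpha>'), code \<alpha>'), (nat (wt \<alpha>), code \<alpha>)) \<in> less_than <*lex*> less_than"
        by (auto simp: less_def wt_zero)
      moreover have "\<alpha>' \<in> exponents N" using \<alpha>'(1) gE by auto
      ultimately have "cmod z \<le> wnorm c \<rho> g'"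
        using \<alpha>' \<open>\<alpha>' = 0 \<or> 0 \<sqsubset> \<alpha>'\<close> gE gL by (intro "1.hyps"[of \<alpha>']) auto
      with le show ?thesis by linarith
    qed
    show ?case
    proof (cases "\<alpha> = 0")
      case True
      \<comment> \<open>All exponents of \<open>g\<close> other than 0 now have negative weight. If
        its constant term were not \<open>z\<close>, then \<open>g - single 0 z\<close> would
        contradict \<open>L_nonunit\<close>.\<close>
      have "lookup g 0 = z"
      proof (rule ccontr)
        assume "lookup g 0 \<noteq> z"
        then have "lookup (g - single 0 z) 0 \<noteq> 0" by (simp add: lookup_minus)
        then obtain \<mu> where \<mu>: "\<mu> \<in> keys (g - single 0 z)" "\<mu> \<noteq> 0" "0 \<le> wt \<mu>"
          using L_nonunit[OF "1.prems"(5)] by (auto simp: wt_def)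
        then have "\<mu> \<in> keys g" by (simp add: in_keys_iff lookup_minus lookup_single)
        then have "\<mu> \<sqsubset> 0" using "1.prems"(3) True \<mu> by blast
        then show False using \<mu> prime_code_pos[of N \<mu>] by (auto simp: less_def wt_zero prime_code_zero)
      qed
      then have "cmod z = cmod (lookup g 0) * weight c \<rho> 0"
        using weight_0[where W = "weight c \<rho>", OF W] by simp
      also have "\<dots> \<le> wnorm c \<rho> g"
        unfolding weighted_norm_superset[of "insert 0 (keys g)" g "weight c \<rho>", OF finite.insertI[OF finite_keys] subset_insertI]
        by (intro member_le_sum) (auto intro!: mult_nonneg_nonneg simp: less_imp_le[OF weight_pos])
      finally show ?thesis .
    next
      case False
      then have pos: "0 \<sqsubset> \<alpha>" using "1.prems" by blast
      show ?thesis
      proof (cases "\<alpha> \<in> keys g")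
        case False
        show ?thesis
        proof (rule step[of g])
          show "\<mu> \<sqsubset> \<alpha>" if "\<mu> \<in> keys g" for \<mu>
            using "1.prems"(3)[OF that] that False by auto
        qed (use "1.prems" pos in auto)
      next
        case True
        define s where "s = lookup g \<alpha>"
        have "\<alpha> \<in> leading"
        proof (rule leadingI[OF "1.prems"(5)])
          show "\<alpha> \<in> keys (g - single 0 z)"
            using True \<open>\<alpha> \<noteq> 0\<close> by (simp add: in_keys_iff lookup_minus lookup_single when_def)
          show "\<forall>\<mu>\<in>keys (g - single 0 z). \<mu> \<noteq> \<alpha> \<longrightarrow> \<mu> \<sqsubset> \<alpha>"
          proof (intro ballI impI)
            fix \<mu> assume \<mu>: "\<mu> \<in> keys (g - single 0 z)" "\<mu> \<noteq> \<alpha>"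
            show "\<mu> \<sqsubset> \<alpha>"
            proof (cases "\<mu> = 0")
              case False
              then have "\<mu> \<in> keys g" using \<mu> by (simp add: in_keys_iff lookup_minus lookup_single)
              then show ?thesis using "1.prems"(3) \<mu> by blast
            qed (use pos in auto)
          qed
        qed
        then obtain \<beta> where \<beta>: "\<beta> \<in> F" "\<And>i. i < N \<Longrightarrow> \<beta> i \<le> \<alpha> i" using F by blast
        have \<beta>E: "\<beta> \<in> exponents N" using L_keys[OF fL[OF \<beta>(1)]] f1[OF \<beta>(1)] by (auto simp: in_keys_iff subset_iff)
        \<comment> \<open>Truncated subtraction is exact here:
          \<open>\<beta> i \<le> \<alpha> i\<close> for \<open>i < N\<close>, and both vanish from
          \<open>N\<close> on.\<close>
        define \<gamma> where "\<gamma> = (\<lambda>i. \<alpha> i - \<beta> i)"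
        have \<gamma>E: "\<gamma> \<in> exponents N" using "1.prems"(1) by (auto simp: \<gamma>_def exponents_def)
        have \<gamma>: "\<gamma> + \<beta> = \<alpha>"
        proof
          fix i show "(\<gamma> + \<beta>) i = \<alpha> i"
            using \<beta>(2)[of i] \<beta>E "1.prems"(1) by (cases "i < N") (auto simp: \<gamma>_def exponents_def)
        qed
        define r where "r = f \<beta> - single \<beta> 1"
        have r_lookup: "lookup r \<mu> = (if \<mu> = \<beta> then 0 else lookup (f \<beta>) \<mu>)" for \<mu>
          using f1[OF \<beta>(1)] by (auto simp: r_def lookup_minus lookup_single)
        then have r_keys: "keys r = keys (f \<beta>) - {\<beta>}"
          by (auto simp: in_keys_iff split: if_splits)
        have r_norm: "wnorm c \<rho> r \<le> weight c \<rho> \<beta>"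
        proof -
          have "wnorm c \<rho> r = (\<Sum>\<mu>\<in>keys (f \<beta>) - {\<beta>}.
              cmod (lookup (f \<beta>) \<mu>) * weight c \<rho> \<mu>)"
            unfolding weighted_norm_def r_keys by (intro sum.cong) (auto simp: r_lookup)
          with dom[OF \<beta>(1)] show ?thesis by simp
        qed
        define h where "h = g - single \<alpha> s"
        have h_lookup: "lookup h \<mu> = (if \<mu> = \<alpha> then 0 else lookup g \<mu>)" for \<mu>
          by (auto simp: h_def s_def lookup_minus lookup_single)
        then have h_keys: "keys h = keys g - {\<alpha>}"
          by (auto simp: in_keys_iff split: if_splits)
        have h_norm: "wnorm c \<rho> g = cmod s * weight c \<rho> \<alpha> + wnorm c \<rho> h"
        proof -
          have "wnorm c \<rho> h = (\<Sum>\<mu>\<in>keys g - {\<alpha>}.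
              cmod (lookup g \<mu>) * weight c \<rho> \<mu>)"
            unfolding weighted_norm_def h_keys by (intro sum.cong) (auto simp: h_lookup)
          then show ?thesis unfolding weighted_norm_def[of _ g]
            using True by (subst sum.remove[of _ \<alpha>]) (auto simp: s_def)
        qed
        \<comment> \<open>Passing from \<open>g\<close> to \<open>h - t\<close> rewrites the leading
          term of \<open>g\<close> by the tail \<open>r\<close> of \<open>f \<beta>\<close>. By
          \<open>dom\<close> the new terms weigh at most as much as the removed one.\<close>
        define t where "t = single \<gamma> s * r"
        have t_keys: "\<exists>\<nu>\<in>keys (f \<beta>) - {\<beta>}. \<mu> = \<gamma> + \<nu>" if "\<mu> \<in> keys t" for \<mu>
          using subsetD[OF keys_mult that[unfolded t_def]] r_keys by (auto split: if_splits)
        have t_norm: "wnorm c \<rho> t \<le> cmod s * weight c \<rho> \<alpha>"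
        proof -
          have "wnorm c \<rho> t \<le> cmod s * weight c \<rho> \<gamma> * wnorm c \<rho> r"
            using weighted_norm_mult[where W = "weight c \<rho>", OF W, of "single \<gamma> s" r]
            by (simp add: t_def weighted_norm_single[where W = "weight c \<rho>", OF W])
          also have "\<dots> \<le> cmod s * weight c \<rho> \<gamma> * weight c \<rho> \<beta>"
            using r_norm by (intro mult_left_mono) (auto simp: less_imp_le[OF weight_pos])
          finally show ?thesis by (simp add: mult.assoc flip: weight_plus \<gamma>)
        qed
        have ht: "h - t = g - single \<gamma> s * f \<beta>"
          by (simp add: h_def t_def r_def algebra_simps mult_single \<gamma>[unfolded add.commute[of \<gamma>]])
        show ?thesis
        proof (rule step[of "h - t"])
          have ht_keys: "keys (h - t) \<subseteq> keys h \<union> keys t"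
            by (auto simp: in_keys_iff lookup_minus)
          show "\<mu> \<sqsubset> \<alpha>" if "\<mu> \<in> keys (h - t)" for \<mu>
            using subsetD[OF ht_keys that]
          proof
            assume "\<mu> \<in> keys h"
            then show ?thesis using "1.prems"(3) by (auto simp: h_keys)
          next
            assume "\<mu> \<in> keys t"
            then obtain \<nu> where \<nu>: "\<nu> \<in> keys (f \<beta>) - {\<beta>}" "\<mu> = \<gamma> + \<nu>" using t_keys by blast
            then have "\<nu> \<sqsubset> \<beta>" using f_less[OF \<beta>(1)] by blast
            then show ?thesis unfolding \<nu>(2) \<gamma>[symmetric] by (rule less_plus)
          qed
          have "keys (f \<beta>) \<subseteq> exponents N" by (rule L_keys[OF fL[OF \<beta>(1)]])
          then have "\<mu> \<in> exponents N" if "\<mu> \<in> keys t" for \<mu>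
            using t_keys[OF that] \<gamma>E by auto
          then have "keys t \<subseteq> exponents N" by blast
          moreover have "keys h \<subseteq> exponents N" using h_keys "1.prems"(4) by auto
          ultimately show "keys (h - t) \<subseteq> exponents N" using ht_keys by blast
          have "single \<gamma> s * f \<beta> \<in> L" using \<gamma>E fL[OF \<beta>(1)] by (intro L_mult) auto
          then have "(g - single 0 z) - single \<gamma> s * f \<beta> \<in> L"
            by (rule L_diff[OF "1.prems"(5)])
          then show "h - t - single 0 z \<in> L" unfolding ht by (simp add: algebra_simps)
          show "wnorm c \<rho> (h - t) \<le> wnorm c \<rho> g"
            using weighted_norm_diff[where W = "weight c \<rho>", OF W, of h t] t_norm h_norm by linarith
        qed (fact pos)
      qed
    qed
  qed
  obtain \<alpha> where \<alpha>: "\<alpha> \<in> insert 0 (keys g)"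
      "\<And>\<mu>. \<mu> \<in> insert 0 (keys g) \<Longrightarrow> \<mu> = \<alpha> \<or> \<mu> \<sqsubset> \<alpha>"
    using ex_top[of "insert 0 (keys g)"] g by auto
  show ?thesis
    by (rule main[of \<alpha>]) (use \<alpha> g in auto)
qed

text \<open>Applied to \<open>1 - l\<close> with \<open>z = 1\<close>, the division estimate says
  that 1 has distance at least 1 from \<open>L\<close>. A seminorm on the quotient for which every
  variable is congruent to a number \<open>x j\<close> then evaluates polynomials at
  \<open>x\<close>, so \<open>x\<close> is a zero of \<open>L\<close>, and \<open>cmod (x j)\<close>
  is bounded by the norm of the variable.\<close>

lemma ex_zero_in_polydisc:
  "\<exists>C>0. \<exists>\<rho>0>0. \<forall>\<rho>. 0 < \<rho> \<and> \<rho> < \<rho>0 \<longrightarrow> (\<exists>x.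
     (\<forall>f\<in>L. cplx.eval (\<lambda>\<mu>. \<Prod>i<N. x i ^ \<mu> i) f = 0) \<and> (\<forall>j<N. cmod (x j) \<le> C * exp (a j / \<rho>)))"
proof -
  obtain F where F: "F \<subseteq> leading" "finite F" "\<And>\<alpha>. \<alpha> \<in> leading \<Longrightarrow> \<exists>\<beta>\<in>F. \<forall>i\<in>{..<N}. \<beta> i \<le> \<alpha> i"
    using dickson[of "{..<N}" leading] by auto
  have "\<forall>\<beta>\<in>F. \<exists>f\<in>L. lookup f \<beta> = 1 \<and> (\<forall>\<mu>\<in>keys f. \<mu> \<noteq> \<beta> \<longrightarrow> \<mu> \<sqsubset> \<beta>)"
    using F(1) by (auto simp: leading_def)
  then obtain f where f: "\<And>\<beta>. \<beta> \<in> F \<Longrightarrow> f \<beta> \<in> L" "\<And>\<beta>. \<beta> \<in> F \<Longrightarrow> lookup (f \<beta>) \<beta> = 1"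
      "\<And>\<beta> \<mu>. \<beta> \<in> F \<Longrightarrow> \<mu> \<in> keys (f \<beta>) \<Longrightarrow> \<mu> \<noteq> \<beta> \<Longrightarrow> \<mu> \<sqsubset> \<beta>"
    by metis
  have "\<exists>c. \<exists>\<rho>0>0. \<forall>\<rho>. 0 < \<rho> \<and> \<rho> < \<rho>0 \<longrightarrow> (\<forall>\<beta>\<in>F.
      (\<Sum>\<mu>\<in>keys (f \<beta>) - {\<beta>}. cmod (lookup (f \<beta>) \<mu>) * weight c \<rho> \<mu>) \<le> weight c \<rho> \<beta>)"
    using F(2) f(3) by (rule leading_terms_dominate)
  then obtain c where "\<exists>\<rho>0>0. \<forall>\<rho>. 0 < \<rho> \<and> \<rho> < \<rho>0 \<longrightarrow> (\<forall>\<beta>\<in>F.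
      (\<Sum>\<mu>\<in>keys (f \<beta>) - {\<beta>}. cmod (lookup (f \<beta>) \<mu>) * weight c \<rho> \<mu>) \<le> weight c \<rho> \<beta>)"
    by (rule exE)
  then obtain \<rho>0 where \<rho>0: "\<rho>0 > 0" and dom: "\<And>\<rho> \<beta>. 0 < \<rho> \<Longrightarrow> \<rho> < \<rho>0 \<Longrightarrow> \<beta> \<in> F \<Longrightarrow>
      (\<Sum>\<mu>\<in>keys (f \<beta>) - {\<beta>}. cmod (lookup (f \<beta>) \<mu>) * weight c \<rho> \<mu>) \<le> weight c \<rho> \<beta>"
    by blast
  define e :: "nat \<Rightarrow> nat \<Rightarrow> nat" where "e j = (\<lambda>i. if i = j then 1 else 0)" for j
  define T :: "nat \<Rightarrow> (nat \<Rightarrow> nat) \<Rightarrow>\<^sub>0 complex" where "T j = single (e j) 1" for j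
  \<comment> \<open>Dominates the tie-breaking part \<open>code (e j) ^ c\<close> of every radius;
    the summand 1 makes \<open>C\<close> positive also for \<open>N = 0\<close>.\<close>
  define C where "C = (\<Sum>j<N. real (code (e j)) ^ c) + 1"
  have C: "C > 0" "\<And>j. j < N \<Longrightarrow> real (code (e j)) ^ c \<le> C"
  proof -
    show "C > 0" by (auto simp: C_def intro!: add_nonneg_pos sum_nonneg)
    fix j assume "j < N"
    then have "real (code (e j)) ^ c \<le> (\<Sum>j<N. real (code (e j)) ^ c)"
      by (intro member_le_sum) auto
    then show "real (code (e j)) ^ c \<le> C" by (simp add: C_def)
  qed
  define B where "B = {f :: (nat \<Rightarrow> nat) \<Rightarrow>\<^sub>0 complex. keys f \<subseteq> exponents N}"
  interpret P: complex_subalgebra "single 0" B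
    unfolding B_def by (rule complex_subalgebra_monoid_algebra) auto
  have "\<exists>x. (\<forall>f\<in>L. cplx.eval (\<lambda>\<mu>. \<Prod>i<N. x i ^ \<mu> i) f = 0) \<and> (\<forall>j<N. cmod (x j) \<le> C * exp (a j / \<rho>))"
    if \<rho>: "0 < \<rho>" "\<rho> < \<rho>0" for \<rho>
  proof -
    note W = weight_pos[of c \<rho>] weight_plus[of c \<rho>]
    define q where "q = wnorm c \<rho>"
    have q: "P.seminorm q"
      unfolding P.seminorm_def q_def using weighted_norm_single[where W = "weight c \<rho>", OF W, of 0 1]
      by (auto simp: weighted_norm_nonneg[where W = "weight c \<rho>", OF W] weighted_norm_add[where W = "weight c \<rho>", OF W] weighted_norm_mult[where W = "weight c \<rho>", OF W]
          weighted_norm_single[where W = "weight c \<rho>", OF W] weight_0[where W = "weight c \<rho>", OF W] single_one)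
    obtain q1 where q1: "P.seminorm q1" "\<And>f. f \<in> B \<Longrightarrow> q1 f \<le> q f" "\<And>f. f \<in> L \<Longrightarrow> q1 f = 0"
    proof (rule P.quotient_seminorm[OF q, of L])
      show "L \<subseteq> B" using L_keys by (auto simp: B_def)
      show "f * g \<in> L" if "f \<in> B" "g \<in> L" for f g using that by (auto simp: B_def intro: L_mult)
      show "1 \<le> q (1 - l)" if l: "l \<in> L" for l
      proof -
        have "cmod 1 \<le> wnorm c \<rho> (1 - l)"
        proof (rule constant_residue_le_norm[where F = F and f = f])
          show "1 - l - single 0 1 \<in> L" using L_uminus[OF l] by simp
          show "keys (1 - l) \<subseteq> exponents N"
            using l P.diff_mem[OF P.one_mem, of l] \<open>L \<subseteq> B\<close> by (auto simp: B_def)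
          show "\<exists>\<beta>\<in>F. \<forall>i<N. \<beta> i \<le> \<alpha> i" if "\<alpha> \<in> leading" for \<alpha>
            using F(3)[OF that] by (simp add: Ball_def)
        qed (use f dom[OF \<rho>] in auto)
        then show ?thesis by (simp add: q_def)
      qed
    qed (use L_zero L_add in auto)
    have TB: "T j \<in> B" if "j < N" for j
      using that by (auto simp: T_def B_def e_def exponents_def)
    obtain x q2 where q2: "P.seminorm q2" "\<And>f. f \<in> B \<Longrightarrow> q2 f \<le> q1 f"
        "\<And>j. j < N \<Longrightarrow> q2 (T j - single 0 (x j)) = 0"
      using P.common_character[OF q1(1), of N T] TB by blast
    \<comment> \<open>Congruence of \<open>f\<close> to the scalar \<open>z\<close> modulo the
      kernel of \<open>q2\<close>. Its compatibility with the ring operations replaces a quotient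
      ring.\<close>
    define Q where "Q f z \<longleftrightarrow> f \<in> B \<and> q2 (f - single 0 z) = 0" for f z
    have nn: "0 \<le> q2 f" if "f \<in> B" for f using P.q_nonneg[OF q2(1) that] .
    have Q_add: "Q (f + g) (z + w)" if "Q f z" "Q g w" for f g z w
    proof -
      have B: "f \<in> B" "g \<in> B" using that by (auto simp: Q_def)
      have "q2 ((f - single 0 z) + (g - single 0 w)) \<le> 0"
        using P.q_add[OF q2(1), of "f - single 0 z" "g - single 0 w"] that
        by (auto simp: Q_def P.mem_intros)
      moreover have "(f - single 0 z) + (g - single 0 w) = f + g - single 0 (z + w)"
        by (simp add: single_add)
      ultimately show ?thesis using nn[of "f + g - single 0 (z + w)"] B
        by (auto simp: Q_def P.mem_intros)
    qed
    have Q_mult: "Q (f * g) (z * w)" if "Q f z" "Q g w" for f g z w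
    proof -
      have B: "f \<in> B" "g \<in> B" using that by (auto simp: Q_def)
      have eq: "f * g - single 0 (z * w) =
          f * (g - single 0 w) + single 0 w * (f - single 0 z)"
        by (simp add: P.sc_mult algebra_simps)
      have "q2 (f * g - single 0 (z * w)) \<le>
          q2 f * q2 (g - single 0 w) + q2 (single 0 w) * q2 (f - single 0 z)"
        unfolding eq
        by (rule order_trans[OF P.q_add[OF q2(1)]])
          (intro P.mem_intros B add_mono P.q_mult[OF q2(1)])+
      then show ?thesis using that nn[of "f * g - single 0 (z * w)"] B
        by (auto simp: Q_def P.mem_intros)
    qed
    have Q_sc: "Q (single 0 z) z" for z
      by (simp add: Q_def P.sc_mem P.q_zero[OF q2(1)])
    have Q_T: "Q (T j) (x j)" if "j < N" for j using q2(3)[OF that] TB[OF that] by (simp add: Q_def)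
    have Q_pow: "Q (f ^ n) (z ^ n)" if "Q f z" for f z n
      by (induction n) (use Q_sc[of 1] Q_mult[OF that] in auto)
    have Q_prod: "Q (\<Prod>j\<in>J. h j) (\<Prod>j\<in>J. w j)" if "\<And>j. j \<in> J \<Longrightarrow> Q (h j) (w j)" for h w and J :: "nat set"
      using that by (induction J rule: infinite_finite_induct) (use Q_sc[of 1] Q_mult in auto)
    have Q_sum: "Q (\<Sum>j\<in>J. h j) (\<Sum>j\<in>J. w j)" if "\<And>j. j \<in> J \<Longrightarrow> Q (h j) (w j)" for h w and J :: "(nat \<Rightarrow> nat) set"
      using that by (induction J rule: infinite_finite_induct) (use Q_sc[of 0] Q_add in auto)
    have mono: "(\<Prod>j<N. T j ^ \<mu> j) = single \<mu> 1" if \<mu>: "\<mu> \<in> exponents N" for \<mu>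
    proof -
      have p: "T j ^ n = single (\<lambda>i. if i = j then n else 0) 1" for j n
      proof (induction n)
        case 0
        have "(\<lambda>i. if i = j then 0 else 0) = (0 :: nat \<Rightarrow> nat)" by auto
        then show ?case by (simp add: single_one)
      next
        case (Suc n)
        have "e j + (\<lambda>i. if i = j then n else 0) = (\<lambda>i. if i = j then Suc n else 0)"
          by (auto simp: e_def)
        with Suc show ?case by (simp add: T_def mult_single)
      qed
      have "(\<Prod>j<n. T j ^ \<mu> j) = single (\<lambda>i. if i < n then \<mu> i else 0) 1" for n
      proof (induction n)
        case 0
        have "(\<lambda>i. 0) = (0 :: nat \<Rightarrow> nat)" by auto
        then show ?case by (simp add: single_one)
      next
        case (Suc n)
        have "(\<lambda>i. if i < n then \<mu> i else 0) + (\<lambda>i. if i = n then \<mu> n else 0) = (\<lambda>i. if i < Suc n then \<mu> i else 0)"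
          by (auto simp: fun_eq_iff)
        with Suc show ?case by (simp add: p mult_single)
      qed
      from this[of N] have "(\<Prod>j<N. T j ^ \<mu> j) = single (\<lambda>i. if i < N then \<mu> i else 0) 1" .
      also have "(\<lambda>i. if i < N then \<mu> i else 0) = \<mu>" using \<mu> by (auto simp: exponents_def fun_eq_iff)
      finally show ?thesis .
    qed
    have Q_eval: "Q f (cplx.eval (\<lambda>\<mu>. \<Prod>i<N. x i ^ \<mu> i) f)" if "f \<in> B" for f
    proof -
      have "Q (\<Sum>\<mu>\<in>keys f. single 0 (lookup f \<mu>) * (\<Prod>j<N. T j ^ \<mu> j))
          (\<Sum>\<mu>\<in>keys f. lookup f \<mu> * (\<Prod>i<N. x i ^ \<mu> i))"
        by (intro Q_sum Q_mult Q_prod Q_sc Q_pow Q_T) auto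
      also have "(\<Sum>\<mu>\<in>keys f. single 0 (lookup f \<mu>) * (\<Prod>j<N. T j ^ \<mu> j))
          = (\<Sum>\<mu>\<in>keys f. single \<mu> (lookup f \<mu>))"
        using that by (intro sum.cong refl) (auto simp: mono B_def subset_iff mult_single)
      finally show ?thesis by (simp add: cplx.eval_def flip: poly_mapping_eq_sum_single)
    qed
    show ?thesis
    proof (intro exI[of _ x] conjI ballI allI impI)
      fix f assume f: "f \<in> L"
      then have fB: "f \<in> B" using L_keys by (auto simp: B_def)
      define z where "z = cplx.eval (\<lambda>\<mu>. \<Prod>i<N. x i ^ \<mu> i) f"
      have "q2 (single 0 z) = 0"
      proof -
        have "q2 f = 0" using q2(2)[OF fB] q1(3)[OF f] nn[OF fB] by simp
        moreover have "q2 (f - single 0 z) = 0" using Q_eval[OF fB] by (simp add: Q_def z_def)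
        moreover have "q2 (single 0 z) \<le> q2 f + q2 (f - single 0 z)"
          using P.q_diff[OF q2(1), of f "f - single 0 z"] fB by (simp add: P.mem_intros)
        ultimately show ?thesis using nn[OF P.sc_mem, of z] by simp
      qed
      then show "cplx.eval (\<lambda>\<mu>. \<Prod>i<N. x i ^ \<mu> i) f = 0" using P.q_sc[OF q2(1), of z] by (simp add: z_def)
    next
      fix j assume j: "j < N"
      have "cmod (x j) = q2 (single 0 (x j))" by (rule P.q_sc[OF q2(1), symmetric])
      also have "\<dots> \<le> q2 (T j) + q2 (T j - single 0 (x j))"
        using P.q_diff[OF q2(1), of "T j" "T j - single 0 (x j)"] TB[OF j] by (simp add: P.mem_intros)
      also have "\<dots> \<le> q (T j)" using q2(2)[OF TB[OF j]] q1(2)[OF TB[OF j]] q2(3)[OF j] by simp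
      also have "\<dots> = exp (a j / \<rho>) * real (code (e j)) ^ c"
      proof -
        have "wt (e j) = (\<Sum>i<N. if i = j then a j else 0)"
          unfolding wt_def by (intro sum.cong) (auto simp: e_def)
        then have "wt (e j) = a j" using j by simp
        then show ?thesis by (simp add: q_def T_def weighted_norm_single[where W = "weight c \<rho>", OF W] weight_def)
      qed
      also have "\<dots> \<le> exp (a j / \<rho>) * C" using C(2)[OF j] by (intro mult_left_mono) auto
      finally show "cmod (x j) \<le> C * exp (a j / \<rho>)" by (simp add: mult.commute)
    qed
  qed
  with C(1) \<rho>0 show ?thesis by blast
qed

end

subsection \<open>Lattices, cones and their dual monoids\<close>

lemma linear_nonneg_on_cone_hull:
  assumes f: "linear f" and V: "\<And>v. v \<in> V \<Longrightarrow> 0 \<le> f v" and v: "v \<in> convex_cone hull V"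
  shows "0 \<le> (f v :: real)"
proof -
  have "convex_cone {v. 0 \<le> f v}"
    unfolding convex_cone_def cone_def convex_def conic_def
    by (auto simp: linear_add[OF f] linear_scale[OF f] intro!: exI[of _ 0] simp: linear_0[OF f])
  then have "convex_cone hull V \<subseteq> {v. 0 \<le> f v}" using V by (intro hull_minimal) auto
  with v show ?thesis by blast
qed

lemma dual_lattice_linear: "m \<in> dual_lattice N \<Longrightarrow> linear m"
  and dual_lattice_Ints: "m \<in> dual_lattice N \<Longrightarrow> v \<in> N \<Longrightarrow> m v \<in> \<int>"
  by (auto simp: dual_lattice_def)

lemma zero_in_dual_lattice: "0 \<in> dual_lattice N"
  by (auto simp: dual_lattice_def linear_iff)

lemma plus_in_dual_lattice: "m \<in> dual_lattice N \<Longrightarrow> m' \<in> dual_lattice N \<Longrightarrow> m + m' \<in> dual_lattice N"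
  by (auto simp: dual_lattice_def linear_iff algebra_simps)

lemma uminus_in_dual_lattice: "m \<in> dual_lattice N \<Longrightarrow> - m \<in> dual_lattice N"
  by (auto simp: dual_lattice_def linear_iff algebra_simps)

lemma diff_in_dual_lattice: "m \<in> dual_lattice N \<Longrightarrow> m' \<in> dual_lattice N \<Longrightarrow> m - m' \<in> dual_lattice N"
  using plus_in_dual_lattice[OF _ uminus_in_dual_lattice] by fastforce

lemma of_nat_times_in_dual_lattice: "m \<in> dual_lattice N \<Longrightarrow> of_nat k * m \<in> dual_lattice N"
  by (induction k) (auto simp: distrib_right zero_in_dual_lattice plus_in_dual_lattice)

lemma cone_monoid_dual: "m \<in> cone_monoid N \<sigma> \<Longrightarrow> m \<in> dual_lattice N"
  by (simp add: cone_monoid_def)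

lemma zero_in_cone_monoid: "0 \<in> cone_monoid N \<sigma>"
  by (simp add: cone_monoid_def zero_in_dual_lattice)

lemma plus_in_cone_monoid: "m \<in> cone_monoid N \<sigma> \<Longrightarrow> m' \<in> cone_monoid N \<sigma> \<Longrightarrow> m + m' \<in> cone_monoid N \<sigma>"
  by (auto simp: cone_monoid_def plus_in_dual_lattice)

lemma of_nat_times_in_cone_monoid: "m \<in> cone_monoid N \<sigma> \<Longrightarrow> of_nat k * m \<in> cone_monoid N \<sigma>"
  by (auto simp: cone_monoid_def of_nat_times_in_dual_lattice)

lemma sum_in_cone_monoid: "(\<And>i. i \<in> I \<Longrightarrow> h i \<in> cone_monoid N \<sigma>) \<Longrightarrow> sum h I \<in> cone_monoid N \<sigma>"
  by (induction I rule: infinite_finite_induct) (auto simp: zero_in_cone_monoid plus_in_cone_monoid)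

lemma cone_monoid_antimono: "\<tau> \<subseteq> \<sigma> \<Longrightarrow> cone_monoid N \<sigma> \<subseteq> cone_monoid N \<tau>"
  by (auto simp: cone_monoid_def)

lemma cone_monoid_hull:
  "cone_monoid N (convex_cone hull V) = {m \<in> dual_lattice N. \<forall>v\<in>V. 0 \<le> m v}"
  using hull_inc[of _ V convex_cone]
  by (auto simp: cone_monoid_def intro: linear_nonneg_on_cone_hull[of _ V, OF dual_lattice_linear])

lemma lattice_basis:
  assumes "is_lattice N"
  obtains B where "finite B" "independent B" "span B = UNIV" "B \<subseteq> N"
    "\<And>v. v \<in> N \<Longrightarrow> \<exists>c :: 'v :: real_vector \<Rightarrow> int. v = (\<Sum>b\<in>B. of_int (c b) *\<^sub>R b)"
proof -
  obtain B where B: "finite B" "independent B" "span B = UNIV"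
      "N = {\<Sum>b\<in>B. of_int (c b) *\<^sub>R b | c :: 'v \<Rightarrow> int. True}"
    using assms by (auto simp: is_lattice_def)
  have "B \<subseteq> N"
  proof
    fix b assume b: "b \<in> B"
    have "(\<Sum>x\<in>B. of_int (if x = b then 1 else 0) *\<^sub>R x) = (\<Sum>x\<in>B. if x = b then b else 0)"
      by (intro sum.cong) auto
    then have "b = (\<Sum>x\<in>B. of_int (if x = b then 1 else 0) *\<^sub>R x)" using b B(1) by simp
    then show "b \<in> N" unfolding B(4) by (intro CollectI exI[of _ "\<lambda>x. if x = b then 1 else 0"]) simp
  qed
  with B show ?thesis by (intro that) auto
qed

text \<open>
  A real functional cutting out a face is replaced by an integral one via Dirichlet's simultaneous
  approximation theorem: values at lattice points are integers, so those that should vanish do.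
\<close>

lemma integral_functional_near:
  fixes N :: "'v::real_vector set"
  assumes "is_lattice N" "finite V" "V \<subseteq> N" "linear u0" "\<epsilon> > 0"
  obtains q :: int and u where "q > 0" "u \<in> dual_lattice N" "\<And>v. v \<in> V \<Longrightarrow> \<bar>u v - real_of_int q * u0 v\<bar> < \<epsilon>"
proof -
  obtain B where B: "finite B" "independent B" "span B = UNIV" "B \<subseteq> N"
      "\<And>v. v \<in> N \<Longrightarrow> \<exists>c :: 'v \<Rightarrow> int. v = (\<Sum>b\<in>B. of_int (c b) *\<^sub>R b)"
    by (rule lattice_basis[OF assms(1)]) blast
  obtain c :: "'v \<Rightarrow> 'v \<Rightarrow> int" where c: "\<And>v. v \<in> N \<Longrightarrow> v = (\<Sum>b\<in>B. of_int (c v b) *\<^sub>R b)"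
    using B(5) by metis
  define K where "K = (\<Sum>v\<in>V. \<Sum>b\<in>B. \<bar>real_of_int (c v b)\<bar>)"
  have K: "(\<Sum>b\<in>B. \<bar>real_of_int (c v b)\<bar>) \<le> K" if "v \<in> V" for v
    unfolding K_def using that assms(2) by (intro member_le_sum) (auto intro: sum_nonneg)
  have K0: "K \<ge> 0" unfolding K_def by (intro sum_nonneg) auto
  \<comment> \<open>An error of \<open>1 / NN\<close> on the basis grows to at most
    \<open>K / NN\<close> on \<open>V\<close>. The extra 1 makes \<open>NN\<close> positive even if
    \<open>K = 0\<close>.\<close>
  obtain NN :: nat where NN: "(K + 1) / \<epsilon> < NN" using reals_Archimedean2 by blast
  moreover have "0 < (K + 1) / \<epsilon>" using K0 assms(5) by simp
  ultimately have NN0: "NN > 0" by (metis of_nat_0_less_iff order_less_trans)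
  obtain h where h: "bij_betw h B {..<card B}"
    using ex_bij_betw_finite_nat[OF B(1)] by (auto simp: atLeast0LessThan)
  obtain q p where qp: "0 < q" "\<And>i. i < card B \<Longrightarrow> \<bar>of_int q * u0 (inv_into B h i) - of_int (p i)\<bar> < 1 / NN"
    by (rule Dirichlet_approx_simult[OF NN0, of "card B" "\<lambda>i. u0 (inv_into B h i)"]) blast
  have near: "\<bar>of_int q * u0 b - of_int (p (h b))\<bar> < 1 / NN" if "b \<in> B" for b
    using qp(2)[of "h b"] that h by (auto simp: bij_betw_def inv_into_f_f)
  obtain u where u: "linear u" "\<And>b. b \<in> B \<Longrightarrow> u b = real_of_int (p (h b))"
    using linear_independent_extend[OF B(2), of "\<lambda>b. real_of_int (p (h b))"] by blast
  have eval: "f v = (\<Sum>b\<in>B. of_int (c v b) * f b)" if "linear f" "v \<in> N" for f :: "'v \<Rightarrow> real" and v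
    by (subst c[OF that(2)]) (simp add: linear_sum[OF that(1)] linear_scale[OF that(1)])
  show ?thesis
  proof (rule that[OF qp(1), of u])
    show "u \<in> dual_lattice N"
      unfolding dual_lattice_def using u eval[OF u(1)] by (auto intro!: Ints_sum Ints_mult)
    fix v assume v: "v \<in> V"
    then have vN: "v \<in> N" using assms by blast
    have "u v - q * u0 v = (\<Sum>b\<in>B. of_int (c v b) * (p (h b) - q * u0 b))"
      by (simp add: eval[OF u(1) vN] eval[OF assms(4) vN] u(2) sum_distrib_left algebra_simps sum_subtractf)
    then have "\<bar>u v - real_of_int q * u0 v\<bar> \<le> (\<Sum>b\<in>B. \<bar>of_int (c v b) * (p (h b) - q * u0 b)\<bar>)"
      by (simp add: sum_abs)
    also have "\<dots> \<le> (\<Sum>b\<in>B. \<bar>of_int (c v b)\<bar> * (1 / NN))"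
      unfolding abs_mult using near by (intro sum_mono mult_left_mono) (auto simp: abs_minus_commute less_imp_le)
    also have "\<dots> = (\<Sum>b\<in>B. \<bar>of_int (c v b)\<bar>) * (1 / NN)" by (simp only: sum_distrib_right)
    also have "\<dots> \<le> K * (1 / NN)" using K[OF v] by (intro mult_right_mono) auto
    also have "\<dots> < \<epsilon>"
    proof -
      have "K < \<epsilon> * NN" using NN assms(5) K0 by (simp add: field_simps)
      then show ?thesis using NN0 by (simp add: field_simps)
    qed
    finally show "\<bar>u v - real_of_int q * u0 v\<bar> < \<epsilon>" .
  qed
qed

text \<open>The integral \<open>u\<close> vanishes on the same generators as \<open>u0\<close>.
  Hence each is at most a multiple of the other on the generators, therefore on the cone, and they
  have the same zeros in it.\<close>

lemma cone_face_integral: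
  fixes N :: "'v::real_vector set"
  assumes N: "is_lattice N" and \<sigma>: "rational_polyhedral_cone N \<sigma>" and \<tau>: "cone_face \<tau> \<sigma>"
  obtains u where "u \<in> cone_monoid N \<sigma>" "\<tau> = {v \<in> \<sigma>. u v = 0}"
proof -
  obtain V where V: "finite V" "V \<subseteq> N" "\<sigma> = convex_cone hull V"
    using \<sigma> by (auto simp: rational_polyhedral_cone_def)
  obtain u0 where u0: "linear u0" "\<And>v. v \<in> \<sigma> \<Longrightarrow> 0 \<le> u0 v" "\<tau> = {v \<in> \<sigma>. u0 v = (0::real)}"
    using \<tau> by (auto simp: cone_face_def)
  have V\<sigma>: "v \<in> \<sigma>" if "v \<in> V" for v using that V(3) by (simp add: hull_inc)
  \<comment> \<open>The entry 1 forces integral values near 0 to be 0; the other entries keep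
    \<open>u\<close> positive on generators where \<open>u0\<close> is.\<close>
  define \<delta> where "\<delta> = Min (insert 1 (u0 ` {v \<in> V. u0 v > 0}))"
  have \<delta>: "0 < \<delta>" "\<delta> \<le> 1" "\<And>v. v \<in> V \<Longrightarrow> u0 v > 0 \<Longrightarrow> \<delta> \<le> u0 v"
    using V(1) by (auto simp: \<delta>_def)
  obtain q :: int and u where u: "q > 0" "u \<in> dual_lattice N" "\<And>v. v \<in> V \<Longrightarrow> \<bar>u v - real_of_int q * u0 v\<bar> < \<delta>"
    by (rule integral_functional_near[OF N V(1,2) u0(1) \<delta>(1)]) blast
  have zero: "u v = 0" if "v \<in> V" "u0 v = 0" for v
  proof -
    have "\<bar>u v\<bar> < 1" using u(3)[OF that(1)] \<delta>(2) that(2) by simp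
    moreover have "u v \<in> \<int>" using dual_lattice_Ints[OF u(2)] that V(2) by blast
    ultimately show ?thesis by (metis Ints_nonzero_abs_less1)
  qed
  have pos: "u v > 0" if "v \<in> V" "u0 v > 0" for v
  proof -
    have "1 * u0 v \<le> q * u0 v" using u(1) that by (intro mult_right_mono) auto
    then show ?thesis using u(3)[OF that(1)] \<delta>(3)[OF that] by linarith
  qed
  \<comment> \<open>Bounds the ratios in both directions. Generators at which both functionals
    vanish contribute \<open>0 / 0 = 0\<close>.\<close>
  define C where "C = (\<Sum>v\<in>V. u v / u0 v + u0 v / u v)"
  have nn: "0 \<le> u v \<and> 0 \<le> u0 v" if "v \<in> V" for v
    using zero[OF that] pos[OF that] u0(2)[OF V\<sigma>[OF that]] by fastforce
  have C: "u v / u0 v + u0 v / u v \<le> C" if "v \<in> V" for v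
    unfolding C_def using that V(1) nn by (intro member_le_sum) (auto intro!: add_nonneg_nonneg)
  have uC: "u v \<le> C * u0 v" "u0 v \<le> C * u v" if v: "v \<in> V" for v
  proof -
    have "u v \<le> C * u0 v \<and> u0 v \<le> C * u v"
    proof (cases "u0 v = 0")
      case False
      then have p: "u0 v > 0" "u v > 0" using nn[OF v] pos[OF v] by auto
      then have "0 \<le> u v / u0 v" "0 \<le> u0 v / u v" by auto
      with C[OF v] have "u v / u0 v \<le> C" "u0 v / u v \<le> C" by linarith+
      with p show ?thesis by (simp add: field_simps)
    qed (use zero[OF v] in simp)
    then show "u v \<le> C * u0 v" "u0 v \<le> C * u v" by auto
  qed
  note lu = dual_lattice_linear[OF u(2)]
  have "0 \<le> C * u0 v - u v" if "v \<in> \<sigma>" for v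
    by (rule linear_nonneg_on_cone_hull[where V = V and f = "\<lambda>v. C * u0 v - u v"])
      (use that V uC u0(1) lu in \<open>auto simp: linear_iff algebra_simps\<close>)
  moreover have "0 \<le> C * u v - u0 v" if "v \<in> \<sigma>" for v
    by (rule linear_nonneg_on_cone_hull[where V = V and f = "\<lambda>v. C * u v - u0 v"])
      (use that V uC u0(1) lu in \<open>auto simp: linear_iff algebra_simps\<close>)
  moreover have "0 \<le> u v" if "v \<in> \<sigma>" for v
    by (rule linear_nonneg_on_cone_hull[OF lu, of V]) (use that V nn in auto)
  ultimately show ?thesis
    using u0(2,3) u(2) by (intro that[of u]) (force simp: cone_monoid_def)+
qed

text \<open>Every character of the face chart becomes regular on the big chart after multiplication
  by a power of the character \<open>u\<close>: the face chart is the locus where \<open>u\<close>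
  is invertible.\<close>

lemma face_monoid_shift:
  assumes \<sigma>: "rational_polyhedral_cone N \<sigma>" and u: "u \<in> cone_monoid N \<sigma>"
    and m: "m \<in> cone_monoid N {v \<in> \<sigma>. u v = 0}"
  shows "\<exists>k. m + of_nat k * u \<in> cone_monoid N \<sigma>"
proof -
  obtain V where V: "finite V" "V \<subseteq> N" "\<sigma> = convex_cone hull V"
    using \<sigma> by (auto simp: rational_polyhedral_cone_def)
  \<comment> \<open>Generators with \<open>u v = 0\<close> contribute \<open>m v / 0 = 0\<close>
    here; on them \<open>m\<close> is non-negative by hypothesis.\<close>
  obtain k :: nat where k: "(\<Sum>v\<in>V. \<bar>m v / u v\<bar>) \<le> k" using real_arch_simple by blast
  have "0 \<le> m v + k * u v" if v: "v \<in> V" for v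
  proof -
    have v\<sigma>: "v \<in> \<sigma>" using v V(3) by (simp add: hull_inc)
    show ?thesis
    proof (cases "u v = 0")
      case True
      then show ?thesis using m v\<sigma> by (simp add: cone_monoid_def)
    next
      case False
      then have p: "u v > 0" using u v\<sigma> by (auto simp: cone_monoid_def less_le)
      have "\<bar>m v / u v\<bar> \<le> (\<Sum>v\<in>V. \<bar>m v / u v\<bar>)" using V(1) v by (intro member_le_sum) auto
      then have "- (m v / u v) \<le> k" using k by linarith
      then show ?thesis using p by (simp add: field_simps)
    qed
  qed
  then show ?thesis
    using u m unfolding V(3) cone_monoid_hull
    by (intro exI[of _ k]) (auto simp: cone_monoid_def intro!: plus_in_dual_lattice of_nat_times_in_dual_lattice)
qed

text \<open>As \<open>\<Lambda>\<close> spans, an element of \<open>S\<close> is determined by its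
  vector of natural values on \<open>\<Lambda>\<close>. Dickson's lemma gives finitely many elements
  dominated by all others, and subtracting them repeatedly ends at 0.\<close>

lemma gordan_spanning:
  fixes N :: "'v::real_vector set"
  assumes \<Lambda>: "finite \<Lambda>" "\<Lambda> \<subseteq> N" "span \<Lambda> = UNIV"
  defines "S \<equiv> {m \<in> dual_lattice N. \<forall>l\<in>\<Lambda>. 0 \<le> m l}"
  shows "\<exists>G\<subseteq>S. finite G \<and> (\<forall>m\<in>S. \<exists>c. m = (\<Sum>g\<in>G. of_nat (c g) * g))"
proof -
  define h where "h m l = nat \<lfloor>m l\<rfloor>" for m :: "'v \<Rightarrow> real" and l
  have h: "real (h m l) = m l" if "m \<in> S" "l \<in> \<Lambda>" for m l
  proof -
    have "m l \<in> \<int>" "0 \<le> m l" using that \<Lambda>(2) by (auto simp: S_def dual_lattice_def)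
    then show ?thesis by (auto simp: h_def elim!: Ints_cases)
  qed
  \<comment> \<open>Without 0, every subtraction strictly decreases the sum of the values.\<close>
  obtain F where F: "F \<subseteq> h ` (S - {0})" "finite F"
      "\<And>a. a \<in> h ` (S - {0}) \<Longrightarrow> \<exists>b\<in>F. \<forall>l\<in>\<Lambda>. b l \<le> a l"
    using dickson[OF \<Lambda>(1), of "h ` (S - {0})"] by meson
  obtain G where G: "G \<subseteq> S - {0}" "finite G" "F = h ` G"
    using finite_subset_image[OF F(2,1)] by blast
  have "\<exists>c. m = (\<Sum>g\<in>G. of_nat (c g) * g)" if "m \<in> S" for m
    using that
  proof (induction "\<Sum>l\<in>\<Lambda>. h m l" arbitrary: m rule: less_induct)
    case less
    show ?case
    proof (cases "m = 0")
      case True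
      then show ?thesis by (intro exI[of _ "\<lambda>_. 0"]) simp
    next
      case False
      then obtain g where g: "g \<in> G" "\<forall>l\<in>\<Lambda>. h g l \<le> h m l" using F(3)[of "h m"] less.prems G(3) by auto
      have gS: "g \<in> S" "g \<noteq> 0" using g G by auto
      have le: "g l \<le> m l" if "l \<in> \<Lambda>" for l
        using g(2) that h[OF gS(1) that] h[OF less.prems that] by (metis of_nat_le_iff)
      have mg: "m - g \<in> S"
        using less.prems gS(1) le by (auto simp: S_def diff_in_dual_lattice)
      have "\<exists>l\<in>\<Lambda>. g l \<noteq> 0"
      proof (rule ccontr)
        assume "\<not> (\<exists>l\<in>\<Lambda>. g l \<noteq> 0)"
        then have "g v = 0" for v
          using linear_eq_0_on_span[of g \<Lambda> v] gS(1) \<Lambda>(3) by (auto simp: S_def dual_lattice_def)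
        then show False using gS(2) by (auto simp: fun_eq_iff)
      qed
      then obtain l where l: "l \<in> \<Lambda>" "g l \<noteq> 0" by blast
      have hmg: "h m l = h (m - g) l + h g l" if "l \<in> \<Lambda>" for l
        using h[OF gS(1) that] h[OF less.prems that] h[OF mg that] by (simp flip: of_nat_add add: of_nat_eq_iff[where 'a = real, symmetric])
      have "h g l > 0" using h[OF gS(1) l(1)] l(2) by (metis of_nat_0 gr0I)
      then have "(\<Sum>l\<in>\<Lambda>. h (m - g) l) < (\<Sum>l\<in>\<Lambda>. h m l)"
        using l(1) \<Lambda>(1) hmg by (intro sum_strict_mono_ex1) (auto intro!: bexI[of _ l])
      then obtain c where c: "m - g = (\<Sum>g\<in>G. of_nat (c g) * g)" using less.hyps mg by blast
      have "(\<Sum>g'\<in>G. of_nat ((c(g := Suc (c g))) g') * g') = (\<Sum>g'\<in>G. of_nat (c g') * g') + g"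
      proof -
        have "(\<Sum>g'\<in>G - {g}. of_nat ((c(g := Suc (c g))) g') * g') = (\<Sum>g'\<in>G - {g}. of_nat (c g') * g')"
          by (intro sum.cong) auto
        then show ?thesis using g(1) G(2) by (simp add: sum.remove[of G g] algebra_simps)
      qed
      then show ?thesis using c by (intro exI[of _ "c(g := Suc (c g))"]) (simp add: algebra_simps)
    qed
  qed
  with G show ?thesis by (intro exI[of _ G]) auto
qed

text \<open>Generators of the cone need not span the space. So the dual monoid is cut into finitely
  many pieces by prescribing the signs on a lattice basis; each piece is given by inequalities on a
  spanning set.\<close>

lemma gordan:
  fixes N :: "'v::real_vector set"
  assumes N: "is_lattice N" and \<sigma>: "rational_polyhedral_cone N \<sigma>"
  shows "\<exists>G\<subseteq>cone_monoid N \<sigma>. finite G \<and> (\<forall>m\<in>cone_monoid N \<sigma>. \<exists>c. m = (\<Sum>g\<in>G. of_nat (c g) * g))"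
proof -
  obtain V where V: "finite V" "V \<subseteq> N" "\<sigma> = convex_cone hull V"
    using \<sigma> by (auto simp: rational_polyhedral_cone_def)
  obtain B where B: "finite B" "span B = UNIV" "B \<subseteq> N"
    "\<And>v. v \<in> N \<Longrightarrow> \<exists>c :: 'v :: real_vector \<Rightarrow> int. v = (\<Sum>b\<in>B. of_int (c b) *\<^sub>R b)"
    by (rule lattice_basis[OF N]) blast
  have uN: "- b \<in> N" if b: "b \<in> N" for b
  proof -
    obtain B' where B': "N = {\<Sum>b\<in>B'. of_int (c b) *\<^sub>R b | c :: 'v \<Rightarrow> int. True}"
      using N by (auto simp: is_lattice_def)
    then obtain c :: "'v \<Rightarrow> int" where "b = (\<Sum>b\<in>B'. of_int (c b) *\<^sub>R b)" using b by auto
    then have "- b = (\<Sum>b\<in>B'. of_int ((\<lambda>x. - c x) b) *\<^sub>R b)" by (simp add: sum_negf)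
    then show ?thesis unfolding B' by (intro CollectI exI[of _ "\<lambda>x. - c x"]) simp
  qed
  define \<Lambda> where "\<Lambda> Q = V \<union> Q \<union> uminus ` (B - Q)" for Q
  define S where "S Q = {m \<in> dual_lattice N. \<forall>l\<in>\<Lambda> Q. 0 \<le> m l}" for Q
  have ex: "\<exists>G\<subseteq>S Q. finite G \<and> (\<forall>m\<in>S Q. \<exists>c. m = (\<Sum>g\<in>G. of_nat (c g) * g))" if Q: "Q \<subseteq> B" for Q
    unfolding S_def
  proof (rule gordan_spanning)
    show "finite (\<Lambda> Q)" "\<Lambda> Q \<subseteq> N" using V B Q uN finite_subset[OF Q] by (auto simp: \<Lambda>_def)
    have "b \<in> span (\<Lambda> Q)" if "b \<in> B" for b
    proof (cases "b \<in> Q")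
      case False
      then have "- b \<in> span (\<Lambda> Q)" using that by (intro span_base) (auto simp: \<Lambda>_def)
      then show ?thesis by (metis span_neg minus_minus)
    qed (auto simp: \<Lambda>_def intro: span_base)
    then have "span B \<subseteq> span (\<Lambda> Q)" by (intro span_minimal) auto
    then show "span (\<Lambda> Q) = UNIV" using B(2) by auto
  qed
  define G where "G Q = (SOME G. G \<subseteq> S Q \<and> finite G \<and> (\<forall>m\<in>S Q. \<exists>c. m = (\<Sum>g\<in>G. of_nat (c g) * g)))" for Q
  have G0: "G Q \<subseteq> S Q \<and> finite (G Q) \<and> (\<forall>m\<in>S Q. \<exists>c. m = (\<Sum>g\<in>G Q. of_nat (c g) * g))" if "Q \<subseteq> B" for Q
    unfolding G_def by (rule someI_ex[OF ex[OF that]])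
  have G: "G Q \<subseteq> S Q" "finite (G Q)" "m \<in> S Q \<Longrightarrow> \<exists>c. m = (\<Sum>g\<in>G Q. of_nat (c g) * g)" if "Q \<subseteq> B" for Q m
    using G0[OF that] by auto
  define U where "U = (\<Union>Q\<in>Pow B. G Q)"
  have fU: "finite U" using G(2) B(1) by (auto simp: U_def)
  show ?thesis
  proof (intro exI[of _ U] conjI ballI fU)
    show "U \<subseteq> cone_monoid N \<sigma>"
    proof
      fix g assume "g \<in> U"
      then obtain Q where "Q \<subseteq> B" "g \<in> G Q" by (auto simp: U_def)
      then have "g \<in> S Q" using G(1) by blast
      then show "g \<in> cone_monoid N \<sigma>" unfolding V(3) cone_monoid_hull by (auto simp: S_def \<Lambda>_def)
    qed
    fix m assume m: "m \<in> cone_monoid N \<sigma>"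
    define Q where "Q = {b \<in> B. 0 \<le> m b}"
    have QB: "Q \<subseteq> B" by (auto simp: Q_def)
    have "linear m" using m by (auto dest: cone_monoid_dual dual_lattice_linear)
    then have "m \<in> S Q"
      using m unfolding V(3) cone_monoid_hull by (auto simp: S_def \<Lambda>_def Q_def linear_neg)
    then obtain c where c: "m = (\<Sum>g\<in>G Q. of_nat (c g) * g)" using G(3)[OF QB] by blast
    have "(\<Sum>g\<in>U. of_nat (if g \<in> G Q then c g else 0) * g) = (\<Sum>g\<in>G Q. of_nat (c g) * g)"
      using QB fU by (intro sum.mono_neutral_cong_right) (auto simp: U_def)
    then show "\<exists>c. m = (\<Sum>g\<in>U. of_nat (c g) * g)"
      unfolding c by (intro exI[of _ "\<lambda>g. if g \<in> G Q then c g else 0"]) simp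
  qed
qed

subsection \<open>Points of the charts\<close>

text \<open>Resolution may eta-expand sums of functions, which these rules would then unfold.\<close>

declare plus_fun_apply [simp del] times_fun_apply [simp del] zero_fun_apply [simp del] of_nat_fun_apply [simp del]

lemma monoid_algebra_generators [simp]:
  "scalar a \<in> monoid_algebra N \<sigma>" "m \<in> cone_monoid N \<sigma> \<Longrightarrow> character m \<in> monoid_algebra N \<sigma>"
  by (auto simp: scalar_def character_def monoid_algebra_def zero_in_cone_monoid split: if_splits)

interpretation monoid_algebra: complex_subalgebra scalar "monoid_algebra N \<sigma>" for N \<sigma>
  unfolding scalar_def[abs_def] monoid_algebra_def
  by (rule complex_subalgebra_monoid_algebra) (auto simp: zero_in_cone_monoid plus_in_cone_monoid)

lemma character_plus: "character (m + m') = character m * character m'"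
  by (simp add: character_def mult_single)

lemma character_zero: "character 0 = 1" and scalar_one: "scalar 1 = 1"
  by (simp_all add: character_def scalar_def)

lemma monoid_algebra_antimono: "\<tau> \<subseteq> \<sigma> \<Longrightarrow> monoid_algebra N \<sigma> \<subseteq> monoid_algebra N \<tau>"
  using cone_monoid_antimono[of \<tau> \<sigma> N] by (auto simp: monoid_algebra_def)

context
  fixes N :: "'v::real_vector set" and \<sigma> x
  assumes x: "x \<in> affine_points N \<sigma>"
begin

lemma affine_point_add: "f \<in> monoid_algebra N \<sigma> \<Longrightarrow> g \<in> monoid_algebra N \<sigma> \<Longrightarrow> x (f + g) = x f + x g"
  and affine_point_mult: "f \<in> monoid_algebra N \<sigma> \<Longrightarrow> g \<in> monoid_algebra N \<sigma> \<Longrightarrow> x (f * g) = x f * x g"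
  and affine_point_scalar: "x (scalar a) = a"
  using x by (auto simp: affine_points_def)

lemma affine_point_character_zero: "x (character 0) = 1"
  using affine_point_scalar[of 1] by (simp add: character_zero scalar_one)

lemma affine_point_character_plus:
  "m \<in> cone_monoid N \<sigma> \<Longrightarrow> m' \<in> cone_monoid N \<sigma> \<Longrightarrow> x (character (m + m')) = x (character m) * x (character m')"
  by (simp add: character_plus affine_point_mult)

lemma affine_point_character_of_nat_times:
  "m \<in> cone_monoid N \<sigma> \<Longrightarrow> x (character (of_nat k * m)) = x (character m) ^ k"
  by (induction k) (auto simp: affine_point_character_zero distrib_right
      affine_point_character_plus of_nat_times_in_cone_monoid)

lemma affine_point_sum:
  "(\<And>i. i \<in> I \<Longrightarrow> h i \<in> monoid_algebra N \<sigma>) \<Longrightarrow> x (sum h I) = (\<Sum>i\<in>I. x (h i))"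
proof (induction I rule: infinite_finite_induct)
  case (insert i I)
  then show ?case by (simp add: affine_point_add monoid_algebra.sum_mem)
qed (use affine_point_scalar[of 0] in \<open>simp_all add: scalar_def\<close>)

lemma affine_point_eval:
  assumes f: "f \<in> monoid_algebra N \<sigma>"
  shows "x f = cplx.eval (\<lambda>m. x (character m)) f"
proof -
  have k: "k \<in> cone_monoid N \<sigma>" if "k \<in> keys f" for k using that f by (auto simp: monoid_algebra_def)
  have "x f = x (\<Sum>k\<in>keys f. scalar (lookup f k) * character k)"
    by (simp add: scalar_def character_def mult_single flip: poly_mapping_eq_sum_single)
  also have "\<dots> = (\<Sum>k\<in>keys f. x (scalar (lookup f k) * character k))"
    by (intro affine_point_sum monoid_algebra.mult_mem) (auto simp: k)
  finally show ?thesis by (simp add: cplx.eval_def affine_point_mult affine_point_scalar k)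
qed

end

lemma affine_point_eqI:
  assumes "x \<in> affine_points N \<sigma>" "y \<in> affine_points N \<sigma>"
    and "\<And>m. m \<in> cone_monoid N \<sigma> \<Longrightarrow> x (character m) = y (character m)"
  shows "x = y"
proof (rule extensionalityI)
  show "x \<in> extensional (monoid_algebra N \<sigma>)" "y \<in> extensional (monoid_algebra N \<sigma>)"
    using assms by (auto simp: affine_points_def)
  fix f assume f: "f \<in> monoid_algebra N \<sigma>"
  then show "x f = y f"
    using assms(3) unfolding affine_point_eval[OF assms(1) f] affine_point_eval[OF assms(2) f] cplx.eval_def
    by (intro sum.cong) (auto simp: monoid_algebra_def)
qed

text \<open>The universal property of the monoid algebra: points are the same as monoid
  homomorphisms to the complex numbers.\<close>

lemma affine_point_of_characters:
  assumes "\<psi> 0 = 1" "\<And>m m'. m \<in> cone_monoid N \<sigma> \<Longrightarrow> m' \<in> cone_monoid N \<sigma> \<Longrightarrow> \<psi> (m + m') = \<psi> m * \<psi> m'"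
  defines "x \<equiv> restrict (cplx.eval \<psi>) (monoid_algebra N \<sigma>)"
  shows "x \<in> affine_points N \<sigma>" "m \<in> cone_monoid N \<sigma> \<Longrightarrow> x (character m) = \<psi> m"
proof -
  have sc: "cplx.eval \<psi> (scalar a) = a" for a by (simp add: scalar_def cplx.eval_single assms)
  show "x \<in> affine_points N \<sigma>"
    unfolding affine_points_def
  proof (intro CollectI conjI ballI allI)
    show "x \<in> extensional (monoid_algebra N \<sigma>)" by (simp add: x_def)
    show "x (scalar a) = a" for a by (simp add: x_def sc)
    fix f g assume fg: "f \<in> monoid_algebra N \<sigma>" "g \<in> monoid_algebra N \<sigma>"
    then show "x (f + g) = x f + x g"
      by (simp add: x_def monoid_algebra.add_mem cplx.eval_add)
    have "cplx.eval \<psi> (f * g) = cplx.eval \<psi> f * cplx.eval \<psi> g"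
      by (rule cplx.eval_mult[where E = "cone_monoid N \<sigma>"]) (use fg assms in \<open>auto simp: monoid_algebra_def\<close>)
    then show "x (f * g) = x f * x g"
      using fg by (simp add: x_def monoid_algebra.mult_mem)
  qed
  show "x (character m) = \<psi> m" if "m \<in> cone_monoid N \<sigma>"
    using that by (simp add: x_def) (simp add: character_def cplx.eval_single)
qed

lemma affine_point_restrict:
  assumes "\<tau> \<subseteq> \<sigma>" "x \<in> affine_points N \<tau>"
  shows "restrict x (monoid_algebra N \<sigma>) \<in> affine_points N \<sigma>"
  using monoid_algebra_antimono[OF assms(1), of N] assms(2)
  by (auto simp: affine_points_def monoid_algebra.add_mem monoid_algebra.mult_mem subset_iff)

lemma trop_chart_zero: "v \<in> trop_chart N \<sigma> \<Longrightarrow> v 0 = 0"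
  and trop_chart_plus: "v \<in> trop_chart N \<sigma> \<Longrightarrow> m \<in> cone_monoid N \<sigma> \<Longrightarrow> m' \<in> cone_monoid N \<sigma> \<Longrightarrow> v (m + m') = v m + v m'"
  and trop_chart_gt: "v \<in> trop_chart N \<sigma> \<Longrightarrow> m \<in> cone_monoid N \<sigma> \<Longrightarrow> v m > -\<infinity>"
  and trop_chart_extensional: "v \<in> trop_chart N \<sigma> \<Longrightarrow> v \<in> extensional (cone_monoid N \<sigma>)"
  by (auto simp: trop_chart_def PiE_def)

lemma trop_chart_of_nat_times:
  assumes "v \<in> trop_chart N \<sigma>" "m \<in> cone_monoid N \<sigma>" "v m = ereal r"
  shows "v (of_nat k * m) = ereal (of_nat k * r)"
  by (induction k)
    (auto simp: trop_chart_zero[OF assms(1)] distrib_right trop_chart_plus[OF assms(1)] of_nat_times_in_cone_monoid assms)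

lemma trop_chart_restrict:
  assumes "\<tau> \<subseteq> \<sigma>" "v \<in> trop_chart N \<tau>"
  shows "restrict v (cone_monoid N \<sigma>) \<in> trop_chart N \<sigma>"
  using cone_monoid_antimono[OF assms(1), of N] assms(2)
  by (auto simp: trop_chart_def zero_in_cone_monoid plus_in_cone_monoid subset_iff)

subsection \<open>Chart topologies\<close>

lemma tendsto_trop_chart_coordinate:
  assumes "x \<in> trop_chart N \<sigma>" "m \<in> cone_monoid N \<sigma>"
  shows "((\<lambda>v. v m) \<longlongrightarrow> x m) (atin (trop_chart_topology N \<sigma>) x)"
proof -
  have "continuous_map (trop_chart_topology N \<sigma>) (top_of_set {-\<infinity><..}) (\<lambda>v. v m)"
    unfolding trop_chart_topology_def
    using assms(2) by (intro continuous_map_from_subtopology continuous_map_product_projection)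
  then have "continuous_map (trop_chart_topology N \<sigma>) euclidean (\<lambda>v. v m)"
    by (simp add: continuous_map_in_subtopology)
  then show ?thesis using assms(1) by (simp add: continuous_map_atin topspace_trop_chart_topology)
qed

lemma continuous_map_into_trop_chart:
  assumes "f \<in> topspace T \<rightarrow> trop_chart N \<sigma>"
    and "\<And>x m. x \<in> topspace T \<Longrightarrow> m \<in> cone_monoid N \<sigma> \<Longrightarrow> ((\<lambda>v. f v m) \<longlongrightarrow> f x m) (atin T x)"
  shows "continuous_map T (trop_chart_topology N \<sigma>) f"
  unfolding trop_chart_topology_def continuous_map_in_subtopology continuous_map_componentwise
proof (intro conjI ballI)
  show "f ` topspace T \<subseteq> extensional (cone_monoid N \<sigma>)"
    using assms(1) trop_chart_extensional by fast
  show "f \<in> topspace T \<rightarrow> trop_chart N \<sigma>" by (rule assms(1))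
  fix m assume m: "m \<in> cone_monoid N \<sigma>"
  show "continuous_map T euclidean (\<lambda>x. f x m)"
    using assms(2)[OF _ m] by (simp add: continuous_map_atin)
  show "(\<lambda>x. f x m) \<in> topspace T \<rightarrow> {-\<infinity><..}"
    using assms(1) m trop_chart_gt by fastforce
qed

subsection \<open>The chart of a face\<close>

text \<open>The algebraic content of being a face: the monoid of \<open>\<tau>\<close> is the
  localisation of that of \<open>\<sigma>\<close> at \<open>u\<close>.\<close>

definition face_by :: "'v::real_vector set \<Rightarrow> 'v set \<Rightarrow> 'v set \<Rightarrow> ('v \<Rightarrow> real) \<Rightarrow> bool" where
  "face_by N \<tau> \<sigma> u \<longleftrightarrow> \<tau> \<subseteq> \<sigma> \<and> u \<in> cone_monoid N \<sigma> \<and> - u \<in> cone_monoid N \<tau> \<and>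
     (\<forall>m\<in>cone_monoid N \<tau>. \<exists>k. m + of_nat k * u \<in> cone_monoid N \<sigma>)"

lemma face_byI:
  assumes "rational_polyhedral_cone N \<sigma>" "u \<in> cone_monoid N \<sigma>"
  shows "face_by N {v \<in> \<sigma>. u v = 0} \<sigma> u"
  using face_monoid_shift[OF assms] assms(2)
  by (auto simp: face_by_def cone_monoid_def uminus_in_dual_lattice)

context
  fixes N :: "'v::real_vector set" and \<tau> \<sigma> u
  assumes face: "face_by N \<tau> \<sigma> u"
begin

lemma face_subset: "\<tau> \<subseteq> \<sigma>"
  and face_monoid: "u \<in> cone_monoid N \<sigma>" "u \<in> cone_monoid N \<tau>" "- u \<in> cone_monoid N \<tau>"
  and face_monoid_subset: "m \<in> cone_monoid N \<sigma> \<Longrightarrow> m \<in> cone_monoid N \<tau>"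
  using face cone_monoid_antimono[of \<tau> \<sigma> N] by (auto simp: face_by_def)

text \<open>Some power of the denominator \<open>u\<close> that makes \<open>m\<close> regular on
  \<open>\<sigma>\<close>; that the choice does not matter is shown in
  \<open>trop_extend_eq\<close>.\<close>

definition shift :: "('v \<Rightarrow> real) \<Rightarrow> nat" where
  "shift m = (SOME k. m + of_nat k * u \<in> cone_monoid N \<sigma>)"

lemma shift: "m \<in> cone_monoid N \<tau> \<Longrightarrow> m + of_nat (shift m) * u \<in> cone_monoid N \<sigma>"
  unfolding shift_def using face by (intro someI_ex[where P = "\<lambda>k. m + of_nat k * u \<in> cone_monoid N \<sigma>"]) (auto simp: face_by_def)

lemma trop_chart_face_finite:
  assumes "y \<in> trop_chart N \<tau>"
  obtains r where "y u = ereal r"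
proof -
  have "y u + y (- u) = 0"
    using trop_chart_plus[OF assms face_monoid(2,3)] trop_chart_zero[OF assms] by simp
  then show ?thesis using that trop_chart_gt[OF assms face_monoid(2)] trop_chart_gt[OF assms face_monoid(3)]
    by (cases "y u") auto
qed

text \<open>Injectivity of the gluing map: since \<open>y u\<close> is finite, \<open>y m\<close> is
  determined by \<open>y (m + of_nat k * u)\<close> and \<open>y u\<close>, both of which are values
  on the monoid of \<open>\<sigma>\<close>.\<close>

lemma trop_chart_face_unique:
  assumes y: "y \<in> trop_chart N \<tau>" and y': "y' \<in> trop_chart N \<tau>"
    and eq: "restrict y (cone_monoid N \<sigma>) = restrict y' (cone_monoid N \<sigma>)"
  shows "y = y'"
proof (rule extensionalityI[OF trop_chart_extensional[OF y] trop_chart_extensional[OF y']])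
  have eq': "y m = y' m" if "m \<in> cone_monoid N \<sigma>" for m
    using fun_cong[OF eq, of m] that by simp
  fix m assume m: "m \<in> cone_monoid N \<tau>"
  obtain r where r: "y u = ereal r" by (rule trop_chart_face_finite[OF y])
  have r': "y' u = ereal r" using eq'[OF face_monoid(1)] r by simp
  define k where "k = shift m"
  have "y m + ereal (k * r) = y (m + of_nat k * u)"
    using trop_chart_plus[OF y m of_nat_times_in_cone_monoid[OF face_monoid(2)], of k]
      trop_chart_of_nat_times[OF y face_monoid(2) r] by simp
  also have "\<dots> = y' (m + of_nat k * u)" using shift[OF m] by (intro eq') (simp add: k_def)
  also have "\<dots> = y' m + ereal (k * r)"
    using trop_chart_plus[OF y' m of_nat_times_in_cone_monoid[OF face_monoid(2)], of k]
      trop_chart_of_nat_times[OF y' face_monoid(2) r'] by simp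
  finally show "y m = y' m" by (cases "y m"; cases "y' m") auto
qed

text \<open>The inverse of the gluing map on the locus where the value at \<open>u\<close> is
  finite. Only a multiple of that finite value is ever subtracted, so no difference of infinities
  arises.\<close>

definition trop_extend :: "(('v \<Rightarrow> real) \<Rightarrow> ereal) \<Rightarrow> ('v \<Rightarrow> real) \<Rightarrow> ereal" where
  "trop_extend x = (\<lambda>m\<in>cone_monoid N \<tau>. x (m + of_nat (shift m) * u) + ereal (- (real (shift m) * real_of_ereal (x u))))"

lemma trop_extend_eq:
  assumes x: "x \<in> trop_chart N \<sigma>" and r: "x u = ereal r"
    and m: "m \<in> cone_monoid N \<tau>" and k: "m + of_nat k * u \<in> cone_monoid N \<sigma>"
  shows "trop_extend x m = x (m + of_nat k * u) + ereal (- (real k * r))"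
proof -
  let ?j = "shift m"
  note ku = of_nat_times_in_cone_monoid[OF face_monoid(1)]
  have "x ((m + of_nat ?j * u) + of_nat k * u) = x ((m + of_nat k * u) + of_nat ?j * u)"
    by (simp add: add_ac)
  then have "x (m + of_nat ?j * u) + ereal (k * r) = x (m + of_nat k * u) + ereal (?j * r)"
    using trop_chart_plus[OF x shift[OF m] ku] trop_chart_plus[OF x k ku]
      trop_chart_of_nat_times[OF x face_monoid(1) r] by simp
  then show ?thesis
    using m r by (cases "x (m + of_nat ?j * u)"; cases "x (m + of_nat k * u)") (auto simp: trop_extend_def)
qed

lemma trop_extend:
  assumes x: "x \<in> trop_chart N \<sigma>" and fin: "x u \<noteq> \<infinity>"
  shows "trop_extend x \<in> trop_chart N \<tau>" "restrict (trop_extend x) (cone_monoid N \<sigma>) = x"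
proof -
  obtain r where r: "x u = ereal r" using fin trop_chart_gt[OF x face_monoid(1)] by (cases "x u") auto
  note eq = trop_extend_eq[OF x r]
  have res: "trop_extend x m = x m" if "m \<in> cone_monoid N \<sigma>" for m
    using eq[of m 0] that face_monoid_subset by simp
  then show "restrict (trop_extend x) (cone_monoid N \<sigma>) = x"
    using trop_chart_extensional[OF x] by (intro extensionalityI[of _ "cone_monoid N \<sigma>"]) auto
  show "trop_extend x \<in> trop_chart N \<tau>"
    unfolding trop_chart_def
  proof (intro CollectI conjI ballI PiE_I)
    show "trop_extend x 0 = 0" using res[OF zero_in_cone_monoid] trop_chart_zero[OF x] by simp
    show "trop_extend x m = undefined" if "m \<notin> cone_monoid N \<tau>" for m
      using that by (simp add: trop_extend_def)
    fix m assume m: "m \<in> cone_monoid N \<tau>"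
    show "trop_extend x m \<in> {-\<infinity><..}"
      using trop_chart_gt[OF x shift[OF m]] by (simp add: eq[OF m shift[OF m]])
    fix m' assume m': "m' \<in> cone_monoid N \<tau>"
    have s: "(m + m') + of_nat (shift m + shift m') * u = (m + of_nat (shift m) * u) + (m' + of_nat (shift m') * u)"
      by (simp add: algebra_simps)
    have "trop_extend x (m + m') = x (m + m' + of_nat (shift m + shift m') * u) + ereal (- (real (shift m + shift m') * r))"
      by (rule eq[OF plus_in_cone_monoid[OF m m']]) (unfold s, intro plus_in_cone_monoid shift m m')
    also have "\<dots> = (x (m + of_nat (shift m) * u) + x (m' + of_nat (shift m') * u)) + ereal (- (real (shift m + shift m') * r))"
      unfolding s by (simp add: trop_chart_plus[OF x shift[OF m] shift[OF m']])
    also have "\<dots> = trop_extend x m + trop_extend x m'"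
      unfolding eq[OF m shift[OF m]] eq[OF m' shift[OF m']]
      by (cases "x (m + of_nat (shift m) * u)"; cases "x (m' + of_nat (shift m') * u)") (auto simp: algebra_simps)
    finally show "trop_extend x (m + m') = trop_extend x m + trop_extend x m'" .
  qed
qed

text \<open>The counterpart of \<open>trop_extend\<close> for complex points: negative powers of the
  character \<open>u\<close> are defined where it does not vanish.\<close>

lemma affine_point_extend:
  assumes x: "x \<in> affine_points N \<sigma>" and nz: "x (character u) \<noteq> 0"
  obtains y where "y \<in> affine_points N \<tau>" "restrict y (monoid_algebra N \<sigma>) = x"
proof -
  define \<psi> where "\<psi> m = x (character (m + of_nat (shift m) * u)) / x (character u) ^ shift m" for m
  note ku = of_nat_times_in_cone_monoid[OF face_monoid(1)]
  have eq: "\<psi> m = x (character (m + of_nat k * u)) / x (character u) ^ k"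
    if m: "m \<in> cone_monoid N \<tau>" and k: "m + of_nat k * u \<in> cone_monoid N \<sigma>" for m k
  proof -
    let ?j = "shift m"
    have "x (character ((m + of_nat ?j * u) + of_nat k * u)) = x (character ((m + of_nat k * u) + of_nat ?j * u))"
      by (simp add: add_ac)
    then have "x (character (m + of_nat ?j * u)) * x (character u) ^ k = x (character (m + of_nat k * u)) * x (character u) ^ ?j"
      using affine_point_character_plus[OF x shift[OF m] ku] affine_point_character_plus[OF x k ku]
        affine_point_character_of_nat_times[OF x face_monoid(1)] by simp
    then show ?thesis using nz by (simp add: \<psi>_def field_simps)
  qed
  have res: "\<psi> m = x (character m)" if "m \<in> cone_monoid N \<sigma>" for m
    using eq[of m 0] that face_monoid_subset by simp
  have one: "\<psi> 0 = 1" using res[OF zero_in_cone_monoid] affine_point_character_zero[OF x] by simp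
  have plus: "\<psi> (m + m') = \<psi> m * \<psi> m'" if m: "m \<in> cone_monoid N \<tau>" and m': "m' \<in> cone_monoid N \<tau>" for m m'
  proof -
    have s: "(m + m') + of_nat (shift m + shift m') * u = (m + of_nat (shift m) * u) + (m' + of_nat (shift m') * u)"
      by (simp add: algebra_simps)
    have "\<psi> (m + m') = x (character (m + m' + of_nat (shift m + shift m') * u)) / x (character u) ^ (shift m + shift m')"
      by (rule eq[OF plus_in_cone_monoid[OF m m']]) (unfold s, intro plus_in_cone_monoid shift m m')
    also have "\<dots> = \<psi> m * \<psi> m'"
      unfolding s by (simp add: affine_point_character_plus[OF x shift[OF m] shift[OF m']] \<psi>_def power_add)
    finally show ?thesis .
  qed
  define y where "y = restrict (cplx.eval \<psi>) (monoid_algebra N \<tau>)"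
  have yp: "y \<in> affine_points N \<tau>"
    unfolding y_def by (rule affine_point_of_characters(1)) (auto simp: one plus)
  have yc: "y (character m) = \<psi> m" if "m \<in> cone_monoid N \<tau>" for m
    unfolding y_def by (rule affine_point_of_characters(2)) (auto simp: one plus that)
  show ?thesis
  proof (rule that[OF yp])
    show "restrict y (monoid_algebra N \<sigma>) = x"
    proof (rule affine_point_eqI[OF affine_point_restrict[OF face_subset yp] x])
      fix m assume m: "m \<in> cone_monoid N \<sigma>"
      then have "y (character m) = \<psi> m" using face_monoid_subset by (intro yc)
      with m show "restrict y (monoid_algebra N \<sigma>) (character m) = x (character m)" by (simp add: res)
    qed
  qed
qed

lemma continuous_map_trop_extend:
  "continuous_map (subtopology (trop_chart_topology N \<sigma>) {v. v u \<noteq> \<infinity>}) (trop_chart_topology N \<tau>) trop_extend"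
proof (rule continuous_map_into_trop_chart)
  let ?T = "subtopology (trop_chart_topology N \<sigma>) {v. v u \<noteq> \<infinity>}"
  show "trop_extend \<in> topspace ?T \<rightarrow> trop_chart N \<tau>"
    using trop_extend(1) by (auto simp: topspace_trop_chart_topology)
  fix x m assume "x \<in> topspace ?T" and m: "m \<in> cone_monoid N \<tau>"
  then have x: "x \<in> trop_chart N \<sigma>" "x u \<noteq> \<infinity>" by (auto simp: topspace_trop_chart_topology)
  have lim: "((\<lambda>v. v m) \<longlongrightarrow> x m) (atin ?T x)" if "m \<in> cone_monoid N \<sigma>" for m
    using tendsto_trop_chart_coordinate[OF x(1) that] x(2)
    by (simp add: atin_subtopology_within) (auto simp: tendsto_def atin_within_def eventually_inf_principal elim: eventually_mono)
  obtain r where r: "x u = ereal r" using x(2) trop_chart_gt[OF x(1) face_monoid(1)] by (cases "x u") auto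
  have "((\<lambda>v. real_of_ereal (v u)) \<longlongrightarrow> r) (atin ?T x)"
    using lim[OF face_monoid(1)] unfolding r by (rule lim_real_of_ereal)
  then have "((\<lambda>v. real_of_ereal (v u)) \<longlongrightarrow> real_of_ereal (x u)) (atin ?T x)" by (simp add: r)
  then have "((\<lambda>v. ereal (- (real (shift m) * real_of_ereal (v u)))) \<longlongrightarrow> ereal (- (real (shift m) * real_of_ereal (x u)))) (atin ?T x)"
    by (intro tendsto_ereal tendsto_minus tendsto_mult tendsto_const)
  from tendsto_add_ereal_general1[OF _ lim[OF shift[OF m]] this]
  have "((\<lambda>v. v (m + of_nat (shift m) * u) + ereal (- (real (shift m) * real_of_ereal (v u)))) \<longlongrightarrow>
      x (m + of_nat (shift m) * u) + ereal (- (real (shift m) * real_of_ereal (x u)))) (atin ?T x)"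
    by simp
  then show "((\<lambda>v. trop_extend v m) \<longlongrightarrow> trop_extend x m) (atin ?T x)"
    using m by (simp add: trop_extend_def)
qed

text \<open>The image is the preimage of \<open>V\<close> under the continuous inverse
  \<open>trop_extend\<close>, taken inside the open set where the value at \<open>u\<close> is
  finite.\<close>

lemma openin_trop_chart_face_image:
  assumes V: "openin (trop_chart_topology N \<tau>) V"
  shows "openin (trop_chart_topology N \<sigma>) ((\<lambda>y. restrict y (cone_monoid N \<sigma>)) ` V)"
proof -
  let ?T = "trop_chart_topology N \<sigma>"
  have V\<tau>: "V \<subseteq> trop_chart N \<tau>" using openin_subset[OF V] by (simp add: topspace_trop_chart_topology)
  have fin: "openin ?T {v \<in> topspace ?T. v u \<in> {x. x \<noteq> \<infinity>}}"
  proof (rule openin_continuous_map_preimage)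
    show "continuous_map ?T euclidean (\<lambda>v. v u)"
      using tendsto_trop_chart_coordinate face_monoid(1)
      by (auto simp: continuous_map_atin topspace_trop_chart_topology)
    have "{x :: ereal. x \<noteq> \<infinity>} = - {\<infinity>}" by auto
    then show "openin euclidean {x :: ereal. x \<noteq> \<infinity>}" by (simp add: open_openin[symmetric] open_Compl)
  qed
  then have fin': "openin ?T (topspace ?T \<inter> {v. v u \<noteq> \<infinity>})" by (simp add: Int_def)
  have "openin (subtopology ?T (topspace ?T \<inter> {v. v u \<noteq> \<infinity>})) {v \<in> topspace (subtopology ?T {v. v u \<noteq> \<infinity>}). trop_extend v \<in> V}"
    unfolding subtopology_restrict by (rule openin_continuous_map_preimage[OF continuous_map_trop_extend V])
  then have "openin ?T {v \<in> topspace (subtopology ?T {v. v u \<noteq> \<infinity>}). trop_extend v \<in> V}"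
    using fin' by (rule openin_trans_full)
  also have "{v \<in> topspace (subtopology ?T {v. v u \<noteq> \<infinity>}). trop_extend v \<in> V} = (\<lambda>y. restrict y (cone_monoid N \<sigma>)) ` V"
  proof (intro equalityI subsetI)
    fix v assume "v \<in> {v \<in> topspace (subtopology ?T {v. v u \<noteq> \<infinity>}). trop_extend v \<in> V}"
    then have "v \<in> trop_chart N \<sigma>" "v u \<noteq> \<infinity>" "trop_extend v \<in> V" by (auto simp: topspace_trop_chart_topology)
    then show "v \<in> (\<lambda>y. restrict y (cone_monoid N \<sigma>)) ` V" using trop_extend(2)[of v]
      by (intro image_eqI[of _ _ "trop_extend v"]) simp_all
  next
    fix v assume "v \<in> (\<lambda>y. restrict y (cone_monoid N \<sigma>)) ` V"
    then obtain y where y: "y \<in> V" "v = restrict y (cone_monoid N \<sigma>)" by blast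
    have y\<tau>: "y \<in> trop_chart N \<tau>" using y(1) V\<tau> by blast
    then have v: "v \<in> trop_chart N \<sigma>" unfolding y(2) by (rule trop_chart_restrict[OF face_subset])
    obtain r where "y u = ereal r" by (rule trop_chart_face_finite[OF y\<tau>])
    then have fin: "v u \<noteq> \<infinity>" using face_monoid(1) by (simp add: y(2))
    have "trop_extend v = y"
      by (rule trop_chart_face_unique[OF trop_extend(1)[OF v fin] y\<tau>]) (simp only: trop_extend(2)[OF v fin] y(2)[symmetric])
    then show "v \<in> {v \<in> topspace (subtopology ?T {v. v u \<noteq> \<infinity>}). trop_extend v \<in> V}"
      using v fin y(1) by (simp add: topspace_trop_chart_topology)
  qed
  finally show ?thesis .
qed

end

lemma continuous_map_trop_chart_restrict:
  assumes "\<tau> \<subseteq> \<sigma>"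
  shows "continuous_map (trop_chart_topology N \<tau>) (trop_chart_topology N \<sigma>) (\<lambda>y. restrict y (cone_monoid N \<sigma>))"
  using trop_chart_restrict[OF assms] cone_monoid_antimono[OF assms, of N]
  by (intro continuous_map_into_trop_chart)
    (auto simp: topspace_trop_chart_topology subset_iff intro!: tendsto_trop_chart_coordinate)

subsection \<open>The glued spaces\<close>

lemma glue_class_eq_iff:
  "glue_class \<Sigma> D U \<sigma> x = glue_class \<Sigma> D U \<sigma>' x' \<longleftrightarrow> equivclp (glue_step \<Sigma> D U) (\<sigma>, x) (\<sigma>', x')"
  unfolding glue_class_def by (auto intro: equivclp_trans equivclp_sym)

lemma glue_class_restrict:
  assumes "\<tau> \<in> \<Sigma>" "\<sigma> \<in> \<Sigma>" "cone_face \<tau> \<sigma>" "y \<in> U \<tau>"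
  shows "glue_class \<Sigma> D U \<sigma> (restrict y (D \<sigma>)) = glue_class \<Sigma> D U \<tau> y"
  unfolding glue_class_eq_iff using assms
  by (intro equivclp_sym[OF r_into_equivclp]) (simp add: glue_step_def)

locale toric_fan =
  fixes N :: "'v::real_vector set" and \<Sigma> :: "'v set set"
  assumes lattice: "is_lattice N" and fan: "fan N \<Sigma>"
begin

lemma cone_polyhedral: "\<sigma> \<in> \<Sigma> \<Longrightarrow> rational_polyhedral_cone N \<sigma>"
  and face_Int: "\<sigma> \<in> \<Sigma> \<Longrightarrow> \<sigma>' \<in> \<Sigma> \<Longrightarrow> cone_face (\<sigma> \<inter> \<sigma>') \<sigma>"
  and face_Int': "\<sigma> \<in> \<Sigma> \<Longrightarrow> \<sigma>' \<in> \<Sigma> \<Longrightarrow> cone_face (\<sigma> \<inter> \<sigma>') \<sigma>'"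
  using fan unfolding fan_def by blast+

lemma Int_in_fan: "\<sigma> \<in> \<Sigma> \<Longrightarrow> \<sigma>' \<in> \<Sigma> \<Longrightarrow> \<sigma> \<inter> \<sigma>' \<in> \<Sigma>"
  using fan face_Int unfolding fan_def by blast

lemma ex_face_by:
  assumes "\<sigma> \<in> \<Sigma>" "cone_face \<tau> \<sigma>"
  obtains u where "u \<in> cone_monoid N \<sigma>" "\<tau> = {v \<in> \<sigma>. u v = 0}" "face_by N \<tau> \<sigma> u"
  using cone_face_integral[OF lattice cone_polyhedral[OF assms(1)] assms(2)]
    face_byI[OF cone_polyhedral[OF assms(1)]] that by metis

text \<open>Separatedness: charts are glued along the chart of the common face only.\<close>

lemma trop_class_eqD:
  assumes eq: "trop_class N \<Sigma> \<sigma> v = trop_class N \<Sigma> \<sigma>' v'" and \<sigma>: "\<sigma> \<in> \<Sigma>" and v: "v \<in> trop_chart N \<sigma>"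
  shows "\<sigma>' \<in> \<Sigma> \<and> v' \<in> trop_chart N \<sigma>' \<and> (\<exists>y\<in>trop_chart N (\<sigma> \<inter> \<sigma>').
    restrict y (cone_monoid N \<sigma>) = v \<and> restrict y (cone_monoid N \<sigma>') = v')"
proof -
  have "equivclp (glue_step \<Sigma> (cone_monoid N) (trop_chart N)) (\<sigma>, v) (\<sigma>', v')"
    using eq by (simp add: trop_class_def glue_class_eq_iff)
  then show ?thesis
  proof (induction "(\<sigma>', v')" arbitrary: \<sigma>' v' rule: equivclp_induct)
    case base
    have "restrict v (cone_monoid N \<sigma>) = v"
      using trop_chart_extensional[OF v] by (simp add: extensional_restrict)
    then show ?case using \<sigma> v by auto
  next
    case (step p \<sigma>2 v2)
    obtain \<sigma>1 v1 where p: "p = (\<sigma>1, v1)" by fastforce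
    obtain y where 1: "\<sigma>1 \<in> \<Sigma>" "v1 \<in> trop_chart N \<sigma>1" and y: "y \<in> trop_chart N (\<sigma> \<inter> \<sigma>1)"
      "restrict y (cone_monoid N \<sigma>) = v" "restrict y (cone_monoid N \<sigma>1) = v1"
      using step.hyps(3)[OF p] by blast
    from step.hyps(2) show ?case
    proof
      assume "glue_step \<Sigma> (cone_monoid N) (trop_chart N) p (\<sigma>2, v2)"
      then have s: "\<sigma>2 \<in> \<Sigma>" "cone_face \<sigma>1 \<sigma>2" "v2 = restrict v1 (cone_monoid N \<sigma>2)"
        by (auto simp: glue_step_def p)
      have sub: "\<sigma>1 \<subseteq> \<sigma>2" using s(2) by (auto simp: cone_face_def)
      let ?y = "restrict y (cone_monoid N (\<sigma> \<inter> \<sigma>2))"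
      have "?y \<in> trop_chart N (\<sigma> \<inter> \<sigma>2)" using sub by (intro trop_chart_restrict[OF _ y(1)]) auto
      moreover have "cone_monoid N \<sigma> \<subseteq> cone_monoid N (\<sigma> \<inter> \<sigma>2)" "cone_monoid N \<sigma>2 \<subseteq> cone_monoid N (\<sigma> \<inter> \<sigma>2)"
        "cone_monoid N \<sigma>2 \<subseteq> cone_monoid N \<sigma>1"
        using sub by (auto intro!: cone_monoid_antimono)
      then have "restrict ?y (cone_monoid N \<sigma>) = v" "restrict ?y (cone_monoid N \<sigma>2) = v2"
        unfolding s(3) y(2)[symmetric] y(3)[symmetric] by (auto simp: restrict_restrict Int_absorb1 Int_absorb2)
      moreover have "v2 \<in> trop_chart N \<sigma>2" unfolding s(3) by (rule trop_chart_restrict[OF sub 1(2)])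
      ultimately show ?thesis using s(1) by blast
    next
      assume "glue_step \<Sigma> (cone_monoid N) (trop_chart N) (\<sigma>2, v2) p"
      then have s: "\<sigma>2 \<in> \<Sigma>" "cone_face \<sigma>2 \<sigma>1" "v2 \<in> trop_chart N \<sigma>2" "v1 = restrict v2 (cone_monoid N \<sigma>1)"
        by (auto simp: glue_step_def p)
      obtain u where u: "u \<in> cone_monoid N \<sigma>1" "\<sigma>2 = {v \<in> \<sigma>1. u v = 0}" "face_by N \<sigma>2 \<sigma>1 u"
        by (rule ex_face_by[OF 1(1) s(2)])
      have sub: "\<sigma>2 \<subseteq> \<sigma>1" using s(2) by (auto simp: cone_face_def)
      have u': "u \<in> cone_monoid N (\<sigma> \<inter> \<sigma>1)" using u(1) cone_monoid_antimono[of "\<sigma> \<inter> \<sigma>1" \<sigma>1 N] by auto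
      \<comment> \<open>The functional cutting \<open>\<sigma>2\<close> out of
        \<open>\<sigma>1\<close> also cuts \<open>\<sigma> \<inter> \<sigma>2\<close> out of
        \<open>\<sigma> \<inter> \<sigma>1\<close>. As \<open>v2\<close> lives on the smaller chart,
        the value at \<open>u\<close> is finite and \<open>y\<close> extends.\<close>
      have "face_by N {v \<in> \<sigma> \<inter> \<sigma>1. u v = 0} (\<sigma> \<inter> \<sigma>1) u"
        by (rule face_byI[OF cone_polyhedral[OF Int_in_fan[OF \<sigma> 1(1)]] u'])
      also have "{v \<in> \<sigma> \<inter> \<sigma>1. u v = 0} = \<sigma> \<inter> \<sigma>2" using u(2) by auto
      finally have face: "face_by N (\<sigma> \<inter> \<sigma>2) (\<sigma> \<inter> \<sigma>1) u" .
      obtain r where "v2 u = ereal r" by (rule trop_chart_face_finite[OF u(3) s(3)])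
      moreover have "y u = v1 u" using y(3) u(1) by auto
      moreover have "v1 u = v2 u" using s(4) u(1) by simp
      ultimately have fin: "y u \<noteq> \<infinity>" by simp
      define z where "z = trop_extend N (\<sigma> \<inter> \<sigma>2) (\<sigma> \<inter> \<sigma>1) u y"
      have z: "z \<in> trop_chart N (\<sigma> \<inter> \<sigma>2)" "restrict z (cone_monoid N (\<sigma> \<inter> \<sigma>1)) = y"
        using trop_extend[OF face y(1) fin] by (simp_all add: z_def)
      have subs: "cone_monoid N \<sigma> \<subseteq> cone_monoid N (\<sigma> \<inter> \<sigma>1)" "cone_monoid N \<sigma>1 \<subseteq> cone_monoid N (\<sigma> \<inter> \<sigma>1)"
        "cone_monoid N \<sigma>1 \<subseteq> cone_monoid N \<sigma>2"
        using sub by (auto intro!: cone_monoid_antimono)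
      have z\<sigma>: "restrict z (cone_monoid N \<sigma>) = v"
        using subs(1) unfolding y(2)[symmetric] z(2)[symmetric] by (auto simp: restrict_restrict Int_absorb1)
      have z1: "restrict z (cone_monoid N \<sigma>1) = v1"
        using subs(2) unfolding y(3)[symmetric] z(2)[symmetric] by (auto simp: restrict_restrict Int_absorb1)
      have "restrict z (cone_monoid N \<sigma>2) = v2"
      proof (rule trop_chart_face_unique[OF u(3) trop_chart_restrict[OF _ z(1)] s(3)])
        show "restrict (restrict z (cone_monoid N \<sigma>2)) (cone_monoid N \<sigma>1) = restrict v2 (cone_monoid N \<sigma>1)"
          using subs(3) z1 s(4) by (simp add: restrict_restrict Int_absorb1)
      qed auto
      with z(1) z\<sigma> s show ?thesis by blast
    qed
  qed
qed

lemma trop_class_in_space: "\<sigma> \<in> \<Sigma> \<Longrightarrow> v \<in> trop_chart N \<sigma> \<Longrightarrow> trop_class N \<Sigma> \<sigma> v \<in> trop_space N \<Sigma>"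
  by (auto simp: trop_space_def)

text \<open>By separatedness, the trace of the image in the chart of \<open>\<sigma>'\<close> comes
  from the chart of \<open>\<sigma> \<inter> \<sigma>'\<close> alone, which is openly embedded in
  both charts.\<close>

lemma openin_trop_class_image:
  assumes \<sigma>: "\<sigma> \<in> \<Sigma>" and V: "openin (trop_chart_topology N \<sigma>) V"
  shows "openin (trop_topology N \<Sigma>) (trop_class N \<Sigma> \<sigma> ` V)"
  unfolding openin_trop_topology trop_open_def
proof (intro conjI ballI)
  have V\<sigma>: "V \<subseteq> trop_chart N \<sigma>" using openin_subset[OF V] by (simp add: topspace_trop_chart_topology)
  then show "trop_class N \<Sigma> \<sigma> ` V \<subseteq> trop_space N \<Sigma>" using trop_class_in_space[OF \<sigma>] by auto
  fix \<sigma>' assume \<sigma>': "\<sigma>' \<in> \<Sigma>"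
  let ?\<tau> = "\<sigma> \<inter> \<sigma>'"
  let ?W = "{y \<in> topspace (trop_chart_topology N ?\<tau>). restrict y (cone_monoid N \<sigma>) \<in> V}"
  obtain u where u: "face_by N ?\<tau> \<sigma>' u" by (rule ex_face_by[OF \<sigma>' face_Int'[OF \<sigma> \<sigma>']])
  have \<tau>: "?\<tau> \<in> \<Sigma>" by (rule Int_in_fan[OF \<sigma> \<sigma>'])
  have "openin (trop_chart_topology N ?\<tau>) ?W"
    by (rule openin_continuous_map_preimage[OF continuous_map_trop_chart_restrict V]) auto
  then have "openin (trop_chart_topology N \<sigma>') ((\<lambda>y. restrict y (cone_monoid N \<sigma>')) ` ?W)"
    by (rule openin_trop_chart_face_image[OF u])
  also have "(\<lambda>y. restrict y (cone_monoid N \<sigma>')) ` ?W = {v \<in> trop_chart N \<sigma>'. trop_class N \<Sigma> \<sigma>' v \<in> trop_class N \<Sigma> \<sigma> ` V}"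
  proof (intro equalityI subsetI)
    fix v assume "v \<in> (\<lambda>y. restrict y (cone_monoid N \<sigma>')) ` ?W"
    then obtain y where y: "y \<in> trop_chart N ?\<tau>" "restrict y (cone_monoid N \<sigma>) \<in> V" "v = restrict y (cone_monoid N \<sigma>')"
      by (auto simp: topspace_trop_chart_topology)
    have "trop_class N \<Sigma> \<sigma>' v = trop_class N \<Sigma> ?\<tau> y"
      unfolding trop_class_def y(3) by (rule glue_class_restrict[where U = "trop_chart N", OF \<tau> \<sigma>' face_Int'[OF \<sigma> \<sigma>'] y(1)])
    also have "\<dots> = trop_class N \<Sigma> \<sigma> (restrict y (cone_monoid N \<sigma>))"
      unfolding trop_class_def by (rule glue_class_restrict[where U = "trop_chart N", OF \<tau> \<sigma> face_Int[OF \<sigma> \<sigma>'] y(1), symmetric])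
    finally show "v \<in> {v \<in> trop_chart N \<sigma>'. trop_class N \<Sigma> \<sigma>' v \<in> trop_class N \<Sigma> \<sigma> ` V}"
      using y trop_chart_restrict[of ?\<tau> \<sigma>' y N] by auto
  next
    fix v assume "v \<in> {v \<in> trop_chart N \<sigma>'. trop_class N \<Sigma> \<sigma>' v \<in> trop_class N \<Sigma> \<sigma> ` V}"
    then obtain w where w: "w \<in> V" "trop_class N \<Sigma> \<sigma> w = trop_class N \<Sigma> \<sigma>' v" by auto
    then show "v \<in> (\<lambda>y. restrict y (cone_monoid N \<sigma>')) ` ?W"
      using trop_class_eqD[OF w(2) \<sigma>] V\<sigma> by (auto simp: topspace_trop_chart_topology)
  qed
  finally show "openin (trop_chart_topology N \<sigma>') {v \<in> trop_chart N \<sigma>'. trop_class N \<Sigma> \<sigma>' v \<in> trop_class N \<Sigma> \<sigma> ` V}" .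
qed

section \<open>The action of positive reals on classes\<close>

definition chart_scale :: "real \<Rightarrow> 'v set \<Rightarrow> (('v \<Rightarrow> real) \<Rightarrow> ereal) \<Rightarrow> ('v \<Rightarrow> real) \<Rightarrow> ereal" where
  "chart_scale \<rho> \<sigma> v = (\<lambda>m\<in>cone_monoid N \<sigma>. ereal \<rho> * v m)"

lemma chart_scale_in_chart:
  assumes "\<rho> > 0" "v \<in> trop_chart N \<sigma>"
  shows "chart_scale \<rho> \<sigma> v \<in> trop_chart N \<sigma>"
  unfolding trop_chart_def
proof (intro CollectI conjI ballI PiE_I)
  fix m assume m: "m \<in> cone_monoid N \<sigma>"
  show "chart_scale \<rho> \<sigma> v m \<in> {-\<infinity><..}"
    using trop_chart_gt[OF assms(2) m] assms(1) m by (cases "v m") (auto simp: chart_scale_def)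
  fix m' assume m': "m' \<in> cone_monoid N \<sigma>"
  show "chart_scale \<rho> \<sigma> v (m + m') = chart_scale \<rho> \<sigma> v m + chart_scale \<rho> \<sigma> v m'"
    using trop_chart_gt[OF assms(2) m] trop_chart_gt[OF assms(2) m'] assms(1) m m'
    by (cases "v m"; cases "v m'")
      (auto simp: chart_scale_def trop_chart_plus[OF assms(2)] plus_in_cone_monoid algebra_simps)
qed (use trop_chart_zero[OF assms(2)] in \<open>auto simp: chart_scale_def zero_in_cone_monoid\<close>)

lemma chart_scale_restrict:
  assumes "\<tau> \<subseteq> \<sigma>"
  shows "chart_scale \<rho> \<sigma> (restrict v (cone_monoid N \<sigma>)) = restrict (chart_scale \<rho> \<tau> v) (cone_monoid N \<sigma>)"
  using cone_monoid_antimono[OF assms, of N] by (auto simp: chart_scale_def fun_eq_iff restrict_def)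

lemma trop_class_scale:
  assumes \<rho>: "\<rho> > 0" and \<sigma>: "\<sigma> \<in> \<Sigma>" and v: "v \<in> trop_chart N \<sigma>"
    and eq: "trop_class N \<Sigma> \<sigma> v = trop_class N \<Sigma> \<sigma>' v'"
  shows "trop_class N \<Sigma> \<sigma> (chart_scale \<rho> \<sigma> v) = trop_class N \<Sigma> \<sigma>' (chart_scale \<rho> \<sigma>' v')"
proof -
  obtain y where \<sigma>': "\<sigma>' \<in> \<Sigma>" and y: "y \<in> trop_chart N (\<sigma> \<inter> \<sigma>')" "v = restrict y (cone_monoid N \<sigma>)" "v' = restrict y (cone_monoid N \<sigma>')"
    using trop_class_eqD[OF eq \<sigma> v] by blast
  have \<tau>: "\<sigma> \<inter> \<sigma>' \<in> \<Sigma>" by (rule Int_in_fan[OF \<sigma> \<sigma>'])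
  have ry: "chart_scale \<rho> (\<sigma> \<inter> \<sigma>') y \<in> trop_chart N (\<sigma> \<inter> \<sigma>')" by (rule chart_scale_in_chart[OF \<rho> y(1)])
  have "trop_class N \<Sigma> \<sigma> (chart_scale \<rho> \<sigma> v) = trop_class N \<Sigma> (\<sigma> \<inter> \<sigma>') (chart_scale \<rho> (\<sigma> \<inter> \<sigma>') y)"
    unfolding y(2) trop_class_def chart_scale_restrict[of "\<sigma> \<inter> \<sigma>'" \<sigma>, OF Int_lower1]
    by (rule glue_class_restrict[where U = "trop_chart N", OF \<tau> \<sigma> face_Int[OF \<sigma> \<sigma>'] ry])
  also have "\<dots> = trop_class N \<Sigma> \<sigma>' (chart_scale \<rho> \<sigma>' v')"
    unfolding y(3) trop_class_def chart_scale_restrict[of "\<sigma> \<inter> \<sigma>'" \<sigma>', OF Int_lower2]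
    by (rule glue_class_restrict[where U = "trop_chart N", OF \<tau> \<sigma>' face_Int'[OF \<sigma> \<sigma>'] ry, symmetric])
  finally show ?thesis .
qed

text \<open>\<open>trop_scale\<close> takes the image of a class as a set of pairs, so it has to be
  shown that this image is a full class. The missing inclusion uses scaling by
  \<open>1 / \<rho>\<close>.\<close>

lemma trop_scale_class:
  assumes \<rho>: "\<rho> > 0" and \<sigma>: "\<sigma> \<in> \<Sigma>" and v: "v \<in> trop_chart N \<sigma>"
  shows "trop_scale N \<rho> (trop_class N \<Sigma> \<sigma> v) = trop_class N \<Sigma> \<sigma> (chart_scale \<rho> \<sigma> v)"
proof -
  have mem: "(\<sigma>', v') \<in> trop_class N \<Sigma> \<sigma> w \<longleftrightarrow> trop_class N \<Sigma> \<sigma> w = trop_class N \<Sigma> \<sigma>' v'" for \<sigma>' v' w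
    unfolding trop_class_def glue_class_eq_iff by (simp add: glue_class_def)
  have inv: "chart_scale r \<sigma>' (chart_scale s \<sigma>' w) = w" if "r * s = 1" "w \<in> trop_chart N \<sigma>'" for r s \<sigma>' w
  proof (rule extensionalityI[OF _ trop_chart_extensional[OF that(2)]])
    show "chart_scale r \<sigma>' (chart_scale s \<sigma>' w) \<in> extensional (cone_monoid N \<sigma>')" by (simp add: chart_scale_def)
    fix m assume "m \<in> cone_monoid N \<sigma>'"
    then show "chart_scale r \<sigma>' (chart_scale s \<sigma>' w) m = w m"
      using that(1) by (simp add: chart_scale_def flip: mult.assoc one_ereal_def)
  qed
  show ?thesis
  proof (intro equalityI subsetI)
    fix p assume "p \<in> trop_scale N \<rho> (trop_class N \<Sigma> \<sigma> v)"
    then obtain \<sigma>' v' where p: "p = (\<sigma>', chart_scale \<rho> \<sigma>' v')" "(\<sigma>', v') \<in> trop_class N \<Sigma> \<sigma> v"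
      by (auto simp: trop_scale_def chart_scale_def)
    from p(2) have "trop_class N \<Sigma> \<sigma> v = trop_class N \<Sigma> \<sigma>' v'" unfolding mem .
    then show "p \<in> trop_class N \<Sigma> \<sigma> (chart_scale \<rho> \<sigma> v)"
      unfolding p(1) mem by (rule trop_class_scale[OF \<rho> \<sigma> v])
  next
    fix p assume p: "p \<in> trop_class N \<Sigma> \<sigma> (chart_scale \<rho> \<sigma> v)"
    obtain \<sigma>' w where w: "p = (\<sigma>', w)" by fastforce
    have rv: "chart_scale \<rho> \<sigma> v \<in> trop_chart N \<sigma>" by (rule chart_scale_in_chart[OF \<rho> v])
    have eq: "trop_class N \<Sigma> \<sigma> (chart_scale \<rho> \<sigma> v) = trop_class N \<Sigma> \<sigma>' w" using p by (simp add: w mem)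
    then have w': "w \<in> trop_chart N \<sigma>'" using trop_class_eqD[OF eq \<sigma> rv] by blast
    have "trop_class N \<Sigma> \<sigma> v = trop_class N \<Sigma> \<sigma>' (chart_scale (1 / \<rho>) \<sigma>' w)"
      using trop_class_scale[OF _ \<sigma> rv eq, of "1 / \<rho>"] \<rho> by (simp add: inv v)
    then have "(\<sigma>', chart_scale (1 / \<rho>) \<sigma>' w) \<in> trop_class N \<Sigma> \<sigma> v" unfolding mem .
    moreover have "w = chart_scale \<rho> \<sigma>' (chart_scale (1 / \<rho>) \<sigma>' w)" using \<rho> w' by (simp add: inv)
    ultimately show "p \<in> trop_scale N \<rho> (trop_class N \<Sigma> \<sigma> v)"
      unfolding trop_scale_def w by (force simp: chart_scale_def)
  qed
qed

lemma toric_class_restrict: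
  assumes "\<tau> \<in> \<Sigma>" "\<sigma> \<in> \<Sigma>" "cone_face \<tau> \<sigma>" "x \<in> affine_points N \<tau>"
  shows "toric_class N \<Sigma> \<sigma> (restrict x (monoid_algebra N \<sigma>)) = toric_class N \<Sigma> \<tau> x"
  unfolding toric_class_def using assms by (rule glue_class_restrict)

end

subsection \<open>Limits of rescaled points define seminorms\<close>

lemma neg_log_mult: "0 \<le> s \<Longrightarrow> 0 \<le> t \<Longrightarrow> neg_log (s * t) = neg_log s + neg_log t"
  by (auto simp: neg_log_def ln_mult)

lemma neg_log_one: "neg_log 1 = 0"
  by (simp add: neg_log_def)

lemma neg_log_neq: "neg_log t \<noteq> -\<infinity>"
  by (simp add: neg_log_def)

text \<open>The inverse of \<open>neg_log\<close> away from \<open>-\<infinity>\<close>. It moves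
  limits from the extended reals back to absolute values, where infinity becomes 0.\<close>

definition exp_neg :: "ereal \<Rightarrow> real" where
  "exp_neg v = (if v = \<infinity> then 0 else exp (- real_of_ereal v))"

lemma exp_neg_nonneg: "0 \<le> exp_neg v"
  by (simp add: exp_neg_def)

lemma neg_log_exp_neg: "v > -\<infinity> \<Longrightarrow> neg_log (exp_neg v) = v"
  by (cases v) (auto simp: neg_log_def exp_neg_def)

lemma exp_neg_scaled_neg_log: "0 < \<rho> \<Longrightarrow> 0 \<le> t \<Longrightarrow> exp_neg (ereal \<rho> * neg_log t) = t powr \<rho>"
  by (auto simp: neg_log_def exp_neg_def powr_def)

lemma tendsto_exp_neg:
  assumes "(f \<longlongrightarrow> v) F" "v > -\<infinity>"
  shows "((\<lambda>x. exp_neg (f x)) \<longlongrightarrow> exp_neg v) F"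
proof (cases v)
  case (real r)
  have "eventually (\<lambda>x. f x < \<infinity>) F" using assms(1) real by (intro order_tendstoD) auto
  then have "eventually (\<lambda>x. exp (- real_of_ereal (f x)) = exp_neg (f x)) F"
    by eventually_elim (auto simp: exp_neg_def)
  moreover have "((\<lambda>x. exp (- real_of_ereal (f x))) \<longlongrightarrow> exp (- r)) F"
    using assms(1) unfolding real by (intro tendsto_intros lim_real_of_ereal)
  ultimately have "((\<lambda>x. exp_neg (f x)) \<longlongrightarrow> exp (- r)) F" by (rule Lim_transform_eventually[rotated])
  then show ?thesis using real by (simp add: exp_neg_def)
next
  case PInf
  have "eventually (\<lambda>x. dist (exp_neg (f x)) 0 < e) F" if e: "e > 0" for e
  proof -
    have "eventually (\<lambda>x. ereal (- ln e) < f x) F" using assms(1) PInf by (intro order_tendstoD) auto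
    then show ?thesis
    proof eventually_elim
      case (elim x)
      show ?case
      proof (cases "f x")
        case (real r)
        then have "- r < ln e" using elim by simp
        then have "exp (- r) < exp (ln e)" by (simp only: exp_less_cancel_iff)
        then show ?thesis using e real by (simp add: exp_neg_def)
      qed (use elim e in \<open>auto simp: exp_neg_def\<close>)
    qed
  qed
  then show ?thesis using PInf by (simp add: tendsto_iff exp_neg_def)
qed (use assms in auto)

context toric_fan
begin

definition trop_of :: "'v set \<Rightarrow> ('v regular_fun \<Rightarrow> real) \<Rightarrow> ('v \<Rightarrow> real) \<Rightarrow> ereal" where
  "trop_of \<sigma> s = (\<lambda>m\<in>cone_monoid N \<sigma>. neg_log (s (character m)))"

lemma trop_of_in_chart:
  assumes "s (character 0) = 1" "\<And>m. m \<in> cone_monoid N \<sigma> \<Longrightarrow> 0 \<le> s (character m)"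
    and "\<And>m m'. m \<in> cone_monoid N \<sigma> \<Longrightarrow> m' \<in> cone_monoid N \<sigma> \<Longrightarrow> s (character (m + m')) = s (character m) * s (character m')"
  shows "trop_of \<sigma> s \<in> trop_chart N \<sigma>"
  unfolding trop_chart_def trop_of_def using assms
  by (auto simp: zero_in_cone_monoid plus_in_cone_monoid neg_log_one neg_log_mult neg_log_neq)

lemma trop_of_point_in_chart:
  "x \<in> affine_points N \<sigma> \<Longrightarrow> trop_of \<sigma> (\<lambda>f. cmod (x f)) \<in> trop_chart N \<sigma>"
  by (intro trop_of_in_chart)
    (auto simp: affine_point_character_zero affine_point_character_plus norm_mult)

lemma trop_of_seminorm_in_chart:
  assumes "mult_seminorm N \<sigma> s"
  shows "trop_of \<sigma> s \<in> trop_chart N \<sigma>"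
proof (rule trop_of_in_chart)
  have "s (scalar 1) = 1" using assms by (simp add: mult_seminorm_def trivial_norm_def)
  then show "s (character 0) = 1" by (simp add: character_zero scalar_one)
qed (use assms in \<open>auto simp: mult_seminorm_def character_plus\<close>)

text \<open>Hypothesis \<open>near\<close> is the negation, within one chart, of condition (i) of
  the Kuratowski limit at the point \<open>w\<close>.\<close>

lemma limit_point_seminorm:
  assumes w: "w \<in> trop_chart N \<sigma>" and X: "X \<subseteq> affine_points N \<sigma>"
    and near: "\<And>V \<rho>0. openin (trop_chart_topology N \<sigma>) V \<Longrightarrow> w \<in> V \<Longrightarrow> \<rho>0 > 0 \<Longrightarrow>
      \<exists>\<rho> x. 0 < \<rho> \<and> \<rho> < \<rho>0 \<and> x \<in> X \<and> chart_scale \<rho> \<sigma> (trop_of \<sigma> (\<lambda>f. cmod (x f))) \<in> V"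
  obtains s where "mult_seminorm N \<sigma> s" "\<And>f. f \<in> monoid_algebra N \<sigma> \<Longrightarrow> (\<And>x. x \<in> X \<Longrightarrow> x f = 0) \<Longrightarrow> s f = 0"
    "trop_of \<sigma> s = w"
proof -
  define T where "T = trop_chart_topology N \<sigma>"
  define A where "A = monoid_algebra N \<sigma>"
  define logp where "logp p = chart_scale (snd p) \<sigma> (trop_of \<sigma> (\<lambda>f. cmod (fst p f)))" for p :: "('v regular_fun \<Rightarrow> complex) \<times> real"
  \<comment> \<open>The filter of pairs \<open>(x, \<rho>)\<close> with \<open>x\<close> in
    \<open>X\<close>, \<open>\<rho>\<close> tending to 0 from above and the rescaled image of
    \<open>x\<close> tending to \<open>w\<close>. By \<open>near\<close> it is proper.\<close>
  define F where "F = inf (inf (filtercomap logp (nhdsin T w)) (filtercomap snd (at_right 0))) (principal {p. fst p \<in> X})"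
  have wT: "w \<in> topspace T" using w by (simp add: T_def topspace_trop_chart_topology)
  have F_bot: "F \<noteq> bot"
  proof
    assume "F = bot"
    then have "eventually (\<lambda>_. False) F" by simp
    then have "eventually (\<lambda>p. fst p \<notin> X) (inf (filtercomap logp (nhdsin T w)) (filtercomap snd (at_right 0)))"
      by (simp add: F_def eventually_inf_principal)
    then obtain P' Q' where P': "eventually P' (filtercomap logp (nhdsin T w))" and Q': "eventually Q' (filtercomap snd (at_right 0))"
      and PQ': "\<forall>p. P' p \<and> Q' p \<longrightarrow> fst p \<notin> X"
      unfolding eventually_inf by (elim exE conjE)
    from P' obtain P where P: "eventually P (nhdsin T w)" "\<forall>p. P (logp p) \<longrightarrow> P' p"
      unfolding eventually_filtercomap by (elim exE conjE)
    from Q' obtain Q where Q: "eventually Q (at_right 0)" "\<forall>p. Q (snd p) \<longrightarrow> Q' p"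
      unfolding eventually_filtercomap by (elim exE conjE)
    have PQ: "eventually P (nhdsin T w)" "eventually Q (at_right 0)"
        "\<And>p. P (logp p) \<Longrightarrow> Q (snd p) \<Longrightarrow> fst p \<in> X \<Longrightarrow> False"
      using P Q PQ' by auto
    obtain V where V: "openin T V" "w \<in> V" "\<And>v. v \<in> V \<Longrightarrow> P v"
      using PQ(1) wT by (auto simp: eventually_nhdsin)
    obtain b where b: "b > 0" "\<And>r. 0 < r \<Longrightarrow> r < b \<Longrightarrow> Q r"
      using PQ(2) by (auto simp: eventually_at_right_field)
    obtain \<rho> x where "0 < \<rho>" "\<rho> < b" "x \<in> X" "chart_scale \<rho> \<sigma> (trop_of \<sigma> (\<lambda>f. cmod (x f))) \<in> V"
      using near[of V b] V(1,2) b(1) by (auto simp: T_def)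
    then show False using PQ(3)[of "(x, \<rho>)"] V(3) b(2) by (auto simp: logp_def)
  qed
  have ev_X: "eventually (\<lambda>p. fst p \<in> X) F"
    unfolding F_def by (simp add: eventually_inf_principal)
  have lim_snd: "filterlim snd (at_right 0) F"
    unfolding F_def by (intro filterlim_mono[OF filterlim_filtercomap order_refl]) (auto intro: le_infI1 le_infI2)
  have ev_pos: "eventually (\<lambda>p. 0 < snd p \<and> snd p < 1) F"
  proof -
    have "eventually (\<lambda>r. 0 < r \<and> r < 1) (at_right (0::real))"
      by (auto simp: eventually_at_right_field intro: exI[of _ 1])
    with lim_snd show ?thesis unfolding filterlim_iff by blast
  qed
  define h where "h f p = cmod (fst p f) powr snd p" for f and p :: "('v regular_fun \<Rightarrow> complex) \<times> real"
  have lim_char: "(h (character m) \<longlongrightarrow> exp_neg (w m)) F" if m: "m \<in> cone_monoid N \<sigma>" for m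
  proof -
    have "filterlim logp (nhdsin T w) F"
      unfolding F_def by (intro filterlim_mono[OF filterlim_filtercomap order_refl]) (auto intro: le_infI1)
    moreover have "((\<lambda>v. v m) \<longlongrightarrow> w m) (nhdsin T w)"
    proof (rule topological_tendstoI)
      fix S assume S: "open S" "w m \<in> S"
      have "eventually (\<lambda>v. v m \<in> S) (atin T w)"
        unfolding T_def by (rule topological_tendstoD[OF tendsto_trop_chart_coordinate[OF w m] S])
      then obtain U where U: "openin T U" "w \<in> U" "\<forall>v\<in>U - {w}. v m \<in> S"
        using wT unfolding eventually_atin by blast
      then have "\<forall>v\<in>U. v m \<in> S" using S(2) by blast
      with U show "eventually (\<lambda>v. v m \<in> S) (nhdsin T w)" unfolding eventually_nhdsin by blast
    qed
    ultimately have "((\<lambda>p. logp p m) \<longlongrightarrow> w m) F" by (rule filterlim_compose[rotated])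
    then have "((\<lambda>p. exp_neg (logp p m)) \<longlongrightarrow> exp_neg (w m)) F" by (rule tendsto_exp_neg) (rule trop_chart_gt[OF w m])
    moreover have "eventually (\<lambda>p. exp_neg (logp p m) = h (character m) p) F"
      using ev_pos by eventually_elim (simp add: logp_def chart_scale_def trop_of_def h_def m exp_neg_scaled_neg_log)
    ultimately show ?thesis by (rule Lim_transform_eventually)
  qed
  \<comment> \<open>Characters occurring in \<open>f\<close> eventually satisfy
    \<open>|\<chi>| \<le> b powr (1 / \<rho>)\<close>, whence
    \<open>|f| \<le> c * b powr (1 / \<rho>)\<close>. Raising to the power \<open>\<rho> < 1\<close>
    leaves at most \<open>c * b\<close>.\<close>
  have bound: "\<exists>B. eventually (\<lambda>p. h f p \<le> B) F" if f: "f \<in> A" for f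
  proof -
    let ?K = "keys f"
    have K: "?K \<subseteq> cone_monoid N \<sigma>" using f by (simp add: A_def monoid_algebra_def)
    define b where "b = 1 + (\<Sum>m\<in>?K. exp_neg (w m))"
    define c where "c = 1 + (\<Sum>m\<in>?K. cmod (lookup f m))"
    have b0: "b \<ge> 1" and c0: "c \<ge> 1" by (auto simp: b_def c_def intro!: sum_nonneg exp_neg_nonneg)
    have "eventually (\<lambda>p. \<forall>m\<in>?K. h (character m) p < b) F"
    proof (rule eventually_ball_finite[OF finite_keys], intro ballI)
      fix m assume m: "m \<in> ?K"
      show "eventually (\<lambda>p. h (character m) p < b) F"
      proof (rule order_tendstoD(2)[OF lim_char])
        have "exp_neg (w m) \<le> (\<Sum>m\<in>?K. exp_neg (w m))"
          using m by (intro member_le_sum exp_neg_nonneg) auto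
        then show "exp_neg (w m) < b" by (simp add: b_def)
      qed (use m K in auto)
    qed
    then have "eventually (\<lambda>p. h f p \<le> c * b) F"
      using ev_pos ev_X
    proof eventually_elim
      case (elim p)
      obtain x \<rho> where p: "p = (x, \<rho>)" by fastforce
      have x: "x \<in> affine_points N \<sigma>" and \<rho>: "0 < \<rho>" "\<rho> < 1" using elim X by (auto simp: p)
      have le: "cmod (x (character m)) \<le> b powr (1 / \<rho>)" if m: "m \<in> ?K" for m
      proof -
        have "cmod (x (character m)) = (cmod (x (character m)) powr \<rho>) powr (1 / \<rho>)"
          using \<rho> by (simp add: powr_powr)
        also have "\<dots> \<le> b powr (1 / \<rho>)"
          using elim(1) m \<rho> by (intro powr_mono2) (auto simp: h_def p less_imp_le)
        finally show ?thesis .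
      qed
      have "cmod (x f) \<le> (\<Sum>m\<in>?K. cmod (lookup f m) * cmod (x (character m)))"
        unfolding affine_point_eval[OF x f[unfolded A_def]] cplx.eval_def
        by (rule order_trans[OF norm_sum]) (simp add: norm_mult)
      also have "\<dots> \<le> (\<Sum>m\<in>?K. cmod (lookup f m) * b powr (1 / \<rho>))"
        using le by (intro sum_mono mult_left_mono) auto
      also have "\<dots> \<le> c * b powr (1 / \<rho>)"
        unfolding c_def sum_distrib_right[symmetric] by (rule mult_right_mono) auto
      finally have "h f p \<le> (c * b powr (1 / \<rho>)) powr \<rho>"
        using \<rho> by (simp add: h_def p powr_mono2)
      also have "\<dots> = c powr \<rho> * b"
        using b0 c0 \<rho> by (simp add: powr_mult powr_powr)
      also have "c powr \<rho> \<le> c powr 1" using c0 \<rho> by (intro powr_mono) auto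
      finally show ?case using b0 c0 by simp
    qed
    then show ?thesis by blast
  qed
  define B where "B f = (if f \<in> A then SOME B. eventually (\<lambda>p. h f p \<le> B) F else 0)" for f
  have B: "eventually (\<lambda>p. h f p \<le> B f) F" if "f \<in> A" for f
    using someI_ex[OF bound[OF that]] that by (simp add: B_def)
  \<comment> \<open>Clipping puts every value into the compact box \<open>U\<close>; on the algebra,
    \<open>H\<close> eventually agrees with \<open>h\<close>.\<close>
  define H where "H p f = max 0 (min (h f p) (B f))" for p f
  define U where "U = PiE UNIV (\<lambda>f :: 'v regular_fun. {0..max 0 (B f)})"
  have "compact U"
  proof -
    have "compactin (product_topology (\<lambda>_. euclidean) UNIV) U"
      unfolding U_def by (subst compactin_PiE) (auto simp: compactin_euclidean_iff)
    then show ?thesis by (simp add: euclidean_product_topology compactin_euclidean_iff)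
  qed
  moreover have "filtermap H F \<noteq> bot" using F_bot by (simp add: filtermap_bot_iff)
  moreover have "eventually (\<lambda>s. s \<in> U) (filtermap H F)"
  proof -
    have "H p \<in> U" for p by (auto simp: H_def U_def)
    then show ?thesis by (simp add: eventually_filtermap)
  qed
  ultimately obtain s where s: "inf (nhds s) (filtermap H F) \<noteq> bot"
    unfolding compact_filter by blast
  \<comment> \<open>Along this refinement of \<open>F\<close> the cluster point \<open>s\<close> is
    an actual limit.\<close>
  define F' where "F' = inf F (filtercomap H (nhds s))"
  have F'_bot: "F' \<noteq> bot"
  proof
    assume "F' = bot"
    then have "eventually (\<lambda>_. False) F'" by simp
    then obtain P Q' where P: "eventually P F" and Q': "eventually Q' (filtercomap H (nhds s))" and PQ': "\<forall>p. P p \<and> Q' p \<longrightarrow> False"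
      unfolding F'_def eventually_inf by (elim exE conjE)
    from Q' obtain Q where Q: "eventually Q (nhds s)" "\<forall>p. Q (H p) \<longrightarrow> Q' p"
      unfolding eventually_filtercomap by (elim exE conjE)
    have PQ: "eventually P F" "eventually Q (nhds s)" "\<And>p. P p \<Longrightarrow> Q (H p) \<Longrightarrow> False"
      using P Q PQ' by auto
    have "eventually (\<lambda>y. \<not> Q y) (filtermap H F)"
      unfolding eventually_filtermap using PQ(1) by eventually_elim (use PQ(3) in blast)
    with PQ(2) have "eventually (\<lambda>_. False) (inf (nhds s) (filtermap H F))"
      unfolding eventually_inf by blast
    with s show False by simp
  qed
  have F'_le: "F' \<le> F" by (simp add: F'_def)
  have lim: "(h f \<longlongrightarrow> s f) F'" if f: "f \<in> A" for f
  proof -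
    have H_lim: "filterlim H (nhds s) F'"
      unfolding F'_def by (intro filterlim_mono[OF filterlim_filtercomap order_refl]) auto
    have "((\<lambda>p. H p f) \<longlongrightarrow> s f) F'"
    proof (rule topological_tendstoI)
      fix S assume S: "open S" "s f \<in> S"
      have "open ((\<lambda>v. v f) -` S)"
        using S(1) continuous_on_product_coordinates by (rule open_vimage)
      then have "eventually (\<lambda>p. H p \<in> (\<lambda>v. v f) -` S) F'"
        using H_lim S(2) by (intro topological_tendstoD) auto
      then show "eventually (\<lambda>p. H p f \<in> S) F'" by simp
    qed
    moreover have "eventually (\<lambda>p. H p f = h f p) F'"
      using filter_leD[OF F'_le B[OF f]] by eventually_elim (simp add: H_def h_def)
    ultimately show ?thesis by (rule Lim_transform_eventually)
  qed
  have ev: "eventually (\<lambda>p. fst p \<in> affine_points N \<sigma> \<and> fst p \<in> X \<and> 0 < snd p \<and> snd p < 1) F'"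
    using filter_leD[OF F'_le ev_X] filter_leD[OF F'_le ev_pos] by eventually_elim (use X in auto)
  have lim_rho: "(snd \<longlongrightarrow> 0) F'"
    using filterlim_mono[OF lim_snd order_refl F'_le] by (simp add: filterlim_at)
  have char_mem: "character m \<in> A" if "m \<in> cone_monoid N \<sigma>" for m using that by (simp add: A_def)
  show ?thesis
  proof (rule that)
    show "mult_seminorm N \<sigma> s"
      unfolding mult_seminorm_def A_def[symmetric]
    proof (intro conjI ballI allI)
      show "0 \<le> s f" if "f \<in> A" for f
        by (rule tendsto_lowerbound[OF lim[OF that]]) (use F'_bot in \<open>auto simp: h_def\<close>)
      fix f g assume f: "f \<in> A" and g: "g \<in> A"
      have fg: "f + g \<in> A" "f * g \<in> A" using f g by (auto simp: A_def monoid_algebra.add_mem monoid_algebra.mult_mem)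
      have s0: "0 \<le> s f" "0 \<le> s g"
        using tendsto_lowerbound[OF lim[OF f], of 0] tendsto_lowerbound[OF lim[OF g], of 0] F'_bot by (auto simp: h_def)
      \<comment> \<open>The constant 2 of the Archimedean estimate by a maximum becomes
        \<open>2 powr \<rho>\<close> and disappears in the limit, so \<open>s\<close> satisfies even
        the ultrametric inequality.\<close>
      have "((\<lambda>p. 2 powr snd p * max (h f p) (h g p)) \<longlongrightarrow> 2 powr 0 * max (s f) (s g)) F'"
        by (intro tendsto_intros lim f g lim_rho) auto
      moreover have "eventually (\<lambda>p. h (f + g) p \<le> 2 powr snd p * max (h f p) (h g p)) F'"
        using ev
      proof eventually_elim
        case (elim p)
        have "cmod (fst p (f + g)) \<le> 2 * max (cmod (fst p f)) (cmod (fst p g))"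
          using f g elim norm_triangle_ineq[of "fst p f" "fst p g"] affine_point_add[of "fst p" N \<sigma> f g]
          by (simp add: A_def max_def)
        then have "h (f + g) p \<le> (2 * max (cmod (fst p f)) (cmod (fst p g))) powr snd p"
          unfolding h_def using elim by (intro powr_mono2) auto
        also have "\<dots> = 2 powr snd p * max (h f p) (h g p)"
        proof -
          have "(max (cmod (fst p f)) (cmod (fst p g))) powr snd p = max (h f p) (h g p)"
            using elim unfolding h_def by (auto simp: max_def powr_mono2 intro!: antisym powr_mono2)
          then show ?thesis by (simp add: powr_mult)
        qed
        finally show ?case .
      qed
      ultimately have "s (f + g) \<le> 2 powr 0 * max (s f) (s g)"
        using tendsto_le[OF F'_bot _ lim[OF fg(1)]] by blast
      then show "s (f + g) \<le> s f + s g" using s0 by simp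
      have "eventually (\<lambda>p. h (f * g) p = h f p * h g p) F'"
        using ev by eventually_elim (use f g in \<open>simp add: h_def A_def affine_point_mult[where N = N and \<sigma> = \<sigma>] norm_mult powr_mult\<close>)
      moreover have "((\<lambda>p. h f p * h g p) \<longlongrightarrow> s f * s g) F'" by (intro tendsto_intros lim f g)
      ultimately have "(h (f * g) \<longlongrightarrow> s f * s g) F'" by (simp cong: tendsto_cong)
      then show "s (f * g) = s f * s g" by (rule tendsto_unique[OF F'_bot lim[OF fg(2)]])
    next
      fix a
      have "(h (scalar a) \<longlongrightarrow> s (scalar a)) F'" by (rule lim) (simp add: A_def)
      moreover have "eventually (\<lambda>p. h (scalar a) p = cmod a powr snd p) F'"
        using ev by eventually_elim (simp add: h_def affine_point_scalar[where N = N and \<sigma> = \<sigma>])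
      ultimately have l: "((\<lambda>p. cmod a powr snd p) \<longlongrightarrow> s (scalar a)) F'" by (simp cong: tendsto_cong)
      \<comment> \<open>The origin of the trivial norm: \<open>cmod a powr \<rho>\<close> tends to 1
        for every \<open>a \<noteq> 0\<close>.\<close>
      have "((\<lambda>p. cmod a powr snd p) \<longlongrightarrow> trivial_norm a) F'"
      proof (cases "a = 0")
        case False
        then have "((\<lambda>p. cmod a powr snd p) \<longlongrightarrow> cmod a powr 0) F'"
          by (intro tendsto_intros lim_rho) auto
        then show ?thesis using False by (simp add: trivial_norm_def)
      qed (simp add: trivial_norm_def)
      with l show "s (scalar a) = trivial_norm a" by (rule tendsto_unique[OF F'_bot])
    qed
    show "s f = 0" if f: "f \<in> monoid_algebra N \<sigma>" and zero: "\<And>x. x \<in> X \<Longrightarrow> x f = 0" for f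
    proof -
      have "eventually (\<lambda>p. h f p = 0) F'" using ev by eventually_elim (simp add: h_def zero)
      then have "(h f \<longlongrightarrow> 0) F'" by (simp cong: tendsto_cong)
      then show ?thesis using f by (intro tendsto_unique[OF F'_bot lim]) (auto simp: A_def)
    qed
    show "trop_of \<sigma> s = w"
    proof (rule extensionalityI[OF _ trop_chart_extensional[OF w]])
      show "trop_of \<sigma> s \<in> extensional (cone_monoid N \<sigma>)" by (simp add: trop_of_def)
      fix m assume m: "m \<in> cone_monoid N \<sigma>"
      have "s (character m) = exp_neg (w m)"
        by (rule tendsto_unique[OF F'_bot lim[OF char_mem[OF m]] tendsto_mono[OF F'_le lim_char[OF m]]])
      then show "trop_of \<sigma> s m = w m"
        using m by (simp add: trop_of_def neg_log_exp_neg[OF trop_chart_gt[OF w m]])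
    qed
  qed
qed

end

subsection \<open>Points of the tropicalization are limits\<close>

lemma character_of_nat_add: "character (of_nat (k + l) * m) = character (of_nat k * m) * character (of_nat l * m)"
  by (simp only: of_nat_add distrib_right character_plus)

definition monomial_exponent :: "nat \<Rightarrow> (nat \<Rightarrow> 'v \<Rightarrow> real) \<Rightarrow> (nat \<Rightarrow> nat) \<Rightarrow> 'v::real_vector \<Rightarrow> real" where
  "monomial_exponent n \<gamma> \<mu> = (\<Sum>j<n. of_nat (\<mu> j) * \<gamma> j)"

lemma monomial_exponent_plus: "monomial_exponent n \<gamma> (\<mu> + \<nu>) = monomial_exponent n \<gamma> \<mu> + monomial_exponent n \<gamma> \<nu>"
  by (simp add: monomial_exponent_def plus_fun_apply[of \<mu>] distrib_right sum.distrib)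

lemma monomial_exponent_zero: "monomial_exponent n \<gamma> 0 = 0"
  by (simp add: monomial_exponent_def zero_fun_apply)

text \<open>The ring homomorphism sending the variable \<open>j\<close> to the character
  \<open>\<gamma> j\<close>. Since \<open>\<gamma> j\<close> may lie outside the cone monoid, its
  values lie in the ring of all finitely supported functions.\<close>

definition substitute :: "nat \<Rightarrow> (nat \<Rightarrow> 'v::real_vector \<Rightarrow> real) \<Rightarrow> ((nat \<Rightarrow> nat) \<Rightarrow>\<^sub>0 complex) \<Rightarrow> 'v regular_fun" where
  "substitute n \<gamma> = complex_subalgebra.eval scalar (\<lambda>\<mu>. character (monomial_exponent n \<gamma> \<mu>))"

lemma substitute_add: "substitute n \<gamma> (f + g) = substitute n \<gamma> f + substitute n \<gamma> g"
  unfolding substitute_def by (rule monoid_algebra.eval_add)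

lemma substitute_mult: "substitute n \<gamma> (f * g) = substitute n \<gamma> f * substitute n \<gamma> g"
  unfolding substitute_def
  by (rule monoid_algebra.eval_mult[where E = UNIV]) (auto simp: monomial_exponent_plus character_plus)

lemma substitute_single: "substitute n \<gamma> (single \<mu> c) = scalar c * character (monomial_exponent n \<gamma> \<mu>)"
  unfolding substitute_def by (rule monoid_algebra.eval_single)

text \<open>The preimage under substitution of the localisation of \<open>I\<close> at the character
  \<open>m0\<close>, with the denominator cleared by a power of that character.\<close>

definition pulled_back_ideal :: "nat \<Rightarrow> (nat \<Rightarrow> 'v::real_vector \<Rightarrow> real) \<Rightarrow> ('v \<Rightarrow> real) \<Rightarrow> 'v regular_fun set
    \<Rightarrow> ((nat \<Rightarrow> nat) \<Rightarrow>\<^sub>0 complex) set" where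
  "pulled_back_ideal n \<gamma> m0 I = {f. keys f \<subseteq> exponents n \<and> (\<exists>k. character (of_nat k * m0) * substitute n \<gamma> f \<in> I)}"

context
  fixes N :: "'v::real_vector set" and \<sigma> s
  assumes s: "mult_seminorm N \<sigma> s"
begin

lemma seminorm_nonneg: "f \<in> monoid_algebra N \<sigma> \<Longrightarrow> 0 \<le> s f"
  and seminorm_add: "f \<in> monoid_algebra N \<sigma> \<Longrightarrow> g \<in> monoid_algebra N \<sigma> \<Longrightarrow> s (f + g) \<le> s f + s g"
  and seminorm_mult: "f \<in> monoid_algebra N \<sigma> \<Longrightarrow> g \<in> monoid_algebra N \<sigma> \<Longrightarrow> s (f * g) = s f * s g"
  and seminorm_scalar: "s (scalar a) = trivial_norm a"
  using s by (auto simp: mult_seminorm_def)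

lemma seminorm_one: "s 1 = 1" and seminorm_zero: "s 0 = 0"
  using seminorm_scalar[of 1] seminorm_scalar[of 0] by (simp_all add: scalar_def trivial_norm_def)

lemma seminorm_power: "f \<in> monoid_algebra N \<sigma> \<Longrightarrow> s (f ^ n) = s f ^ n"
  by (induction n) (auto simp: seminorm_one seminorm_mult monoid_algebra.power_mem)

lemma seminorm_sum_le:
  "(\<And>i. i \<in> I \<Longrightarrow> h i \<in> monoid_algebra N \<sigma>) \<Longrightarrow> s (sum h I) \<le> (\<Sum>i\<in>I. s (h i))"
proof (induction I rule: infinite_finite_induct)
  case (insert i I)
  then have "s (h i + sum h I) \<le> s (h i) + s (sum h I)"
    by (intro seminorm_add monoid_algebra.sum_mem) auto
  with insert show ?case by force
qed (simp_all add: seminorm_zero)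

text \<open>Binomial coefficients have norm at most 1 because constants carry the trivial norm. So
  the binomial theorem bounds the \<open>n\<close>-th power of the left side by \<open>n + 1\<close>
  times that of the right side; a geometric gain would beat the linear factor.\<close>

lemma seminorm_ultrametric:
  assumes f: "f \<in> monoid_algebra N \<sigma>" and g: "g \<in> monoid_algebra N \<sigma>"
  shows "s (f + g) \<le> max (s f) (s g)"
proof (rule ccontr)
  define c where "c = max (s f) (s g)"
  assume "\<not> s (f + g) \<le> max (s f) (s g)"
  then have gt: "c < s (f + g)" by (simp only: c_def not_le)
  have c: "0 \<le> c" "s f \<le> c" "s g \<le> c" using seminorm_nonneg[OF f] by (auto simp: c_def)
  have fg: "f + g \<in> monoid_algebra N \<sigma>" using f g by (rule monoid_algebra.add_mem)
  have pow: "s (f + g) ^ n \<le> real (Suc n) * c ^ n" for n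
  proof -
    have mem: "of_nat (n choose k) * f ^ k * g ^ (n - k) \<in> monoid_algebra N \<sigma>" for k
      using monoid_algebra.sc_mem[of "of_nat (n choose k)" N \<sigma>] f g
      by (intro monoid_algebra.mult_mem monoid_algebra.power_mem) (simp_all add: monoid_algebra.sc_of_nat)
    have "s (f + g) ^ n = s (\<Sum>k\<le>n. of_nat (n choose k) * f ^ k * g ^ (n - k))"
      by (simp add: binomial_ring flip: seminorm_power[OF fg])
    also have "\<dots> \<le> (\<Sum>k\<le>n. s (of_nat (n choose k) * f ^ k * g ^ (n - k)))"
      by (intro seminorm_sum_le mem)
    also have "\<dots> \<le> (\<Sum>k\<le>n. c ^ n)"
    proof (intro sum_mono)
      fix k assume "k \<in> {..n}"
      then have k: "k \<le> n" by simp
      have "s (of_nat (n choose k) * f ^ k * g ^ (n - k)) = trivial_norm (of_nat (n choose k)) * s f ^ k * s g ^ (n - k)"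
        using f g by (simp add: seminorm_mult seminorm_power monoid_algebra.power_mem monoid_algebra.mult_mem
            seminorm_scalar flip: monoid_algebra.sc_of_nat)
      also have "\<dots> \<le> 1 * c ^ k * c ^ (n - k)"
        using c seminorm_nonneg[OF f] seminorm_nonneg[OF g]
        by (intro mult_mono power_mono) (auto simp: trivial_norm_def)
      also have "\<dots> = c ^ n" using k by (simp flip: power_add)
      finally show "s (of_nat (n choose k) * f ^ k * g ^ (n - k)) \<le> c ^ n" .
    qed
    finally show ?thesis by simp
  qed
  define d where "d = s (f + g)"
  have d0: "d > 0" using gt c by (simp add: d_def)
  have "(\<lambda>n. real (Suc n) * (c / d) ^ n) \<longlonglongrightarrow> 0"
  proof -
    have "\<bar>c / d\<bar> < 1" using gt c d0 by (simp add: d_def)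
    then have "(\<lambda>n. real n * (c / d) ^ n + (c / d) ^ n) \<longlonglongrightarrow> 0 + 0"
      by (intro tendsto_add powser_times_n_limit_0 LIMSEQ_power_zero) auto
    then show ?thesis by (simp add: algebra_simps)
  qed
  moreover have "1 \<le> real (Suc n) * (c / d) ^ n" for n
    using pow[of n] d0 by (simp add: d_def power_divide field_simps)
  ultimately have "(1::real) \<le> 0" by (intro LIMSEQ_le_const) auto
  then show False by simp
qed

lemma seminorm_sum_less:
  assumes "finite I" "\<And>i. i \<in> I \<Longrightarrow> h i \<in> monoid_algebra N \<sigma>" "\<And>i. i \<in> I \<Longrightarrow> s (h i) < c" "0 < c"
  shows "s (sum h I) < c"
  using assms(1-3)
proof (induction I rule: finite_induct)
  case (insert i I)
  then have "s (h i + sum h I) \<le> max (s (h i)) (s (sum h I))"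
    by (intro seminorm_ultrametric monoid_algebra.sum_mem) auto
  with insert show ?case by fastforce
qed (use assms(4) in \<open>simp add: seminorm_zero\<close>)

lemma seminorm_character_plus:
  "m \<in> cone_monoid N \<sigma> \<Longrightarrow> m' \<in> cone_monoid N \<sigma> \<Longrightarrow> s (character (m + m')) = s (character m) * s (character m')"
  by (simp add: character_plus seminorm_mult)

lemma seminorm_character_of_nat_times:
  "m \<in> cone_monoid N \<sigma> \<Longrightarrow> s (character (of_nat k * m)) = s (character m) ^ k"
  by (induction k) (auto simp: character_zero seminorm_one distrib_right
      seminorm_character_plus of_nat_times_in_cone_monoid)

lemma seminorm_character_sum:
  "(\<And>i. i \<in> I \<Longrightarrow> h i \<in> cone_monoid N \<sigma>) \<Longrightarrow> s (character (sum h I)) = (\<Prod>i\<in>I. s (character (h i)))"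
  by (induction I rule: infinite_finite_induct)
    (auto simp: character_zero seminorm_one seminorm_character_plus sum_in_cone_monoid)

text \<open>
  Monomials in finitely many characters, some of which need only become regular after
  multiplication by a character \<open>m0\<close> at which the seminorm does not vanish.
\<close>

context
  fixes n :: nat and \<gamma> :: "nat \<Rightarrow> 'v \<Rightarrow> real" and a :: "nat \<Rightarrow> int" and q :: nat and m0
  assumes m0: "m0 \<in> cone_monoid N \<sigma>" "s (character m0) > 0" and q: "q > 0"
    and \<gamma>_mem: "\<And>j. j < n \<Longrightarrow> m0 + \<gamma> j \<in> cone_monoid N \<sigma>"
    and \<gamma>_le: "\<And>j. j < n \<Longrightarrow> s (character (m0 + \<gamma> j)) \<le> s (character m0) * exp (a j / q)"
begin

abbreviation total_degree :: "(nat \<Rightarrow> nat) \<Rightarrow> nat" where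
  "total_degree \<mu> \<equiv> (\<Sum>j<n. \<mu> j)"

text \<open>Each variable in the monomial uses up one copy of \<open>m0\<close> to become some
  \<open>m0 + \<gamma> j\<close>, which is regular; the \<open>k - total_degree \<mu>\<close> copies
  left over are regular by themselves.\<close>

lemma shifted_monomial:
  assumes k: "total_degree \<mu> \<le> k"
  shows "of_nat k * m0 + monomial_exponent n \<gamma> \<mu> \<in> cone_monoid N \<sigma>"
    and "s (character (of_nat k * m0 + monomial_exponent n \<gamma> \<mu>))
      \<le> s (character m0) ^ k * exp (real_of_int (\<Sum>j<n. a j * int (\<mu> j)) / q)"
proof -
  define r where "r = k - total_degree \<mu>"
  have kr: "k = total_degree \<mu> + r" using k by (simp add: r_def)
  have eq: "of_nat k * m0 + monomial_exponent n \<gamma> \<mu> = (\<Sum>j<n. of_nat (\<mu> j) * (m0 + \<gamma> j)) + of_nat r * m0"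
    by (simp add: kr monomial_exponent_def distrib_left distrib_right sum.distrib sum_distrib_right)
  have mem: "of_nat (\<mu> j) * (m0 + \<gamma> j) \<in> cone_monoid N \<sigma>" if "j < n" for j
    using \<gamma>_mem[OF that] by (rule of_nat_times_in_cone_monoid)
  show "of_nat k * m0 + monomial_exponent n \<gamma> \<mu> \<in> cone_monoid N \<sigma>"
    unfolding eq by (intro plus_in_cone_monoid sum_in_cone_monoid mem of_nat_times_in_cone_monoid m0) auto
  have "s (character (of_nat k * m0 + monomial_exponent n \<gamma> \<mu>))
      = (\<Prod>j<n. s (character (m0 + \<gamma> j)) ^ \<mu> j) * s (character m0) ^ r"
  proof -
    have "(\<Sum>j<n. of_nat (\<mu> j) * (m0 + \<gamma> j)) \<in> cone_monoid N \<sigma>"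
      by (intro sum_in_cone_monoid mem) simp
    moreover have "s (character (\<Sum>j<n. of_nat (\<mu> j) * (m0 + \<gamma> j))) = (\<Prod>j<n. s (character (m0 + \<gamma> j)) ^ \<mu> j)"
      using mem \<gamma>_mem
      by (subst seminorm_character_sum) (auto intro!: prod.cong seminorm_character_of_nat_times)
    ultimately show ?thesis
      unfolding eq using m0
      by (simp add: seminorm_character_plus of_nat_times_in_cone_monoid seminorm_character_of_nat_times)
  qed
  also have "\<dots> \<le> (\<Prod>j<n. (s (character m0) * exp (a j / q)) ^ \<mu> j) * s (character m0) ^ r"
    using \<gamma>_le \<gamma>_mem m0 by (intro mult_right_mono prod_mono conjI power_mono zero_le_power seminorm_nonneg) auto
  also have "(\<Prod>j<n. (s (character m0) * exp (a j / q)) ^ \<mu> j)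
      = s (character m0) ^ total_degree \<mu> * exp (\<Sum>j<n. \<mu> j * (a j / q))"
    by (simp add: power_mult_distrib prod.distrib power_sum exp_sum flip: exp_of_nat_mult)
  also have "(\<Sum>j<n. \<mu> j * (a j / q)) = real_of_int (\<Sum>j<n. a j * int (\<mu> j)) / q"
    by (simp add: sum_divide_distrib mult.commute)
  finally show "s (character (of_nat k * m0 + monomial_exponent n \<gamma> \<mu>))
      \<le> s (character m0) ^ k * exp (real_of_int (\<Sum>j<n. a j * int (\<mu> j)) / q)"
    by (simp add: kr power_add mult_ac)
qed

lemma shifted_substitute:
  "character (of_nat k * m0) * substitute n \<gamma> f =
    (\<Sum>\<mu>\<in>keys f. scalar (lookup f \<mu>) * character (of_nat k * m0 + monomial_exponent n \<gamma> \<mu>))"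
  by (simp add: substitute_def monoid_algebra.eval_def sum_distrib_left character_plus mult_ac)

lemma shifted_substitute_mem:
  "(\<And>\<mu>. \<mu> \<in> keys f \<Longrightarrow> total_degree \<mu> \<le> k) \<Longrightarrow>
    character (of_nat k * m0) * substitute n \<gamma> f \<in> monoid_algebra N \<sigma>"
  unfolding shifted_substitute
  by (intro monoid_algebra.sum_mem monoid_algebra.mult_mem monoid_algebra.sc_mem)
    (simp add: shifted_monomial(1))

context
  fixes I
  assumes I_mem: "\<And>f. f \<in> I \<Longrightarrow> f \<in> monoid_algebra N \<sigma>" and I_zero: "0 \<in> I"
    and I_add: "\<And>f g. f \<in> I \<Longrightarrow> g \<in> I \<Longrightarrow> f + g \<in> I"
    and I_mult: "\<And>f g. f \<in> monoid_algebra N \<sigma> \<Longrightarrow> g \<in> I \<Longrightarrow> f * g \<in> I"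
    and sI: "\<And>f. f \<in> I \<Longrightarrow> s f = 0"
begin

lemma shift_more:
  assumes "character (of_nat k * m0) * f \<in> I"
  shows "character (of_nat (k + l) * m0) * f \<in> I"
proof -
  have "character (of_nat l * m0) * (character (of_nat k * m0) * f) \<in> I"
    using m0 by (intro I_mult[OF _ assms]) (simp add: of_nat_times_in_cone_monoid)
  then show ?thesis by (simp add: character_of_nat_add mult.assoc mult.left_commute del: of_nat_add)
qed

text \<open>For \<open>L_nonunit\<close>: if all other exponents of \<open>f\<close> had negative
  weight, then after clearing denominators the constant term would strictly dominate for the
  ultrametric \<open>s\<close>, whereas \<open>s\<close> vanishes on \<open>I\<close>. The
  comparison is strict because \<open>s (character m0) > 0\<close>.\<close>

lemma weighted_ideal_pulled_back: "weighted_ideal n a (pulled_back_ideal n \<gamma> m0 I)"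
proof
  show "keys f \<subseteq> exponents n" if "f \<in> pulled_back_ideal n \<gamma> m0 I" for f
    using that by (simp add: pulled_back_ideal_def)
  have "substitute n \<gamma> 0 = 0" by (simp add: substitute_def monoid_algebra.eval_0)
  then show "0 \<in> pulled_back_ideal n \<gamma> m0 I" using I_zero by (simp add: pulled_back_ideal_def)
next
  fix f g assume "f \<in> pulled_back_ideal n \<gamma> m0 I" "g \<in> pulled_back_ideal n \<gamma> m0 I"
  then obtain k l where k: "character (of_nat k * m0) * substitute n \<gamma> f \<in> I" "keys f \<subseteq> exponents n"
    and l: "character (of_nat l * m0) * substitute n \<gamma> g \<in> I" "keys g \<subseteq> exponents n"
    by (auto simp: pulled_back_ideal_def)
  have "character (of_nat (k + l) * m0) * substitute n \<gamma> f + character (of_nat (l + k) * m0) * substitute n \<gamma> g \<in> I"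
    by (intro I_add shift_more k l)
  then have "character (of_nat (k + l) * m0) * substitute n \<gamma> (f + g) \<in> I"
    by (simp only: substitute_add distrib_left add.commute[of l])
  then show "f + g \<in> pulled_back_ideal n \<gamma> m0 I"
    using keys_plus_subset[OF k(2) l(2)] unfolding pulled_back_ideal_def by blast
next
  fix f g :: "(nat \<Rightarrow> nat) \<Rightarrow>\<^sub>0 complex"
  assume f: "keys f \<subseteq> exponents n" and "g \<in> pulled_back_ideal n \<gamma> m0 I"
  then obtain l where l: "character (of_nat l * m0) * substitute n \<gamma> g \<in> I" "keys g \<subseteq> exponents n"
    by (auto simp: pulled_back_ideal_def)
  define k where "k = (\<Sum>\<mu>\<in>keys f. total_degree \<mu>)"
  have "character (of_nat k * m0) * substitute n \<gamma> f \<in> monoid_algebra N \<sigma>"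
    unfolding k_def by (intro shifted_substitute_mem member_le_sum[where f = total_degree]) auto
  then have "(character (of_nat k * m0) * substitute n \<gamma> f) * (character (of_nat l * m0) * substitute n \<gamma> g) \<in> I"
    using l(1) by (rule I_mult)
  then have "character (of_nat (k + l) * m0) * substitute n \<gamma> (f * g) \<in> I"
    by (simp add: substitute_mult character_of_nat_add mult.assoc mult.left_commute del: of_nat_add)
  then show "f * g \<in> pulled_back_ideal n \<gamma> m0 I"
    using keys_times_subset[OF _ f l(2)] plus_in_exponents unfolding pulled_back_ideal_def by blast
next
  fix f assume "f \<in> pulled_back_ideal n \<gamma> m0 I" and f0: "lookup f 0 \<noteq> 0"
  then obtain k0 where k0: "character (of_nat k0 * m0) * substitute n \<gamma> f \<in> I"
    by (auto simp: pulled_back_ideal_def)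
  show "\<exists>\<mu>\<in>keys f. \<mu> \<noteq> 0 \<and> 0 \<le> (\<Sum>i<n. a i * int (\<mu> i))"
  proof (rule ccontr)
    assume "\<not> ?thesis"
    then have neg: "(\<Sum>i<n. a i * int (\<mu> i)) < 0" if "\<mu> \<in> keys f - {0}" for \<mu>
      using that by force
    \<comment> \<open>The summand \<open>k0\<close> brings the product into \<open>I\<close>; the
      sum of the degrees makes every single monomial regular.\<close>
    define k where "k = k0 + (\<Sum>\<mu>\<in>keys f. total_degree \<mu>)"
    have k: "total_degree \<mu> \<le> k" if "\<mu> \<in> keys f" for \<mu>
      unfolding k_def using that by (intro trans_le_add2 member_le_sum[where f = total_degree]) auto
    define h where "h \<mu> = scalar (lookup f \<mu>) * character (of_nat k * m0 + monomial_exponent n \<gamma> \<mu>)" for \<mu>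
    have hm: "h \<mu> \<in> monoid_algebra N \<sigma>" if "\<mu> \<in> keys f" for \<mu>
      unfolding h_def using shifted_monomial(1)[OF k[OF that]]
      by (intro monoid_algebra.mult_mem monoid_algebra.sc_mem) simp
    have sh: "s (h \<mu>) = s (character (of_nat k * m0 + monomial_exponent n \<gamma> \<mu>))" if "\<mu> \<in> keys f" for \<mu>
      using shifted_monomial(1)[OF k[OF that]] that
      by (simp add: h_def seminorm_mult seminorm_scalar trivial_norm_def in_keys_iff)
    have zk: "0 \<in> keys f" using f0 by (simp add: in_keys_iff)
    let ?c = "s (character m0) ^ k"
    have c0: "?c > 0" using m0 by simp
    have "s (h 0) = ?c"
      using m0 by (simp add: sh[OF zk] monomial_exponent_zero seminorm_character_of_nat_times)
    moreover have lt: "s (sum h (keys f - {0})) < ?c"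
    proof (rule seminorm_sum_less[OF _ _ _ c0])
      fix \<mu> assume \<mu>: "\<mu> \<in> keys f - {0}"
      have "s (h \<mu>) \<le> ?c * exp (real_of_int (\<Sum>j<n. a j * int (\<mu> j)) / q)"
        using \<mu> shifted_monomial(2)[OF k, of \<mu>] sh[of \<mu>] by simp
      also have "\<dots> < ?c * 1"
      proof (rule mult_strict_left_mono[OF _ c0])
        have "real_of_int (\<Sum>j<n. a j * int (\<mu> j)) < 0" using neg[OF \<mu>] by (simp only: of_int_less_0_iff)
        then have "real_of_int (\<Sum>j<n. a j * int (\<mu> j)) / q < 0" using q by (intro divide_neg_pos) auto
        then show "exp (real_of_int (\<Sum>j<n. a j * int (\<mu> j)) / q) < 1" by (simp only: exp_less_one_iff)
      qed
      finally show "s (h \<mu>) < ?c" by simp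
    qed (use hm in auto)
    moreover have "s (h 0) \<le> max (s (sum h (keys f))) (s (sum h (keys f - {0})))"
    proof -
      let ?r = "sum h (keys f - {0})"
      have r: "?r \<in> monoid_algebra N \<sigma>" "sum h (keys f) \<in> monoid_algebra N \<sigma>"
        using hm by (auto intro!: monoid_algebra.sum_mem)
      have "s (- ?r) = s ?r"
        using seminorm_mult[OF monoid_algebra.sc_mem r(1), of "-1"]
          seminorm_scalar[of "-1"]
        by (simp add: trivial_norm_def monoid_algebra.sc_minus scalar_one)
      moreover have "h 0 = sum h (keys f) + (- ?r)"
        using zk by (simp add: sum.remove[of _ 0])
      ultimately show ?thesis
        using seminorm_ultrametric[OF r(2) monoid_algebra.minus_mem[OF r(1)]] by simp
    qed
    moreover have "s (sum h (keys f)) = 0"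
      using sI[OF shift_more[OF k0]] unfolding k_def shifted_substitute h_def by blast
    ultimately show False using c0 by simp
  qed
qed

end

end

end

section \<open>From zeros in a polydisc to points near a seminorm\<close>

context toric_fan
begin

lemma trop_open_basis:
  assumes V: "openin (trop_chart_topology N \<sigma>) V" and w: "w \<in> V"
  obtains K U where "finite K" "K \<subseteq> cone_monoid N \<sigma>" "\<And>m. m \<in> K \<Longrightarrow> open (U m)" "\<And>m. m \<in> K \<Longrightarrow> w m \<in> U m"
    "\<And>v. v \<in> trop_chart N \<sigma> \<Longrightarrow> (\<And>m. m \<in> K \<Longrightarrow> v m \<in> U m) \<Longrightarrow> v \<in> V"
proof -
  let ?S = "cone_monoid N \<sigma>"
  obtain W where W: "openin (product_topology (\<lambda>m. top_of_set {-\<infinity><..}) ?S) W" "V = W \<inter> trop_chart N \<sigma>"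
    using V by (auto simp: trop_chart_topology_def openin_subtopology)
  have "w \<in> W" using W w by blast
  have "\<forall>x\<in>W. \<exists>U. finite {m \<in> ?S. U m \<noteq> topspace (top_of_set {-\<infinity>::ereal<..})} \<and>
      (\<forall>m\<in>?S. openin (top_of_set {-\<infinity>::ereal<..}) (U m)) \<and> x \<in> Pi\<^sub>E ?S U \<and> Pi\<^sub>E ?S U \<subseteq> W"
    using W(1) unfolding openin_product_topology_alt .
  from bspec[OF this \<open>w \<in> W\<close>] obtain U where U: "finite {m \<in> ?S. U m \<noteq> topspace (top_of_set {-\<infinity>::ereal<..})}"
      "\<forall>m\<in>?S. openin (top_of_set {-\<infinity>::ereal<..}) (U m)" "w \<in> Pi\<^sub>E ?S U" "Pi\<^sub>E ?S U \<subseteq> W"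
    by (elim exE conjE)
  define K where "K = {m \<in> ?S. U m \<noteq> {-\<infinity>::ereal<..}}"
  show ?thesis
  proof (rule that[of K U])
    show "finite K" "K \<subseteq> ?S" using U(1) by (auto simp: K_def)
    show "open (U m)" if "m \<in> K" for m
      using U(2) that by (auto simp: K_def openin_open_eq)
    show "w m \<in> U m" if "m \<in> K" for m using U(3) that by (auto simp: K_def)
    fix v assume v: "v \<in> trop_chart N \<sigma>" "\<And>m. m \<in> K \<Longrightarrow> v m \<in> U m"
    have "v \<in> Pi\<^sub>E ?S U"
    proof (rule PiE_I)
      show "v m \<in> U m" if "m \<in> ?S" for m
        using that v(2)[of m] trop_chart_gt[OF v(1) that] by (cases "m \<in> K") (auto simp: K_def)
      show "v m = undefined" if "m \<notin> ?S" for m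
        using trop_chart_extensional[OF v(1)] that by (simp add: extensional_def)
    qed
    then show "v \<in> V" using U(4) W(2) v(1) by blast
  qed
qed

text \<open>One small parameter describes neighbourhoods of finite and infinite values alike, so
  that the finitely many coordinates of a basic open set can share it.\<close>

lemma ereal_nbhd:
  assumes "open U" "w \<in> U" "w > -\<infinity>"
  shows "eventually (\<lambda>\<epsilon>. \<forall>y. (if w = \<infinity> then ereal (1 / \<epsilon>) < y else w - ereal \<epsilon> < y \<and> y < w + ereal \<epsilon>) \<longrightarrow> y \<in> U) (at_right 0)"
proof (cases w)
  case (real r)
  obtain b c where bc: "b < ereal r" "ereal r < c" "{b<..<c} \<subseteq> U"
    using ereal_open_cont_interval2[OF assms(1), of "ereal r"] assms(2) real by auto
  have "((\<lambda>\<epsilon>. ereal (r - \<epsilon>)) \<longlongrightarrow> ereal (r - 0)) (at_right 0)" "((\<lambda>\<epsilon>. ereal (r + \<epsilon>)) \<longlongrightarrow> ereal (r + 0)) (at_right 0)"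
    by (intro tendsto_ereal tendsto_intros)+
  then have "eventually (\<lambda>\<epsilon>. b < ereal (r - \<epsilon>)) (at_right 0)" "eventually (\<lambda>\<epsilon>. ereal (r + \<epsilon>) < c) (at_right 0)"
    using bc by (auto intro: order_tendstoD)
  then show ?thesis
  proof eventually_elim
    case (elim \<epsilon>)
    show ?case
    proof (intro allI impI)
      fix y assume "if w = \<infinity> then ereal (1 / \<epsilon>) < y else w - ereal \<epsilon> < y \<and> y < w + ereal \<epsilon>"
      then have "ereal (r - \<epsilon>) < y" "y < ereal (r + \<epsilon>)" using real by auto
      then have "b < y" "y < c" using elim by (auto intro: less_trans)
      then show "y \<in> U" using bc(3) by auto
    qed
  qed
next
  case PInf
  then obtain b where b: "{ereal b<..} \<subseteq> U" using open_PInfty[OF assms(1)] assms(2) by auto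
  have "eventually (\<lambda>\<epsilon>. 0 < \<epsilon> \<and> \<epsilon> < 1 / (\<bar>b\<bar> + 1)) (at_right (0::real))"
    by (auto simp: eventually_at_right_field intro!: exI[of _ "1 / (\<bar>b\<bar> + 1)"])
  then show ?thesis
  proof eventually_elim
    case (elim \<epsilon>)
    have "b < 1 / \<epsilon>"
    proof -
      have "\<epsilon> * (\<bar>b\<bar> + 1) < 1" using elim by (simp add: field_simps)
      then have "\<bar>b\<bar> + 1 < 1 / \<epsilon>" using elim by (simp add: field_simps)
      then show ?thesis by linarith
    qed
    then show ?case using b PInf
      by (auto intro!: subsetD[OF b] intro: less_trans[of "ereal b" "ereal (1 / \<epsilon>)"])
  qed
qed (use assms in auto)

text \<open>Zeros are sought in a polynomial ring with \<open>2 * n\<close> variables: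
  \<open>n\<close> for chosen characters and \<open>n\<close> for their inverses. Relations among
  the characters need not be listed, as they belong to the pulled back ideal.\<close>

lemma seminorm_is_limit:
  assumes \<sigma>: "\<sigma> \<in> \<Sigma>" and F: "F \<subseteq> monoid_algebra N \<sigma>" "X = {x \<in> affine_points N \<sigma>. \<forall>f\<in>F. x f = 0}"
    and s: "mult_seminorm N \<sigma> s" "\<And>f. f \<in> monoid_algebra N \<sigma> \<Longrightarrow> (\<And>x. x \<in> X \<Longrightarrow> x f = 0) \<Longrightarrow> s f = 0"
    and V: "openin (trop_chart_topology N \<sigma>) V" "trop_of \<sigma> s \<in> V"
  shows "\<exists>\<rho>0>0. \<forall>\<rho>. 0 < \<rho> \<and> \<rho> < \<rho>0 \<longrightarrow> (\<exists>x\<in>X. chart_scale \<rho> \<sigma> (trop_of \<sigma> (\<lambda>f. cmod (x f))) \<in> V)"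
proof -
  let ?S = "cone_monoid N \<sigma>" and ?A = "monoid_algebra N \<sigma>"
  define w where "w = trop_of \<sigma> s"
  have w: "w \<in> trop_chart N \<sigma>" unfolding w_def by (rule trop_of_seminorm_in_chart[OF s(1)])
  obtain K U where K: "finite K" "K \<subseteq> ?S" and U: "\<And>m. m \<in> K \<Longrightarrow> open (U m)" "\<And>m. m \<in> K \<Longrightarrow> w m \<in> U m"
    and KV: "\<And>v. v \<in> trop_chart N \<sigma> \<Longrightarrow> (\<And>m. m \<in> K \<Longrightarrow> v m \<in> U m) \<Longrightarrow> v \<in> V"
    using trop_open_basis[OF V(1), of w] V(2) unfolding w_def by metis
  have "eventually (\<lambda>\<epsilon>. \<forall>m\<in>K. \<forall>y. (if w m = \<infinity> then ereal (1 / \<epsilon>) < y else w m - ereal \<epsilon> < y \<and> y < w m + ereal \<epsilon>) \<longrightarrow> y \<in> U m) (at_right 0)"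
  proof (rule eventually_ball_finite[OF K(1)], intro ballI)
    fix m assume m: "m \<in> K"
    then have "w m > -\<infinity>" using K(2) trop_chart_gt[OF w] by blast
    then show "eventually (\<lambda>\<epsilon>. \<forall>y. (if w m = \<infinity> then ereal (1 / \<epsilon>) < y else w m - ereal \<epsilon> < y \<and> y < w m + ereal \<epsilon>) \<longrightarrow> y \<in> U m) (at_right 0)"
      by (rule ereal_nbhd[OF U[OF m]])
  qed
  moreover have "eventually (\<lambda>\<epsilon>. 0 < \<epsilon> \<and> \<epsilon> < 1) (at_right (0::real))"
    by (auto simp: eventually_at_right_field intro: exI[of _ 1])
  ultimately have "eventually (\<lambda>\<epsilon>. (\<forall>m\<in>K. \<forall>y. (if w m = \<infinity> then ereal (1 / \<epsilon>) < y else w m - ereal \<epsilon> < y \<and> y < w m + ereal \<epsilon>) \<longrightarrow> y \<in> U m)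
      \<and> 0 < \<epsilon> \<and> \<epsilon> < 1) (at_right 0)"
    by (rule eventually_conj)
  from eventually_happens[OF this] obtain \<epsilon> where \<epsilon>: "0 < \<epsilon>" "\<epsilon> < 1"
    and \<epsilon>U: "\<And>m y. m \<in> K \<Longrightarrow> (if w m = \<infinity> then ereal (1 / \<epsilon>) < y else w m - ereal \<epsilon> < y \<and> y < w m + ereal \<epsilon>) \<Longrightarrow> y \<in> U m"
    by auto
  obtain G where G: "G \<subseteq> ?S" "finite G" "\<And>m. m \<in> ?S \<Longrightarrow> \<exists>c. m = (\<Sum>g\<in>G. of_nat (c g) * g)"
    using gordan[OF lattice cone_polyhedral[OF \<sigma>]] by blast
  \<comment> \<open>\<open>G\<close> generates the monoid, so the variables determine a point of the
    chart; \<open>K\<close> contains the coordinates to be controlled, so each of them is a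
    variable.\<close>
  define n where "n = card (G \<union> K)"
  obtain g where g: "bij_betw g {..<n} (G \<union> K)"
    using ex_bij_betw_nat_finite[of "G \<union> K"] G(2) K(1) by (auto simp: n_def atLeast0LessThan)
  have gS: "g i \<in> ?S" if "i < n" for i
    using bij_betwE[OF g] that G(1) K(2) by auto
  define t where "t i = s (character (g i))" for i
  have t0: "0 \<le> t i" if "i < n" for i
    using seminorm_nonneg[OF s(1)] gS[OF that] by (simp add: t_def)
  obtain q :: nat where q: "2 / \<epsilon> < q" using reals_Archimedean2 by blast
  have q0: "q > 0" using q \<epsilon> by (metis divide_pos_pos less_trans of_nat_0_less_iff zero_less_numeral)
  have q1: "1 / q < \<epsilon> / 2" using q q0 \<epsilon> by (simp add: field_simps)
  define M where "M = 2 * n"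
  \<comment> \<open>The second half holds the inverses of the characters with non-zero norm. For the
    others the slot is filled with the trivial character and weight 0.\<close>
  define \<gamma> where "\<gamma> j = (if j < n then g j else if t (j - n) \<noteq> 0 then - g (j - n) else 0)" for j
  \<comment> \<open>Rounding up makes \<open>exp (a j / q)\<close> an upper bound for the norm.
    Where the norm is 0, the choice gives \<open>a j / q \<le> - (1 / \<epsilon> + 1)\<close>, which
    leaves the coordinate beyond \<open>1 / \<epsilon>\<close> after an error of
    \<open>\<epsilon> / 2\<close>.\<close>
  define a where "a j = (if j < n then if t j \<noteq> 0 then \<lceil>q * ln (t j)\<rceil> else - \<lceil>q * (1 / \<epsilon> + 1)\<rceil>
    else if t (j - n) \<noteq> 0 then \<lceil>- q * ln (t (j - n))\<rceil> else 0)" for j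
  define J where "J = {i. i < n \<and> t i \<noteq> 0}"
  \<comment> \<open>The sum of all characters to be inverted: adding \<open>- g i\<close> just drops
    one summand, so the result stays regular.\<close>
  define m0 where "m0 = (\<Sum>i\<in>J. g i)"
  have Jfin: "finite J" by (simp add: J_def)
  have m0: "m0 \<in> ?S" unfolding m0_def by (intro sum_in_cone_monoid gS) (auto simp: J_def)
  have sm0: "s (character m0) = (\<Prod>i\<in>J. t i)"
    unfolding m0_def t_def by (rule seminorm_character_sum[OF s(1)]) (auto simp: J_def gS)
  have sm0_pos: "s (character m0) > 0"
    unfolding sm0 by (intro prod_pos) (use t0 in \<open>auto simp: J_def less_le\<close>)
  have \<gamma>_both: "m0 + \<gamma> j \<in> ?S \<and> s (character (m0 + \<gamma> j)) \<le> s (character m0) * exp (a j / q)" if j: "j < M" for j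
  proof (cases "j < n")
    case True
    have le: "t j \<le> exp (a j / q)"
    proof (cases "t j = 0")
      case False
      then have "t j > 0" using t0[OF True] by simp
      have "ln (t j) \<le> a j / q" using q0 True False by (simp add: a_def field_simps)
      then have "exp (ln (t j)) \<le> exp (a j / q)" by simp
      then show ?thesis using \<open>t j > 0\<close> by simp
    qed simp
    have "s (character (m0 + g j)) = s (character m0) * t j"
      using m0 gS[OF True] by (simp add: seminorm_character_plus[OF s(1)] t_def)
    then show ?thesis
      using True le sm0_pos m0 gS[OF True] by (auto simp: \<gamma>_def plus_in_cone_monoid)
  next
    case False
    define i where "i = j - n"
    have i: "i < n" using j False by (simp add: i_def M_def)
    show ?thesis
    proof (cases "t i = 0")
      case True
      then show ?thesis using False m0 by (simp add: \<gamma>_def a_def i_def)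
    next
      case nz: False
      then have tp: "t i > 0" using t0[OF i] by simp
      have iJ: "i \<in> J" using i nz by (simp add: J_def)
      have eq: "m0 + \<gamma> j = (\<Sum>i\<in>J - {i}. g i)"
        using False nz iJ Jfin by (simp add: \<gamma>_def i_def m0_def sum.remove)
      have mem: "(\<Sum>i\<in>J - {i}. g i) \<in> ?S" by (intro sum_in_cone_monoid gS) (auto simp: J_def)
      have "s (character m0) = t i * s (character (m0 + \<gamma> j))"
        unfolding sm0 eq using iJ Jfin
        by (subst seminorm_character_sum[OF s(1)]) (auto simp: J_def gS prod.remove t_def)
      then have "s (character (m0 + \<gamma> j)) = s (character m0) * inverse (t i)" using tp by simp
      also have "inverse (t i) = exp (- ln (t i))" using tp by (simp add: exp_minus)
      also have "\<dots> \<le> exp (a j / q)"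
      proof -
        have "- ln (t i) \<le> a j / q" using q0 False nz by (simp add: a_def i_def[symmetric] field_simps)
        then show ?thesis by simp
      qed
      finally show ?thesis using eq mem sm0_pos by simp
    qed
  qed
  define I where "I = {f \<in> ?A. \<forall>x\<in>X. x f = 0}"
  have XA: "x \<in> affine_points N \<sigma>" if "x \<in> X" for x using that F(2) by simp
  have x0: "x 0 = 0" if "x \<in> X" for x
    using affine_point_scalar[OF XA[OF that], of 0] by (simp add: scalar_def)
  define L where "L = pulled_back_ideal M \<gamma> m0 I"
  have "weighted_ideal M a L"
    unfolding L_def
  proof (rule weighted_ideal_pulled_back[OF s(1) m0 sm0_pos q0])
    show "m0 + \<gamma> j \<in> ?S" "s (character (m0 + \<gamma> j)) \<le> s (character m0) * exp (a j / q)" if "j < M" for j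
      using \<gamma>_both[OF that] by auto
    show "f \<in> ?A" if "f \<in> I" for f using that by (simp add: I_def)
    show "0 \<in> I" by (simp add: I_def x0 monoid_algebra.zero_mem)
    show "f + g \<in> I" if "f \<in> I" "g \<in> I" for f g
      using that XA by (auto simp: I_def monoid_algebra.add_mem affine_point_add[where N = N and \<sigma> = \<sigma>])
    show "f * g \<in> I" if "f \<in> ?A" "g \<in> I" for f g
      using that XA by (auto simp: I_def monoid_algebra.mult_mem affine_point_mult[where N = N and \<sigma> = \<sigma>])
    show "s f = 0" if "f \<in> I" for f using that by (auto simp: I_def intro: s(2))
  qed
  then obtain C \<rho>1 where C: "C > 0" and \<rho>1: "\<rho>1 > 0" and zeros: "\<And>\<rho>. 0 < \<rho> \<Longrightarrow> \<rho> < \<rho>1 \<Longrightarrow>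
      \<exists>z. (\<forall>f\<in>L. cplx.eval (\<lambda>\<mu>. \<Prod>i<M. z i ^ \<mu> i) f = 0) \<and> (\<forall>j<M. cmod (z j) \<le> C * exp (a j / \<rho>))"
    using weighted_ideal.ex_zero_in_polydisc[of M a L] by blast
  \<comment> \<open>Zeros are taken at the parameter \<open>q * \<rho>\<close>, whence
    \<open>\<rho>1 / q\<close>; the other bound makes the contribution \<open>\<rho> * ln C\<close>
    of the constant smaller than \<open>\<epsilon> / 2\<close>.\<close>
  define \<rho>0 where "\<rho>0 = min (\<rho>1 / q) (\<epsilon> / (2 * (\<bar>ln C\<bar> + 1)))"
  have \<rho>0: "\<rho>0 > 0" using \<rho>1 q0 \<epsilon> by (auto simp: \<rho>0_def intro!: divide_pos_pos add_nonneg_pos)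
  define unit :: "nat \<Rightarrow> nat \<Rightarrow> nat" where "unit j = (\<lambda>i. if i = j then 1 else 0)" for j
  let ?e = "monomial_exponent M \<gamma>"
  have unit_mem: "unit j \<in> exponents M" if "j < M" for j using that by (auto simp: unit_def exponents_def)
  have e_unit: "?e (unit j) = \<gamma> j" if "j < M" for j
  proof -
    have "?e (unit j) = (\<Sum>i<M. if i = j then \<gamma> j else 0)"
      unfolding monomial_exponent_def by (intro sum.cong) (auto simp: unit_def)
    with that show ?thesis by simp
  qed
  have rep: "\<exists>\<mu>\<in>exponents M. ?e \<mu> = m" if m: "m \<in> ?S" for m
  proof -
    obtain c where c: "m = (\<Sum>g\<in>G. of_nat (c g) * g)" using G(3)[OF m] by blast
    define \<mu> where "\<mu> i = (if i < n \<and> g i \<in> G then c (g i) else 0)" for i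
    have "?e \<mu> = (\<Sum>j<n. of_nat (\<mu> j) * \<gamma> j)"
      unfolding monomial_exponent_def by (rule sum.mono_neutral_right) (auto simp: M_def \<mu>_def)
    also have "\<dots> = (\<Sum>j<n. (\<lambda>x. if x \<in> G then of_nat (c x) * x else 0) (g j))"
      by (intro sum.cong) (auto simp: \<mu>_def \<gamma>_def)
    also have "\<dots> = (\<Sum>x\<in>G \<union> K. if x \<in> G then of_nat (c x) * x else 0)"
      using g by (rule sum.reindex_bij_betw)
    also have "\<dots> = m" unfolding c using G(2) K(1) by (intro sum.mono_neutral_cong_right) auto
    finally show ?thesis by (intro bexI[of _ \<mu>]) (auto simp: exponents_def \<mu>_def M_def)
  qed
  then obtain r where r: "\<And>m. m \<in> ?S \<Longrightarrow> r m \<in> exponents M" "\<And>m. m \<in> ?S \<Longrightarrow> ?e (r m) = m" by metis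
  have LI: "f \<in> L" if "keys f \<subseteq> exponents M" "substitute M \<gamma> f \<in> I" for f
    unfolding L_def pulled_back_ideal_def using that by (auto simp: character_zero intro!: exI[of _ 0])
  show ?thesis
  proof (intro exI[of _ \<rho>0] conjI allI impI \<rho>0)
    fix \<rho> assume "0 < \<rho> \<and> \<rho> < \<rho>0"
    then have \<rho>: "0 < \<rho>" "q * \<rho> < \<rho>1" "\<rho> * (2 * (\<bar>ln C\<bar> + 1)) < \<epsilon>"
      using q0 by (auto simp: \<rho>0_def field_simps)
    obtain z where z: "\<And>f. f \<in> L \<Longrightarrow> cplx.eval (\<lambda>\<mu>. \<Prod>i<M. z i ^ \<mu> i) f = 0"
        "\<And>j. j < M \<Longrightarrow> cmod (z j) \<le> C * exp (a j / (q * \<rho>))"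
      using zeros[of "q * \<rho>"] \<rho> q0 by auto
    define Z where "Z \<mu> = (\<Prod>i<M. z i ^ \<mu> i)" for \<mu>
    have Z_plus: "Z (\<mu> + \<nu>) = Z \<mu> * Z \<nu>" for \<mu> \<nu>
      by (simp add: Z_def plus_fun_apply power_add prod.distrib)
    have Z_zero: "Z 0 = 1" by (simp add: Z_def zero_fun_apply)
    have Z_unit: "Z (unit j) = z j" if "j < M" for j
    proof -
      have "Z (unit j) = (\<Prod>i<M. if i = j then z j else 1)"
        unfolding Z_def by (intro prod.cong) (auto simp: unit_def)
      with that show ?thesis by simp
    qed
    \<comment> \<open>If two monomials have the same character, their difference is mapped to 0 and
      so lies in \<open>L\<close>. Hence the value of a monomial at the zero \<open>z\<close>
      depends only on its character.\<close>
    have Z_eq: "Z \<mu> = Z \<nu>" if "\<mu> \<in> exponents M" "\<nu> \<in> exponents M" "?e \<mu> = ?e \<nu>" for \<mu> \<nu>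
    proof -
      let ?f = "single \<mu> 1 + single \<nu> (- 1) :: _ \<Rightarrow>\<^sub>0 complex"
      have "substitute M \<gamma> ?f = 0"
        by (simp add: substitute_add substitute_single that(3) monoid_algebra.sc_minus scalar_one)
      moreover have "keys ?f \<subseteq> exponents M"
        using that by (intro keys_plus_subset) auto
      ultimately have "?f \<in> L" using x0 by (intro LI) (auto simp: I_def monoid_algebra.zero_mem)
      from z(1)[OF this] show ?thesis by (simp add: cplx.eval_add cplx.eval_single Z_def)
    qed
    define \<psi> where "\<psi> m = Z (r m)" for m
    have \<psi>: "\<psi> m = Z \<mu>" if "\<mu> \<in> exponents M" "?e \<mu> = m" "m \<in> ?S" for m \<mu>
      unfolding \<psi>_def using that r by (intro Z_eq) auto
    have \<psi>_zero: "\<psi> 0 = 1"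
      using \<psi>[of 0 0] by (simp add: monomial_exponent_zero zero_in_cone_monoid Z_zero)
    have \<psi>_plus: "\<psi> (m + m') = \<psi> m * \<psi> m'" if "m \<in> ?S" "m' \<in> ?S" for m m'
      using \<psi>[of "r m + r m'" "m + m'"] that r
      by (simp add: monomial_exponent_plus plus_in_cone_monoid Z_plus) (simp add: \<psi>_def)
    define x where "x = restrict (cplx.eval \<psi>) ?A"
    have xA: "x \<in> affine_points N \<sigma>"
      unfolding x_def by (rule affine_point_of_characters(1)) (auto simp: \<psi>_zero \<psi>_plus)
    have xc: "x (character m) = \<psi> m" if "m \<in> ?S" for m
      unfolding x_def by (rule affine_point_of_characters(2)) (auto simp: \<psi>_zero \<psi>_plus that)
    have "x f = 0" if f: "f \<in> F" for f
    proof -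
      have fA: "f \<in> ?A" using f F(1) by blast
      then have kS: "k \<in> ?S" if "k \<in> keys f" for k using that by (auto simp: monoid_algebra_def)
      have fI: "f \<in> I" using fA f F(2) by (simp add: I_def)
      \<comment> \<open>A polynomial in the variables lifting \<open>f\<close>; it lies in
        \<open>L\<close>, and its value at \<open>z\<close> is that of \<open>f\<close> at
        \<open>x\<close>.\<close>
      define f' where "f' = (\<Sum>k\<in>keys f. single (r k) (lookup f k))"
      have "substitute M \<gamma> f' = (\<Sum>k\<in>keys f. scalar (lookup f k) * character k)"
        unfolding f'_def substitute_def monoid_algebra.eval_sum monoid_algebra.eval_single
        using r(2) kS by (intro sum.cong) auto
      also have "\<dots> = f"
        by (simp add: scalar_def character_def mult_single flip: poly_mapping_eq_sum_single)
      finally have sub: "substitute M \<gamma> f' = f" .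
      have "keys f' \<subseteq> exponents M"
        unfolding f'_def using r(1) kS by (intro order_trans[OF keys_sum]) (auto split: if_splits)
      then have "f' \<in> L" using sub fI by (intro LI) auto
      from z(1)[OF this] have "0 = (\<Sum>k\<in>keys f. lookup f k * Z (r k))"
        unfolding f'_def cplx.eval_sum cplx.eval_single by (simp add: Z_def)
      also have "\<dots> = cplx.eval \<psi> f" by (simp add: cplx.eval_def \<psi>_def)
      finally show ?thesis using fA by (simp add: x_def)
    qed
    then have "x \<in> X" using xA F(2) by simp
    moreover have "chart_scale \<rho> \<sigma> (trop_of \<sigma> (\<lambda>f. cmod (x f))) \<in> V"
    proof (rule KV)
      show "chart_scale \<rho> \<sigma> (trop_of \<sigma> (\<lambda>f. cmod (x f))) \<in> trop_chart N \<sigma>"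
        by (rule chart_scale_in_chart[OF \<rho>(1) trop_of_point_in_chart[OF xA]])
      fix m assume m: "m \<in> K"
      then have mS: "m \<in> ?S" using K by blast
      have "m \<in> g ` {..<n}" using g m by (simp add: bij_betw_def)
      then obtain i where i: "i < n" "g i = m" by auto
      have iM: "i < M" "n + i < M" using i by (auto simp: M_def)
      have gi: "\<gamma> i = m" using i by (simp add: \<gamma>_def)
      have xz: "x (character m) = z i"
        using xc[OF mS] \<psi>[OF unit_mem[OF iM(1)] _ mS] e_unit[OF iM(1)] Z_unit[OF iM(1)] gi by simp
      define y where "y = ereal \<rho> * neg_log (cmod (z i))"
      have upper: "\<rho> * ln (cmod (z j)) \<le> \<rho> * ln C + a j / q" if j: "j < M" and nz: "z j \<noteq> 0" for j
      proof -
        have "ln (cmod (z j)) \<le> ln (C * exp (a j / (q * \<rho>)))"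
          using z(2)[OF j] nz C by (subst ln_le_cancel_iff) (auto intro!: mult_pos_pos)
        also have "\<dots> = ln C + a j / (q * \<rho>)" using C by (simp add: ln_mult)
        finally have "\<rho> * ln (cmod (z j)) \<le> \<rho> * (ln C + a j / (q * \<rho>))" using \<rho> by (intro mult_left_mono) auto
        then show ?thesis using \<rho> by (simp add: field_simps)
      qed
      have \<rho>C: "\<bar>\<rho> * ln C\<bar> < \<epsilon> / 2"
      proof -
        have "\<bar>\<rho> * ln C\<bar> = \<rho> * \<bar>ln C\<bar>" using \<rho> by (simp add: abs_mult)
        then show ?thesis using \<rho> by (simp add: algebra_simps)
      qed
      have wm: "w m = neg_log (t i)" using mS i by (simp add: w_def trop_of_def t_def)
      have "y \<in> U m"
      proof (rule \<epsilon>U[OF m])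
        show "if w m = \<infinity> then ereal (1 / \<epsilon>) < y else w m - ereal \<epsilon> < y \<and> y < w m + ereal \<epsilon>"
        proof (cases "t i = 0")
          case True
          have "ereal (1 / \<epsilon>) < y"
          proof (cases "z i = 0")
            case False
            have "- (\<rho> * ln (cmod (z i))) \<ge> - (\<rho> * ln C) - a i / q" using upper[OF iM(1) False] by simp
            moreover have "a i / q \<le> - (1 / \<epsilon> + 1)"
            proof -
              have "real_of_int (a i) \<le> - (q * (1 / \<epsilon> + 1))" using True i by (simp add: a_def)
              then show ?thesis using q0 by (simp add: field_simps)
            qed
            ultimately have "1 / \<epsilon> < - (\<rho> * ln (cmod (z i)))" using \<rho>C \<epsilon> by linarith
            then show ?thesis using False by (simp add: y_def neg_log_def)
          qed (use \<rho> in \<open>simp add: y_def neg_log_def\<close>)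
          with True show ?thesis by (simp add: wm neg_log_def)
        next
          case False
          have e0: "?e (unit i + unit (n + i)) = 0"
            using False i by (simp add: monomial_exponent_plus e_unit iM gi) (simp add: \<gamma>_def t_def)
          \<comment> \<open>The product of a variable and its inverse has the trivial character, so
            its value is 1; the upper bound for \<open>z (n + i)\<close> thus becomes a lower bound
            for \<open>z i\<close>.\<close>
          have "z i * z (n + i) = Z (unit i + unit (n + i))" by (simp add: Z_plus Z_unit iM)
          also have "\<dots> = Z 0" using e0 by (intro Z_eq plus_in_exponents unit_mem iM zero_in_exponents) (simp add: monomial_exponent_zero)
          finally have zz: "z i * z (n + i) = 1" by (simp add: Z_zero)
          then have nz: "z i \<noteq> 0" "z (n + i) \<noteq> 0" by auto
          have "ln (cmod (z i)) + ln (cmod (z (n + i))) = ln (cmod (z i * z (n + i)))"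
            using nz by (simp add: norm_mult ln_mult)
          then have neg: "ln (cmod (z (n + i))) = - ln (cmod (z i))" using zz by simp
          have u1: "\<rho> * ln (cmod (z i)) \<le> \<rho> * ln C + a i / q" by (rule upper[OF iM(1) nz(1)])
          have u2: "- (\<rho> * ln (cmod (z i))) \<le> \<rho> * ln C + a (n + i) / q"
            using upper[OF iM(2) nz(2)] by (simp add: neg)
          have "real_of_int (a i) < q * ln (t i) + 1" "real_of_int (a (n + i)) < - q * ln (t i) + 1"
            using False i by (simp_all add: a_def) linarith+
          then have "a i / q < ln (t i) + 1 / q" "a (n + i) / q < - ln (t i) + 1 / q"
            using q0 by (simp_all add: field_simps)
          with u1 u2 \<rho>C q1 have "- ln (t i) - \<epsilon> < - (\<rho> * ln (cmod (z i)))" "- (\<rho> * ln (cmod (z i))) < - ln (t i) + \<epsilon>"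
            by linarith+
          then show ?thesis using False nz by (simp add: wm y_def neg_log_def)
        qed
      qed
      then show "chart_scale \<rho> \<sigma> (trop_of \<sigma> (\<lambda>f. cmod (x f))) m \<in> U m"
        using mS by (simp add: chart_scale_def trop_of_def xz y_def)
    qed
    ultimately show "\<exists>x\<in>X. chart_scale \<rho> \<sigma> (trop_of \<sigma> (\<lambda>f. cmod (x f))) \<in> V" by blast
  qed
qed

end

subsection \<open>The limit of the rescaled amoebas\<close>

context toric_fan
begin

lemma chart_part_affine: "chart_part N \<Sigma> X \<sigma> \<subseteq> affine_points N \<sigma>"
  by (auto simp: chart_part_def)

lemma amoeba_alt:
  "amoeba N \<Sigma> X = {trop_class N \<Sigma> \<sigma> (trop_of \<sigma> (\<lambda>f. cmod (x f))) | \<sigma> x. \<sigma> \<in> \<Sigma> \<and> x \<in> chart_part N \<Sigma> X \<sigma>}"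
  by (simp add: amoeba_def trop_of_def)

lemma scaled_amoeba:
  assumes "\<rho> > 0"
  shows "trop_scale N \<rho> ` amoeba N \<Sigma> X =
    {trop_class N \<Sigma> \<sigma> (chart_scale \<rho> \<sigma> (trop_of \<sigma> (\<lambda>f. cmod (x f)))) | \<sigma> x. \<sigma> \<in> \<Sigma> \<and> x \<in> chart_part N \<Sigma> X \<sigma>}"
proof -
  have "trop_scale N \<rho> (trop_class N \<Sigma> \<sigma> (trop_of \<sigma> (\<lambda>f. cmod (x f)))) =
      trop_class N \<Sigma> \<sigma> (chart_scale \<rho> \<sigma> (trop_of \<sigma> (\<lambda>f. cmod (x f))))"
    if "\<sigma> \<in> \<Sigma>" "x \<in> chart_part N \<Sigma> X \<sigma>" for \<sigma> x
    using that chart_part_affine by (intro trop_scale_class assms trop_of_point_in_chart) auto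
  then show ?thesis unfolding amoeba_alt by (auto simp: image_iff) metis+
qed

text \<open>A point of the rescaled amoeba may come from another chart. Its value at the character
  \<open>u\<close> cutting out the common face is finite, so that character does not vanish at the
  complex point, which therefore lies in the chart of the common face and can be moved to
  \<open>\<sigma>\<close>.\<close>

lemma scaled_amoeba_chart:
  assumes \<rho>: "\<rho> > 0" and \<sigma>: "\<sigma> \<in> \<Sigma>" and w: "w \<in> trop_chart N \<sigma>"
    and in_amoeba: "trop_class N \<Sigma> \<sigma> w \<in> trop_scale N \<rho> ` amoeba N \<Sigma> X"
  obtains x where "x \<in> chart_part N \<Sigma> X \<sigma>" "w = chart_scale \<rho> \<sigma> (trop_of \<sigma> (\<lambda>f. cmod (x f)))"
proof -
  obtain \<sigma>' x' where \<sigma>': "\<sigma>' \<in> \<Sigma>" and x': "x' \<in> chart_part N \<Sigma> X \<sigma>'"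
    and eq: "trop_class N \<Sigma> \<sigma> w = trop_class N \<Sigma> \<sigma>' (chart_scale \<rho> \<sigma>' (trop_of \<sigma>' (\<lambda>f. cmod (x' f))))"
    using in_amoeba unfolding scaled_amoeba[OF \<rho>] by blast
  let ?\<tau> = "\<sigma> \<inter> \<sigma>'"
  have \<tau>: "?\<tau> \<in> \<Sigma>" by (rule Int_in_fan[OF \<sigma> \<sigma>'])
  obtain y where y: "y \<in> trop_chart N ?\<tau>" "restrict y (cone_monoid N \<sigma>) = w"
      "restrict y (cone_monoid N \<sigma>') = chart_scale \<rho> \<sigma>' (trop_of \<sigma>' (\<lambda>f. cmod (x' f)))"
    using trop_class_eqD[OF eq \<sigma> w] by blast
  obtain u where u: "u \<in> cone_monoid N \<sigma>'" "face_by N ?\<tau> \<sigma>' u"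
    by (rule ex_face_by[OF \<sigma>' face_Int'[OF \<sigma> \<sigma>']])
  obtain r where r: "y u = ereal r" by (rule trop_chart_face_finite[OF u(2) y(1)])
  have "y u = ereal \<rho> * neg_log (cmod (x' (character u)))"
    using fun_cong[OF y(3), of u] u(1) by (simp add: chart_scale_def trop_of_def)
  then have nz: "x' (character u) \<noteq> 0" using r \<rho> by (auto simp: neg_log_def)
  have x'A: "x' \<in> affine_points N \<sigma>'" using x' chart_part_affine by blast
  obtain z where z: "z \<in> affine_points N ?\<tau>" "restrict z (monoid_algebra N \<sigma>') = x'"
    by (rule affine_point_extend[OF u(2) x'A nz])
  define x where "x = restrict z (monoid_algebra N \<sigma>)"
  have xA: "x \<in> affine_points N \<sigma>" unfolding x_def by (rule affine_point_restrict[OF _ z(1)]) auto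
  have "toric_class N \<Sigma> \<sigma> x = toric_class N \<Sigma> ?\<tau> z"
    unfolding x_def by (rule toric_class_restrict[OF \<tau> \<sigma> face_Int[OF \<sigma> \<sigma>'] z(1)])
  also have "\<dots> = toric_class N \<Sigma> \<sigma>' x'"
    unfolding z(2)[symmetric] by (rule toric_class_restrict[OF \<tau> \<sigma>' face_Int'[OF \<sigma> \<sigma>'] z(1), symmetric])
  finally have xX: "x \<in> chart_part N \<Sigma> X \<sigma>" using x' xA by (simp add: chart_part_def)
  have sub: "cone_monoid N \<sigma> \<subseteq> cone_monoid N ?\<tau>" "cone_monoid N \<sigma>' \<subseteq> cone_monoid N ?\<tau>"
    by (auto intro!: cone_monoid_antimono)
  let ?y = "chart_scale \<rho> ?\<tau> (trop_of ?\<tau> (\<lambda>f. cmod (z f)))"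
  have "y = ?y"
  proof (rule trop_chart_face_unique[OF u(2) y(1)])
    show "?y \<in> trop_chart N ?\<tau>" by (intro chart_scale_in_chart \<rho> trop_of_point_in_chart z(1))
    show "restrict y (cone_monoid N \<sigma>') = restrict ?y (cone_monoid N \<sigma>')"
      unfolding y(3) z(2)[symmetric] using sub(2)
      by (auto simp: chart_scale_def trop_of_def fun_eq_iff restrict_def)
  qed
  then have "w = restrict ?y (cone_monoid N \<sigma>)" using y(2) by simp
  also have "\<dots> = chart_scale \<rho> \<sigma> (trop_of \<sigma> (\<lambda>f. cmod (x f)))"
    unfolding x_def using sub(1) by (auto simp: chart_scale_def trop_of_def fun_eq_iff restrict_def)
  finally show ?thesis by (rule that[OF xX])
qed

lemma tropicalization_alt:
  "tropicalization N \<Sigma> X = {trop_class N \<Sigma> \<sigma> (trop_of \<sigma> s) | \<sigma> s.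
    \<sigma> \<in> \<Sigma> \<and> mult_seminorm N \<sigma> s \<and> (\<forall>f\<in>chart_ideal N \<Sigma> X \<sigma>. s f = 0)}"
  by (simp add: tropicalization_def trop_of_def)

text \<open>The open set is found in a single chart. By \<open>scaled_amoeba_chart\<close> it then
  avoids the whole rescaled amoeba, not just the part coming from that chart.\<close>

lemma amoeba_limit_superset:
  assumes P: "P \<in> trop_space N \<Sigma>" "P \<notin> tropicalization N \<Sigma> X"
  shows "\<exists>U. openin (trop_topology N \<Sigma>) U \<and> P \<in> U \<and>
    (\<exists>\<rho>0>0. \<forall>\<rho>. 0 < \<rho> \<and> \<rho> < \<rho>0 \<longrightarrow> trop_scale N \<rho> ` amoeba N \<Sigma> X \<inter> U = {})"
proof -
  obtain \<sigma> w where \<sigma>: "\<sigma> \<in> \<Sigma>" and w: "w \<in> trop_chart N \<sigma>" and Pw: "P = trop_class N \<Sigma> \<sigma> w"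
    using P(1) by (auto simp: trop_space_def)
  have "\<exists>V \<rho>0. openin (trop_chart_topology N \<sigma>) V \<and> w \<in> V \<and> \<rho>0 > 0 \<and>
      (\<forall>\<rho> x. 0 < \<rho> \<and> \<rho> < \<rho>0 \<and> x \<in> chart_part N \<Sigma> X \<sigma> \<longrightarrow> chart_scale \<rho> \<sigma> (trop_of \<sigma> (\<lambda>f. cmod (x f))) \<notin> V)"
  proof (rule ccontr)
    assume no: "\<not> ?thesis"
    obtain s where s: "mult_seminorm N \<sigma> s" "trop_of \<sigma> s = w"
      "\<And>f. f \<in> monoid_algebra N \<sigma> \<Longrightarrow> (\<And>x. x \<in> chart_part N \<Sigma> X \<sigma> \<Longrightarrow> x f = 0) \<Longrightarrow> s f = 0"
    proof (rule limit_point_seminorm[OF w chart_part_affine])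
      show "\<exists>\<rho> x. 0 < \<rho> \<and> \<rho> < \<rho>0 \<and> x \<in> chart_part N \<Sigma> X \<sigma> \<and> chart_scale \<rho> \<sigma> (trop_of \<sigma> (\<lambda>f. cmod (x f))) \<in> V"
        if "openin (trop_chart_topology N \<sigma>) V" "w \<in> V" "\<rho>0 > 0" for V \<rho>0
        using no that by blast
    qed blast
    then have "P \<in> tropicalization N \<Sigma> X"
      unfolding tropicalization_alt Pw using \<sigma>
      by (intro CollectI exI[of _ \<sigma>] exI[of _ s]) (auto simp: chart_ideal_def)
    with P(2) show False by blast
  qed
  then obtain V \<rho>0 where V: "openin (trop_chart_topology N \<sigma>) V" "w \<in> V" and \<rho>0: "\<rho>0 > 0"
    and far: "\<And>\<rho> x. 0 < \<rho> \<Longrightarrow> \<rho> < \<rho>0 \<Longrightarrow> x \<in> chart_part N \<Sigma> X \<sigma> \<Longrightarrow>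
      chart_scale \<rho> \<sigma> (trop_of \<sigma> (\<lambda>f. cmod (x f))) \<notin> V"
    by blast
  have V\<sigma>: "V \<subseteq> trop_chart N \<sigma>" using openin_subset[OF V(1)] by (simp add: topspace_trop_chart_topology)
  show ?thesis
  proof (intro exI[of _ "trop_class N \<Sigma> \<sigma> ` V"] exI[of _ \<rho>0] conjI allI impI \<rho>0)
    show "openin (trop_topology N \<Sigma>) (trop_class N \<Sigma> \<sigma> ` V)" by (rule openin_trop_class_image[OF \<sigma> V(1)])
    show "P \<in> trop_class N \<Sigma> \<sigma> ` V" using V(2) by (simp add: Pw)
    fix \<rho> assume \<rho>: "0 < \<rho> \<and> \<rho> < \<rho>0"
    show "trop_scale N \<rho> ` amoeba N \<Sigma> X \<inter> trop_class N \<Sigma> \<sigma> ` V = {}"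
    proof (rule ccontr)
      assume "\<not> ?thesis"
      then obtain w' where w': "w' \<in> V" "trop_class N \<Sigma> \<sigma> w' \<in> trop_scale N \<rho> ` amoeba N \<Sigma> X" by blast
      obtain x where "x \<in> chart_part N \<Sigma> X \<sigma>" "w' = chart_scale \<rho> \<sigma> (trop_of \<sigma> (\<lambda>f. cmod (x f)))"
        using scaled_amoeba_chart[OF _ \<sigma> _ w'(2)] \<rho> w'(1) V\<sigma> by blast
      then show False using far \<rho> w'(1) by blast
    qed
  qed
qed

text \<open>The points are found in the chart carrying the seminorm: closedness of \<open>X\<close>
  provides equations there, and \<open>U\<close> is open in that chart by definition of the glued
  topology.\<close>

lemma amoeba_limit_subset:
  assumes X: "closed_subvariety N \<Sigma> X" and P: "P \<in> tropicalization N \<Sigma> X"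
    and U: "openin (trop_topology N \<Sigma>) U" "P \<in> U"
  shows "\<exists>\<rho>0>0. \<forall>\<rho>. 0 < \<rho> \<and> \<rho> < \<rho>0 \<longrightarrow> trop_scale N \<rho> ` amoeba N \<Sigma> X \<inter> U \<noteq> {}"
proof -
  obtain \<sigma> s where \<sigma>: "\<sigma> \<in> \<Sigma>" and s: "mult_seminorm N \<sigma> s" "\<forall>f\<in>chart_ideal N \<Sigma> X \<sigma>. s f = 0"
    and Ps: "P = trop_class N \<Sigma> \<sigma> (trop_of \<sigma> s)"
    using P unfolding tropicalization_alt by blast
  obtain F where F: "F \<subseteq> monoid_algebra N \<sigma>" "chart_part N \<Sigma> X \<sigma> = {x \<in> affine_points N \<sigma>. \<forall>f\<in>F. x f = 0}"
    using X \<sigma> unfolding closed_subvariety_def by blast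
  define V where "V = {v \<in> trop_chart N \<sigma>. trop_class N \<Sigma> \<sigma> v \<in> U}"
  have V: "openin (trop_chart_topology N \<sigma>) V"
    using U(1) \<sigma> unfolding openin_trop_topology trop_open_def V_def by blast
  have sV: "trop_of \<sigma> s \<in> V"
    using U(2) trop_of_seminorm_in_chart[OF s(1)] by (simp add: V_def Ps)
  have "s f = 0" if "f \<in> monoid_algebra N \<sigma>" "\<And>x. x \<in> chart_part N \<Sigma> X \<sigma> \<Longrightarrow> x f = 0" for f
    using s(2) that by (auto simp: chart_ideal_def)
  from seminorm_is_limit[OF \<sigma> F s(1) this V sV]
  obtain \<rho>0 where \<rho>0: "\<rho>0 > 0" "\<And>\<rho>. 0 < \<rho> \<Longrightarrow> \<rho> < \<rho>0 \<Longrightarrow>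
      \<exists>x\<in>chart_part N \<Sigma> X \<sigma>. chart_scale \<rho> \<sigma> (trop_of \<sigma> (\<lambda>f. cmod (x f))) \<in> V"
    by blast
  show ?thesis
  proof (intro exI[of _ \<rho>0] conjI allI impI \<rho>0(1))
    fix \<rho> assume \<rho>: "0 < \<rho> \<and> \<rho> < \<rho>0"
    then obtain x where x: "x \<in> chart_part N \<Sigma> X \<sigma>" "chart_scale \<rho> \<sigma> (trop_of \<sigma> (\<lambda>f. cmod (x f))) \<in> V"
      using \<rho>0(2) by blast
    have \<rho>_pos: "0 < \<rho>" using \<rho> by simp
    have "trop_class N \<Sigma> \<sigma> (chart_scale \<rho> \<sigma> (trop_of \<sigma> (\<lambda>f. cmod (x f)))) \<in> trop_scale N \<rho> ` amoeba N \<Sigma> X"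
      unfolding scaled_amoeba[OF \<rho>_pos] using \<sigma> x(1)
      by (intro CollectI exI[of _ \<sigma>] exI[of _ x]) simp
    then show "trop_scale N \<rho> ` amoeba N \<Sigma> X \<inter> U \<noteq> {}"
      using x(2) unfolding V_def by (intro notI) (simp add: disjoint_iff)
  qed
qed

end

theorem mainTheorem2:
  fixes N :: "'v::real_vector set" and \<Sigma> :: "'v set set" and X :: "'v toric_point set"
  assumes "is_lattice N" and "fan N \<Sigma>" and "closed_subvariety N \<Sigma> X"
  shows "kuratowski_limit (trop_topology N \<Sigma>)
           (\<lambda>\<rho>. trop_scale N \<rho> ` amoeba N \<Sigma> X) (tropicalization N \<Sigma> X)"
proof -
  interpret toric_fan N \<Sigma> using assms(1,2) by unfold_locales
  show ?thesis
    unfolding kuratowski_limit_def topspace_trop_topology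
  proof (intro conjI ballI allI impI)
    fix P assume "P \<in> trop_space N \<Sigma> - tropicalization N \<Sigma> X"
    then show "\<exists>U. openin (trop_topology N \<Sigma>) U \<and> P \<in> U \<and>
        (\<exists>\<rho>0>0. \<forall>\<rho>. 0 < \<rho> \<and> \<rho> < \<rho>0 \<longrightarrow> trop_scale N \<rho> ` amoeba N \<Sigma> X \<inter> U = {})"
      by (intro amoeba_limit_superset) auto
  next
    fix P U assume "P \<in> tropicalization N \<Sigma> X" "openin (trop_topology N \<Sigma>) U \<and> P \<in> U"
    then show "\<exists>\<rho>0>0. \<forall>\<rho>. 0 < \<rho> \<and> \<rho> < \<rho>0 \<longrightarrow> trop_scale N \<rho> ` amoeba N \<Sigma> X \<inter> U \<noteq> {}"
      by (intro amoeba_limit_subset[OF assms(3)]) auto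
  qed
qed

end
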